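(* Let $F$ be a $3$-graph. If $\pi_{\mathrm{co}}(F)=0$, then $\pi_{\text{unif}}(F)=0$.
   Context: A $3$-graph is a $3$-uniform hypergraph. For a $3$-graph $H$ and a pair $S\subseteq V(H)$ with $|S|=2$, let $d_H(S)$ be the number of edges of $H$ containing $S$; the minimum codegree $\delta_{\mathrm{co}}(H)$ is the minimum of $d_H(S)$ over all $2$-subsets $S$ of $V(H)$. The codegree Turán number $\mathrm{ex}_{\mathrm{co}}(n,F)$ is the maximum of $\delta_{\mathrm{co}}(H)$ over all $n$-vertex $3$-graphs $H$ containing no copy of $F$, and the codegree Turán density is $\pi_{\mathrm{co}}(F)=\lim_{n\to\infty}\mathrm{ex}_{\mathrm{co}}(n,F)/n$ (this limit exists). For $d\in[0,1]$ and $\eta>0$, an $n$-vertex $3$-graph $H$ is uniformly $(d,\eta)$-dense if for all $U\subseteq V(H)$, $|\binom{U}{3}\cap E(H)|\ge d\binom{|U|}{3}-\eta n^3$. The uniform Turán density $\pi_{\text{unif}}(F)$ is the supremum of all $d\in[0,1]$ such that for every $\eta>0$ and $n_0\in\mathbb{N}$ there exists an $F$-free uniformly $(d,\eta)$-dense $3$-graph $H$ with $|V(H)|\ge n_0$. *)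

theory Defs
  imports Complex_Main
begin

definition is_3graph :: "'a set \<Rightarrow> 'a set set \<Rightarrow> bool" where
  "is_3graph V E \<longleftrightarrow> finite V \<and> (\<forall>e\<in>E. e \<subseteq> V \<and> card e = 3)"

definition contains_copy ::
  "'a set \<Rightarrow> 'a set set \<Rightarrow> 'b set \<Rightarrow> 'b set set \<Rightarrow> bool" where
  "contains_copy VH EH VF EF \<longleftrightarrow>
     (\<exists>f. inj_on f VF \<and> f ` VF \<subseteq> VH \<and> (\<forall>e\<in>EF. f ` e \<in> EH))"

definition codeg :: "'a set set \<Rightarrow> 'a set \<Rightarrow> nat" where
  "codeg E S = card {e \<in> E. S \<subseteq> e}"

text \<open>Minimum codegree over all 2-subsets of V (0 if there are none).\<close>

definition min_codeg :: "'a set \<Rightarrow> 'a set set \<Rightarrow> nat" where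
  "min_codeg V E = Inf {codeg E S | S. S \<subseteq> V \<and> card S = 2}"

text \<open>Codegree Turan number: n-vertex 3-graphs are taken on vertex set {0..<n}
(every n-vertex 3-graph is isomorphic to one of these). Sup of the empty set is 0.\<close>

definition ex_co :: "nat \<Rightarrow> 'b set \<Rightarrow> 'b set set \<Rightarrow> nat" where
  "ex_co n VF EF = Sup {min_codeg {..<n} E | E.
      is_3graph {..<n} E \<and> \<not> contains_copy {..<n} E VF EF}"

definition pi_co :: "'b set \<Rightarrow> 'b set set \<Rightarrow> real" where
  "pi_co VF EF = lim (\<lambda>n. real (ex_co n VF EF) / real n)"

definition unif_dense :: "real \<Rightarrow> real \<Rightarrow> 'a set \<Rightarrow> 'a set set \<Rightarrow> bool" where
  "unif_dense d \<eta> V E \<longleftrightarrow>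
     (\<forall>U\<subseteq>V. real (card {e \<in> E. e \<subseteq> U}) \<ge>
        d * real (card U choose 3) - \<eta> * real (card V) ^ 3)"

definition pi_unif :: "'b set \<Rightarrow> 'b set set \<Rightarrow> real" where
  "pi_unif VF EF = Sup ({0} \<union> {d. 0 \<le> d \<and> d \<le> 1 \<and>
     (\<forall>\<eta>>0. \<forall>n0::nat. \<exists>(V::nat set) E.
        is_3graph V E \<and> \<not> contains_copy V E VF EF \<and>
        unif_dense d \<eta> V E \<and> card V \<ge> n0)})"

end

theory Submission
  imports Defs "HOL-Library.Ramsey" "HOL-Library.Disjoint_Sets"
begin

text \<open>
  Call \<open>F\<close> vanishing if its vertices can be ordered and its pairs coloured red, blue and green such that
  in every edge \<open>x < y < z\<close> the pair \<open>xy\<close> is red, \<open>xz\<close> is blue and \<open>yz\<close> is green. Vanishing is the link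
  between the two densities.

  If \<open>F\<close> is not vanishing, its codegree density is positive. Distribute the vertices over many cyclically
  arranged cells and let a random colouring assign to each pair of vertices a third cell. Join three
  vertices of distinct cells if each pair points to the cell of the third vertex, and join \<open>x < y\<close> in
  cell \<open>i\<close> to \<open>z\<close> in cell \<open>i + 2\<close> if \<open>xz\<close> points to cell \<open>i + 1\<close> and \<open>yz\<close> to cell \<open>i - 1\<close>. All
  codegrees are linear, and a copy of \<open>F\<close> avoids two consecutive cells, so that cutting the cycle there
  shows \<open>F\<close> to be vanishing. Sampling a random subset of the vertices shows that the limit
  defining the codegree density exists.

  If \<open>F\<close> is vanishing, every large uniformly dense 3-graph contains it. Regularise the 3-graph: choose
  cells and a colouring of the pairs between them such that the edge indicators are regular relative to the
  pair colours and the colour classes are quasirandom bipartite graphs. The number of copies of \<open>F\<close> is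
  then governed by a model in which all pair colours are independent. By uniform density and
  Ramsey's theorem all triples among many cells are dense, and a further Ramsey argument picks cells
  for which random red, blue and green colours fit together with probability bounded below
  independently of the number of colours.
\<close>

subsection \<open>Conditional expectations on finite sets\<close>

text \<open>The order of the choices shapes the second half. The tolerance \<open>\<epsilon>\<close>
  for triples is an input of the regularity lemma, which returns the number \<open>2^t\<close> of
  pair colours; so \<open>\<epsilon>\<close> can only be measured against a probability that does
  not see \<open>t\<close>, and the Ramsey selection has to work for arbitrary colour distributions.
  The tolerance \<open>\<mu> t\<close> for pairs may depend on \<open>t\<close>: it has to outweigh
  the number \<open>(2^t) ^ card S\<close> of colour patterns.

  In the first half, transversal triples alone would leave pairs inside a cell with codegree zero;
  this forces the second kind of edge. Its shifts are such that after the cut the third cells of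
  \<open>xz\<close> and \<open>yz\<close> lie between and below, as they do for a transversal edge,
  so that the colour can be read off from the pair alone. The arrangement is cyclic because the
  cells \<open>i - 1\<close> and \<open>i + 2\<close> have to exist for every \<open>i\<close>.

  Both the sampling and the random colouring ask for many hits relative to two fixed coordinates of
  a product set, so one tail bound serves both.\<close>

definition cexp :: "'x set \<Rightarrow> ('x \<Rightarrow> 'c) \<Rightarrow> ('x \<Rightarrow> real) \<Rightarrow> 'x \<Rightarrow> real" where
  "cexp S p h x = (\<Sum>y\<in>{y\<in>S. p y = p x}. h y) / real (card {y\<in>S. p y = p x})"

text \<open>The squared L2 norm of the conditional expectation, without the normalisation by
  \<open>card S\<close>. It is the energy (index) of regularity arguments.\<close>

definition energy :: "'x set \<Rightarrow> ('x \<Rightarrow> 'c) \<Rightarrow> ('x \<Rightarrow> real) \<Rightarrow> real" where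
  "energy S p h = (\<Sum>x\<in>S. (cexp S p h x)\<^sup>2)"

lemma cexp_cong: "p x = p y \<Longrightarrow> cexp S p h x = cexp S p h y"
  by (simp add: cexp_def)

lemma cexp_nonneg: "(\<And>x. x \<in> S \<Longrightarrow> 0 \<le> h x) \<Longrightarrow> 0 \<le> cexp S p h x"
  by (auto simp: cexp_def intro!: divide_nonneg_nonneg sum_nonneg)

lemma cexp_le_1:
  assumes "\<And>x. x \<in> S \<Longrightarrow> h x \<le> 1"
  shows "cexp S p h x \<le> 1"
proof -
  have "(\<Sum>y\<in>{y\<in>S. p y = p x}. h y) \<le> real (card {y\<in>S. p y = p x}) * 1"
    by (rule sum_bounded_above) (use assms in auto)
  then show ?thesis
    by (auto simp: cexp_def divide_le_eq_1)
qed

lemma energy_bounds: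
  assumes "\<And>x. x \<in> S \<Longrightarrow> 0 \<le> h x" "\<And>x. x \<in> S \<Longrightarrow> h x \<le> 1"
  shows "0 \<le> energy S p h" "energy S p h \<le> real (card S)"
proof -
  show "0 \<le> energy S p h"
    by (simp add: energy_def sum_nonneg)
  have "energy S p h \<le> real (card S) * 1"
    unfolding energy_def
    by (rule sum_bounded_above)
      (use cexp_nonneg[of S h p] cexp_le_1[of S h p] assms in \<open>auto simp: power_le_one\<close>)
  then show "energy S p h \<le> real (card S)" by simp
qed

text \<open>Here \<open>g\<close> is measurable for the partition by \<open>p\<close>. Writing out
  the averages gives a double sum over pairs of points in a common class, and exchanging the order
  of summation collapses it.\<close>

lemma sum_cexp_mult:
  assumes fin: "finite S" and meas: "\<And>x y. x \<in> S \<Longrightarrow> y \<in> S \<Longrightarrow> p x = p y \<Longrightarrow> g x = g y"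
  shows "(\<Sum>x\<in>S. cexp S p h x * g x) = (\<Sum>x\<in>S. h x * g x)"
proof -
  let ?n = "\<lambda>x. real (card {y\<in>S. p y = p x})"
  have "(\<Sum>x\<in>S. cexp S p h x * g x) = (\<Sum>x\<in>S. \<Sum>y\<in>{y\<in>S. p y = p x}. h y * g y / ?n y)"
  proof (rule sum.cong)
    fix x assume x: "x \<in> S"
    have "cexp S p h x * g x = (\<Sum>y\<in>{y\<in>S. p y = p x}. h y * g x / ?n x)"
      by (simp add: cexp_def sum_distrib_right sum_divide_distrib)
    also have "\<dots> = (\<Sum>y\<in>{y\<in>S. p y = p x}. h y * g y / ?n y)"
    proof (rule sum.cong)
      fix y assume "y \<in> {y\<in>S. p y = p x}"
      then show "h y * g x / ?n x = h y * g y / ?n y"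
        using meas[of y x] x by simp
    qed simp
    finally show "cexp S p h x * g x = \<dots>" .
  qed simp
  also have "\<dots> = (\<Sum>y\<in>S. \<Sum>x\<in>{x\<in>S. p y = p x}. h y * g y / ?n y)"
    by (rule sum.swap_restrict) (use fin in auto)
  also have "\<dots> = (\<Sum>y\<in>S. h y * g y)"
  proof (rule sum.cong)
    fix y assume y: "y \<in> S"
    have eq: "{x\<in>S. p y = p x} = {x\<in>S. p x = p y}" by auto
    have "card {x\<in>S. p x = p y} > 0"
      using y fin by (auto simp: card_gt_0_iff)
    then show "(\<Sum>x\<in>{x\<in>S. p y = p x}. h y * g y / ?n y) = h y * g y"
      by (simp add: eq)
  qed simp
  finally show ?thesis .
qed

lemma sum_cexp: "finite S \<Longrightarrow> (\<Sum>x\<in>S. cexp S p h x) = (\<Sum>x\<in>S. h x)"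
  using sum_cexp_mult[of S p "\<lambda>_. 1" h] by simp

text \<open>By Pythagoras for the refinement \<open>q\<close> of \<open>p\<close>, the energies
  differ by the squared norm of \<open>?F - ?E\<close>. The test \<open>g\<close> cannot distinguish
  \<open>h\<close> from \<open>?F\<close>, and Cauchy-Schwarz turns its correlation with
  \<open>?F - ?E\<close> into a lower bound for that norm.\<close>

lemma energy_gain:
  assumes fin: "finite S"
    and ref: "\<And>x y. x \<in> S \<Longrightarrow> y \<in> S \<Longrightarrow> q x = q y \<Longrightarrow> p x = p y"
    and meas: "\<And>x y. x \<in> S \<Longrightarrow> y \<in> S \<Longrightarrow> q x = q y \<Longrightarrow> g x = g y"
    and g: "\<And>x. x \<in> S \<Longrightarrow> \<bar>g x\<bar> \<le> 1"
  shows "energy S p h + (\<Sum>x\<in>S. (h x - cexp S p h x) * g x)\<^sup>2 / real (card S) \<le> energy S q h"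
proof -
  let ?E = "cexp S p h" and ?F = "cexp S q h"
  have mE: "\<And>x y. x \<in> S \<Longrightarrow> y \<in> S \<Longrightarrow> q x = q y \<Longrightarrow> ?E x = ?E y"
    by (rule cexp_cong) (rule ref)
  have 1: "(\<Sum>x\<in>S. ?F x * ?E x) = (\<Sum>x\<in>S. ?E x * ?E x)"
  proof -
    have "(\<Sum>x\<in>S. ?F x * ?E x) = (\<Sum>x\<in>S. h x * ?E x)"
      by (rule sum_cexp_mult[OF fin mE])
    also have "\<dots> = (\<Sum>x\<in>S. ?E x * ?E x)"
      by (rule sum_cexp_mult[OF fin cexp_cong, symmetric])
    finally show ?thesis .
  qed
  have 2: "(\<Sum>x\<in>S. (?F x - ?E x)\<^sup>2) = energy S q h - energy S p h"
  proof -
    have "(\<Sum>x\<in>S. (?F x - ?E x)\<^sup>2)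
        = (\<Sum>x\<in>S. (?F x)\<^sup>2 + ?E x * ?E x - 2 * (?F x * ?E x))"
      by (rule sum.cong) (simp_all add: power2_eq_square algebra_simps)
    also have "\<dots> = energy S q h - energy S p h"
      by (simp add: sum.distrib sum_subtractf 1 energy_def power2_eq_square flip: sum_distrib_left)
    finally show ?thesis .
  qed
  have 3: "(\<Sum>x\<in>S. (h x - ?E x) * g x) = (\<Sum>x\<in>S. (?F x - ?E x) * g x)"
  proof -
    have "(\<Sum>x\<in>S. ?F x * g x) = (\<Sum>x\<in>S. h x * g x)"
      by (rule sum_cexp_mult[OF fin meas])
    then show ?thesis by (simp add: left_diff_distrib sum_subtractf)
  qed
  \<comment> \<open>The optimal coefficient for subtracting a multiple of \<open>g\<close> from
    \<open>?F - ?E\<close>, with \<open>card S\<close> in place of the squared norm of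
    \<open>g\<close>, for which it is an upper bound.\<close>
  define a where "a = (\<Sum>x\<in>S. (?F x - ?E x) * g x) / real (card S)"
  show ?thesis
  proof (cases "S = {}")
    case True
    then show ?thesis by (simp add: energy_def)
  next
    case False
    then have S: "real (card S) > 0" using fin by (simp add: card_gt_0_iff)
    have "(\<Sum>x\<in>S. (g x)\<^sup>2) \<le> real (card S) * 1"
      by (rule sum_bounded_above) (use g in \<open>auto simp: abs_square_le_1\<close>)
    then have 4: "a\<^sup>2 * (\<Sum>x\<in>S. (g x)\<^sup>2) \<le> a\<^sup>2 * real (card S)"
      by (intro mult_left_mono) simp_all
    have "0 \<le> (\<Sum>x\<in>S. ((?F x - ?E x) - a * g x)\<^sup>2)"
      by (simp add: sum_nonneg)
    also have "\<dots> = (\<Sum>x\<in>S. (?F x - ?E x)\<^sup>2 - 2 * a * ((?F x - ?E x) * g x) + a\<^sup>2 * (g x)\<^sup>2)"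
      by (rule sum.cong) (simp_all add: power2_eq_square algebra_simps)
    also have "\<dots> = (\<Sum>x\<in>S. (?F x - ?E x)\<^sup>2) - 2 * a * (\<Sum>x\<in>S. (?F x - ?E x) * g x)
        + a\<^sup>2 * (\<Sum>x\<in>S. (g x)\<^sup>2)"
      by (simp add: sum.distrib sum_subtractf sum_distrib_left)
    also have "(\<Sum>x\<in>S. (?F x - ?E x) * g x) = a * real (card S)"
      using S by (simp add: a_def)
    finally have "a\<^sup>2 * real (card S) \<le> energy S q h - energy S p h"
      using 2 4 by (simp add: power2_eq_square algebra_simps)
    moreover have "a\<^sup>2 * real (card S) = (\<Sum>x\<in>S. (?F x - ?E x) * g x)\<^sup>2 / real (card S)"
      using S by (simp add: a_def power2_eq_square)
    ultimately show ?thesis using 3 by simp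
  qed
qed

lemma energy_mono:
  assumes "finite S"
    and "\<And>x y. x \<in> S \<Longrightarrow> y \<in> S \<Longrightarrow> q x = q y \<Longrightarrow> p x = p y"
  shows "energy S p h \<le> energy S q h"
proof -
  have "energy S p h + (\<Sum>x\<in>S. (h x - cexp S p h x) * 0)\<^sup>2 / real (card S) \<le> energy S q h"
    by (rule energy_gain[OF assms]) auto
  then show ?thesis by simp
qed

text \<open>The sum over \<open>x\<close> weights each cell of \<open>\<tau>\<close> by its size. So
  passing to the cell of a random point has, on average, the same effect on the energy as refining
  the partition by \<open>\<tau>\<close>.\<close>

lemma sum_cell_energy:
  assumes fin: "finite S"
  shows "(\<Sum>x\<in>S. energy {y\<in>S. \<tau> y = \<tau> x} p h / real (card {y\<in>S. \<tau> y = \<tau> x}))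
    = energy S (\<lambda>x. (p x, \<tau> x)) h"
proof -
  let ?G = "\<lambda>x. (cexp S (\<lambda>x. (p x, \<tau> x)) h x)\<^sup>2"
  have "energy {y\<in>S. \<tau> y = \<tau> x} p h = (\<Sum>y\<in>{y\<in>S. \<tau> y = \<tau> x}. ?G y)" for x
    unfolding energy_def
  proof (rule sum.cong)
    fix z assume z: "z \<in> {y\<in>S. \<tau> y = \<tau> x}"
    have "{y \<in> {y\<in>S. \<tau> y = \<tau> x}. p y = p z} = {y\<in>S. (p y, \<tau> y) = (p z, \<tau> z)}"
      using z by auto
    then show "(cexp {y\<in>S. \<tau> y = \<tau> x} p h z)\<^sup>2 = ?G z" by (simp add: cexp_def)
  qed simp
  then have "(\<Sum>x\<in>S. energy {y\<in>S. \<tau> y = \<tau> x} p h / real (card {y\<in>S. \<tau> y = \<tau> x}))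
     = (\<Sum>x\<in>S. cexp S \<tau> ?G x)"
    by (simp add: cexp_def)
  also have "\<dots> = (\<Sum>x\<in>S. ?G x)"
    by (rule sum_cexp[OF fin])
  finally show ?thesis by (simp add: energy_def)
qed

lemma sum_inverse_card_cell:
  assumes fin: "finite S"
  shows "(\<Sum>x\<in>S. 1 / real (card {y\<in>S. \<tau> y = \<tau> x})) = real (card (\<tau> ` S))"
proof -
  have "(\<Sum>x\<in>S. 1 / real (card {y\<in>S. \<tau> y = \<tau> x}))
     = (\<Sum>c\<in>\<tau> ` S. \<Sum>x\<in>{x\<in>S. \<tau> x = c}. 1 / real (card {y\<in>S. \<tau> y = \<tau> x}))"
    by (rule sum.image_gen[OF fin])
  also have "\<dots> = (\<Sum>c\<in>\<tau> ` S. 1)"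
  proof (rule sum.cong)
    fix c assume "c \<in> \<tau> ` S"
    then have "card {x\<in>S. \<tau> x = c} > 0" using fin by (auto simp: card_gt_0_iff)
    then show "(\<Sum>x\<in>{x\<in>S. \<tau> x = c}. 1 / real (card {y\<in>S. \<tau> y = \<tau> x})) = 1"
      by simp
  qed simp
  finally show ?thesis by simp
qed

subsection \<open>Regularity against products of functions of fewer coordinates\<close>

definition depends_on :: "'i set \<Rightarrow> (('i \<Rightarrow> 'a) \<Rightarrow> 'b) \<Rightarrow> bool" where
  "depends_on D g \<longleftrightarrow> (\<forall>x y. (\<forall>i\<in>D. x i = y i) \<longrightarrow> g x = g y)"

definition mix :: "'i set \<Rightarrow> ('i \<Rightarrow> 'a) \<Rightarrow> ('i \<Rightarrow> 'a) \<Rightarrow> 'i \<Rightarrow> 'a" where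
  "mix D x y = (\<lambda>i. if i \<in> D then x i else y i)"

definition faces :: "'i set \<Rightarrow> 'i set set" where
  "faces e = (\<lambda>i. e - {i}) ` e"

text \<open>Smallness in a cut norm. For a pair \<open>e\<close> the tests are products of two
  functions of one coordinate each; for a triple they are products of three functions of two
  coordinates each.\<close>

definition regular ::
  "('i \<Rightarrow> 'a) set \<Rightarrow> 'i set \<Rightarrow> (('i \<Rightarrow> 'a) \<Rightarrow> real) \<Rightarrow> real \<Rightarrow> bool" where
  "regular S e g \<epsilon> \<longleftrightarrow> (\<forall>T. (\<forall>s\<in>faces e. depends_on s (T s) \<and> (\<forall>x. 0 \<le> T s x \<and> T s x \<le> 1)) \<longrightarrow>
     \<bar>\<Sum>x\<in>S. g x * (\<Prod>s\<in>faces e. T s x)\<bar> \<le> \<epsilon> * real (card S))"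

lemma depends_onI: "(\<And>x y. (\<And>i. i \<in> D \<Longrightarrow> x i = y i) \<Longrightarrow> g x = g y) \<Longrightarrow> depends_on D g"
  unfolding depends_on_def by blast

lemma depends_onD: "depends_on D g \<Longrightarrow> (\<And>i. i \<in> D \<Longrightarrow> x i = y i) \<Longrightarrow> g x = g y"
  unfolding depends_on_def by blast

lemma finite_faces: "finite e \<Longrightarrow> finite (faces e)"
  by (simp add: faces_def)

text \<open>Exchanging the coordinates in \<open>D\<close> between two points is an involution on
  pairs of points, and the assumption says that it preserves the product weight.\<close>

lemma sum_mix_weighted:
  fixes m Q :: "('i \<Rightarrow> 'a) \<Rightarrow> real"
  assumes "\<And>x y. x \<in> PiE I U \<Longrightarrow> y \<in> PiE I U \<Longrightarrow> m (mix D x y) * m (mix D y x) = m x * m y"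
  shows "(\<Sum>x\<in>PiE I U. \<Sum>y\<in>PiE I U. m x * m y * Q (mix D x y))
    = (\<Sum>x\<in>PiE I U. m x) * (\<Sum>x\<in>PiE I U. m x * Q x)"
proof -
  let ?O = "PiE I U"
  have mem: "mix D x y \<in> ?O" if "x \<in> ?O" "y \<in> ?O" for x y
    using that by (auto simp: mix_def PiE_iff extensional_def)
  have inv: "mix D (mix D x y) (mix D y x) = x" for x y :: "'i \<Rightarrow> 'a"
    by (auto simp: mix_def)
  have "(\<Sum>x\<in>?O. \<Sum>y\<in>?O. m x * m y * Q (mix D x y))
      = (\<Sum>(x, y)\<in>?O \<times> ?O. m x * m y * Q (mix D x y))"
    by (rule sum.cartesian_product)
  also have "\<dots> = (\<Sum>(x, y)\<in>?O \<times> ?O. m x * m y * Q x)"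
    by (rule sum.reindex_bij_witness[where i = "\<lambda>(x, y). (mix D x y, mix D y x)"
          and j = "\<lambda>(x, y). (mix D x y, mix D y x)"])
      (clarsimp simp: inv mem assms)+
  also have "\<dots> = (\<Sum>x\<in>?O. \<Sum>y\<in>?O. m x * m y * Q x)"
    by (rule sum.cartesian_product[symmetric])
  also have "\<dots> = (\<Sum>x\<in>?O. m x) * (\<Sum>x\<in>?O. m x * Q x)"
    by (subst mult.commute, subst sum_product) (simp add: mult_ac)
  finally show ?thesis .
qed

lemma sum_mix:
  fixes Q :: "('i \<Rightarrow> 'a) \<Rightarrow> real"
  shows "(\<Sum>y\<in>PiE I U. \<Sum>x\<in>PiE I U. Q (mix D x y)) = real (card (PiE I U)) * (\<Sum>x\<in>PiE I U. Q x)"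
  using sum_mix_weighted[where m = "\<lambda>_. 1" and I = I and U = U and D = D and Q = Q]
  by (simp add: sum.swap[of "\<lambda>x y. Q (mix D x y)"])

text \<open>A multi-affine function attains its maximum over a cube at a vertex.\<close>

lemma sum_prod_le_if_01:
  fixes g :: "('i \<Rightarrow> 'a) \<Rightarrow> real"
  assumes fin: "finite S" "finite F"
    and bound: "\<And>T. (\<And>s. s \<in> F \<Longrightarrow> depends_on s (T s)) \<Longrightarrow>
        (\<And>s x. s \<in> F \<Longrightarrow> T s x \<in> {0, 1}) \<Longrightarrow> (\<Sum>x\<in>S. g x * (\<Prod>s\<in>F. T s x)) \<le> B"
    and T: "\<And>s. s \<in> F \<Longrightarrow> depends_on s (T s)" "\<And>s x. s \<in> F \<Longrightarrow> 0 \<le> T s x \<and> T s x \<le> 1"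
  shows "(\<Sum>x\<in>S. g x * (\<Prod>s\<in>F. T s x)) \<le> B"
proof -
  have "(\<Sum>x\<in>S. g x * (\<Prod>s\<in>F. T s x)) \<le> B"
    if "finite G" "G \<subseteq> F" "\<And>s. s \<in> F \<Longrightarrow> depends_on s (T s)"
      "\<And>s x. s \<in> F \<Longrightarrow> 0 \<le> T s x \<and> T s x \<le> 1" "\<And>s x. s \<in> F - G \<Longrightarrow> T s x \<in> {0, 1}"
    for G T
    using that
  proof (induction G arbitrary: T rule: finite_induct)
    case empty
    then show ?case by (intro bound) auto
  next
    case (insert s0 G)
    define h where "h x = g x * (\<Prod>s\<in>F - {s0}. T s x)" for x
    define p :: "('i \<Rightarrow> 'a) \<Rightarrow> 'i \<Rightarrow> 'a" where "p x = restrict x s0" for x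
    \<comment> \<open>With all other factors fixed the sum is linear in \<open>T s0\<close>, and
      only the averages of \<open>h\<close> over points with equal coordinates in \<open>s0\<close>
      matter. Taking \<open>1\<close> exactly where such an average is non-negative is
      optimal.\<close>
    define t where "t x = (if cexp S p h x \<ge> 0 then 1 else 0 :: real)" for x
    define T' where "T' = T(s0 := t)"
    have s0: "s0 \<in> F" using insert by auto
    have p: "p x = p y" if "\<And>i. i \<in> s0 \<Longrightarrow> x i = y i" for x y
      unfolding p_def by (rule restrict_ext) (rule that)
    have pD: "x i = y i" if "p x = p y" "i \<in> s0" for x y i
      using that by (metis p_def restrict_apply)
    have dt: "depends_on s0 t"
    proof (rule depends_onI)
      fix x y :: "'i \<Rightarrow> 'a" assume "\<And>i. i \<in> s0 \<Longrightarrow> x i = y i"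
      then have "p x = p y" by (rule p)
      then show "t x = t y" unfolding t_def by (metis cexp_cong)
    qed
    have eq: "g x * (\<Prod>s\<in>F. V s x) = h x * V s0 x" if "\<And>s. s \<noteq> s0 \<Longrightarrow> V s = T s" for V x
    proof -
      have "(\<Prod>s\<in>F. V s x) = V s0 x * (\<Prod>s\<in>F - {s0}. V s x)"
        by (rule prod.remove[OF fin(2) s0])
      also have "(\<Prod>s\<in>F - {s0}. V s x) = (\<Prod>s\<in>F - {s0}. T s x)"
        by (rule prod.cong) (auto simp: that)
      finally show ?thesis by (simp add: h_def)
    qed
    have "(\<Sum>x\<in>S. g x * (\<Prod>s\<in>F. T s x)) = (\<Sum>x\<in>S. h x * T s0 x)"
      by (simp add: eq)
    also have "\<dots> = (\<Sum>x\<in>S. cexp S p h x * T s0 x)"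
    proof (rule sum_cexp_mult[OF fin(1), symmetric])
      fix x y assume "p x = p y"
      then show "T s0 x = T s0 y"
        using pD by (intro depends_onD[OF insert.prems(2)[OF s0]]) auto
    qed
    also have "\<dots> \<le> (\<Sum>x\<in>S. cexp S p h x * t x)"
    proof (rule sum_mono)
      fix x
      show "cexp S p h x * T s0 x \<le> cexp S p h x * t x"
        using insert.prems(3)[OF s0, of x]
        by (cases "cexp S p h x \<ge> 0") (auto simp: t_def mult_left_le mult_nonpos_nonneg)
    qed
    also have "\<dots> = (\<Sum>x\<in>S. h x * t x)"
      by (rule sum_cexp_mult[OF fin(1)]) (auto simp: t_def intro: cexp_cong dest: cexp_cong[of p _ _ S h])
    also have "\<dots> = (\<Sum>x\<in>S. g x * (\<Prod>s\<in>F. T' s x))"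
      by (subst eq) (auto simp: T'_def)
    also have "\<dots> \<le> B"
    proof (rule insert.IH)
      show "G \<subseteq> F" using insert.prems by auto
      show "depends_on s (T' s)" if "s \<in> F" for s
        using insert.prems(2)[OF that] dt by (simp add: T'_def)
      show "0 \<le> T' s x \<and> T' s x \<le> 1" if "s \<in> F" for s x
        using insert.prems(3)[OF that] by (simp add: T'_def t_def)
      show "T' s x \<in> {0, 1}" if "s \<in> F - G" for s x
        using insert.prems(4)[of s x] that by (auto simp: T'_def t_def)
    qed
    finally show ?case .
  qed
  from this[OF fin(2) subset_refl T] show ?thesis by auto
qed

text \<open>A two-valued test can be recorded as one bit of a colour or as a split of a cell, so
  only such tests can drive the regularity lemma. The reduction is the extremal argument for
  \<open>g\<close> and for \<open>- g\<close>.\<close>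

lemma regular_if_01:
  fixes g :: "('i \<Rightarrow> 'a) \<Rightarrow> real"
  assumes "finite S" "finite e"
    and "\<And>T. (\<And>s. s \<in> faces e \<Longrightarrow> depends_on s (T s)) \<Longrightarrow>
        (\<And>s x. s \<in> faces e \<Longrightarrow> T s x \<in> {0, 1}) \<Longrightarrow>
        \<bar>\<Sum>x\<in>S. g x * (\<Prod>s\<in>faces e. T s x)\<bar> \<le> \<epsilon> * real (card S)"
  shows "regular S e g \<epsilon>"
  unfolding regular_def
proof (intro allI impI)
  fix T :: "'i set \<Rightarrow> ('i \<Rightarrow> 'a) \<Rightarrow> real"
  assume T: "\<forall>s\<in>faces e. depends_on s (T s) \<and> (\<forall>x. 0 \<le> T s x \<and> T s x \<le> 1)"
  have 1: "(\<Sum>x\<in>S. g x * (\<Prod>s\<in>faces e. T s x)) \<le> \<epsilon> * real (card S)"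
    by (rule sum_prod_le_if_01) (use assms T finite_faces in \<open>auto simp: abs_le_iff\<close>)
  have 2: "(\<Sum>x\<in>S. (- g x) * (\<Prod>s\<in>faces e. T s x)) \<le> \<epsilon> * real (card S)"
  proof (rule sum_prod_le_if_01)
    fix T :: "'i set \<Rightarrow> ('i \<Rightarrow> 'a) \<Rightarrow> real"
    assume "\<And>s. s \<in> faces e \<Longrightarrow> depends_on s (T s)" "\<And>s x. s \<in> faces e \<Longrightarrow> T s x \<in> {0, 1}"
    from assms(3)[OF this] show "(\<Sum>x\<in>S. (- g x) * (\<Prod>s\<in>faces e. T s x)) \<le> \<epsilon> * real (card S)"
      by (simp add: sum_negf abs_le_iff)
  qed (use assms T finite_faces in auto)
  show "\<bar>\<Sum>x\<in>S. g x * (\<Prod>s\<in>faces e. T s x)\<bar> \<le> \<epsilon> * real (card S)"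
    using 1 2 by (simp add: sum_negf abs_le_iff)
qed

lemma regular_sum_prod:
  fixes g :: "('i \<Rightarrow> 'a) \<Rightarrow> real" and G :: "'i set \<Rightarrow> ('i \<Rightarrow> 'a) \<Rightarrow> real"
  assumes reg: "regular (PiE I U) e0 g \<epsilon>" and fin: "finite (PiE I U)" "finite e0" "finite \<D>"
    and g: "depends_on e0 g"
    and G: "\<And>e. e \<in> \<D> \<Longrightarrow> \<not> e0 \<subseteq> e" "\<And>e. e \<in> \<D> \<Longrightarrow> depends_on e (G e)"
      "\<And>e x. e \<in> \<D> \<Longrightarrow> 0 \<le> G e x \<and> G e x \<le> 1"
  shows "\<bar>\<Sum>x\<in>PiE I U. g x * (\<Prod>e\<in>\<D>. G e x)\<bar> \<le> \<epsilon> * real (card (PiE I U))"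
proof (cases "PiE I U = {}")
  case True
  then show ?thesis by simp
next
  case False
  let ?O = "PiE I U"
  define \<Phi> where "\<Phi> x = g x * (\<Prod>e\<in>\<D>. G e x)" for x
  have "\<exists>s\<in>faces e0. e \<inter> e0 \<subseteq> s" if "e \<in> \<D>" for e
    using G(1)[OF that] by (auto simp: faces_def)
  then obtain \<phi> where \<phi>: "\<And>e. e \<in> \<D> \<Longrightarrow> \<phi> e \<in> faces e0" "\<And>e. e \<in> \<D> \<Longrightarrow> e \<inter> e0 \<subseteq> \<phi> e"
    by metis
  have one: "\<bar>\<Sum>x\<in>?O. \<Phi> (mix e0 x y)\<bar> \<le> \<epsilon> * real (card ?O)" for y
  proof -
    define T where "T s x = (\<Prod>e\<in>{e\<in>\<D>. \<phi> e = s}. G e (mix e0 x y))" for s x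
    have "g (mix e0 x y) = g x" for x
      by (rule depends_onD[OF g]) (simp add: mix_def)
    moreover have "(\<Prod>e\<in>\<D>. G e (mix e0 x y)) = (\<Prod>s\<in>faces e0. T s x)" for x
      unfolding T_def by (rule prod.group[symmetric]) (use fin finite_faces \<phi> in auto)
    ultimately have "(\<Sum>x\<in>?O. \<Phi> (mix e0 x y)) = (\<Sum>x\<in>?O. g x * (\<Prod>s\<in>faces e0. T s x))"
      by (simp add: \<Phi>_def)
    moreover have "depends_on s (T s)" for s
    proof (rule depends_onI)
      fix x x' :: "'i \<Rightarrow> 'a" assume xx: "\<And>i. i \<in> s \<Longrightarrow> x i = x' i"
      show "T s x = T s x'"
        unfolding T_def
      proof (rule prod.cong)
        fix e assume e: "e \<in> {e\<in>\<D>. \<phi> e = s}"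
        show "G e (mix e0 x y) = G e (mix e0 x' y)"
        proof (rule depends_onD[OF G(2)])
          fix i assume "i \<in> e"
          then show "mix e0 x y i = mix e0 x' y i"
            using \<phi>(2)[of e] e xx[of i] by (auto simp: mix_def)
        qed (use e in auto)
      qed simp
    qed
    moreover have "0 \<le> T s x \<and> T s x \<le> 1" for s x
      unfolding T_def by (intro conjI prod_nonneg prod_le_1) (use G(3) in auto)
    ultimately show ?thesis using reg by (auto simp: regular_def)
  qed
  have c: "real (card ?O) > 0" using False fin by (simp add: card_gt_0_iff)
  have "real (card ?O) * \<bar>\<Sum>x\<in>?O. \<Phi> x\<bar> = \<bar>\<Sum>y\<in>?O. \<Sum>x\<in>?O. \<Phi> (mix e0 x y)\<bar>"
    by (simp add: sum_mix abs_mult)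
  also have "\<dots> \<le> (\<Sum>y\<in>?O. \<bar>\<Sum>x\<in>?O. \<Phi> (mix e0 x y)\<bar>)" by (rule sum_abs)
  also have "\<dots> \<le> real (card ?O) * (\<epsilon> * real (card ?O))"
    by (rule sum_bounded_above) (rule one)
  finally show ?thesis using c by (simp add: \<Phi>_def)
qed

text \<open>A telescoping argument: the factors \<open>h e\<close> are replaced by
  \<open>w e\<close> one at a time. As no member of \<open>\<E>\<close> contains another, the
  remaining factors never see all of the current edge. Edges of any size are allowed because the
  lemma serves both pair colours and edges of the 3-graph.\<close>

lemma counting_lemma:
  fixes h w :: "'i set \<Rightarrow> ('i \<Rightarrow> 'a) \<Rightarrow> real"
  assumes fin: "finite (PiE I U)" "finite \<E>" "\<And>e. e \<in> \<E> \<Longrightarrow> finite e"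
    and reg: "\<And>e. e \<in> \<E> \<Longrightarrow> regular (PiE I U) e (\<lambda>x. h e x - w e x) \<epsilon>"
    and dep: "\<And>e. e \<in> \<E> \<Longrightarrow> depends_on e (h e)" "\<And>e. e \<in> \<E> \<Longrightarrow> depends_on e (w e)"
    and bd: "\<And>e x. e \<in> \<E> \<Longrightarrow> 0 \<le> h e x \<and> h e x \<le> 1" "\<And>e x. e \<in> \<E> \<Longrightarrow> 0 \<le> w e x \<and> w e x \<le> 1"
    and anti: "\<And>e e'. e \<in> \<E> \<Longrightarrow> e' \<in> \<E> \<Longrightarrow> e \<subseteq> e' \<Longrightarrow> e = e'"
  shows "\<bar>(\<Sum>x\<in>PiE I U. \<Prod>e\<in>\<E>. h e x) - (\<Sum>x\<in>PiE I U. \<Prod>e\<in>\<E>. w e x)\<bar>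
    \<le> real (card \<E>) * \<epsilon> * real (card (PiE I U))"
proof -
  let ?O = "PiE I U"
  define hyb where "hyb A = (\<Sum>x\<in>?O. \<Prod>e\<in>\<E>. if e \<in> A then w e x else h e x)" for A
  have "\<bar>hyb {} - hyb A\<bar> \<le> real (card A) * \<epsilon> * real (card ?O)" if "finite A" "A \<subseteq> \<E>" for A
    using that
  proof (induction A rule: finite_induct)
    case (insert e0 A)
    define G where "G e x = (if e \<in> A then w e x else h e x)" for e x
    have e0: "e0 \<in> \<E>" using insert by auto
    have pr: "(\<Prod>e\<in>\<E>. if e \<in> B then w e x else h e x)
        = (if e0 \<in> B then w e0 x else h e0 x) * (\<Prod>e\<in>\<E> - {e0}. G e x)"
      if "B = A \<or> B = insert e0 A" for B x
    proof -
      have "(\<Prod>e\<in>\<E>. if e \<in> B then w e x else h e x)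
        = (if e0 \<in> B then w e0 x else h e0 x) * (\<Prod>e\<in>\<E> - {e0}. if e \<in> B then w e x else h e x)"
        by (rule prod.remove[OF fin(2) e0])
      also have "(\<Prod>e\<in>\<E> - {e0}. if e \<in> B then w e x else h e x) = (\<Prod>e\<in>\<E> - {e0}. G e x)"
        by (rule prod.cong) (use that in \<open>auto simp: G_def\<close>)
      finally show ?thesis .
    qed
    have "hyb A - hyb (insert e0 A) = (\<Sum>x\<in>?O. (h e0 x - w e0 x) * (\<Prod>e\<in>\<E> - {e0}. G e x))"
      unfolding hyb_def using insert.hyps pr[of A] pr[of "insert e0 A"]
      by (simp add: left_diff_distrib sum_subtractf)
    also have "\<bar>\<dots>\<bar> \<le> \<epsilon> * real (card ?O)"
    proof (rule regular_sum_prod)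
      show "regular ?O e0 (\<lambda>x. h e0 x - w e0 x) \<epsilon>" by (rule reg[OF e0])
      show "depends_on e0 (\<lambda>x. h e0 x - w e0 x)"
      proof (rule depends_onI)
        fix x y :: "'i \<Rightarrow> 'a" assume a: "\<And>i. i \<in> e0 \<Longrightarrow> x i = y i"
        show "h e0 x - w e0 x = h e0 y - w e0 y"
          using depends_onD[OF dep(1)[OF e0] a] depends_onD[OF dep(2)[OF e0] a] by simp
      qed
      show "depends_on e (G e)" if "e \<in> \<E> - {e0}" for e
        using dep[of e] that by (cases "e \<in> A") (simp_all add: G_def[abs_def])
      show "0 \<le> G e x \<and> G e x \<le> 1" if "e \<in> \<E> - {e0}" for e x
        using bd that by (simp add: G_def)
      show "\<not> e0 \<subseteq> e" if "e \<in> \<E> - {e0}" for e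
        using anti[OF e0, of e] that by auto
    qed (use fin e0 in auto)
    finally have "\<bar>hyb A - hyb (insert e0 A)\<bar> \<le> \<epsilon> * real (card ?O)" .
    moreover have "\<bar>hyb {} - hyb A\<bar> \<le> real (card A) * \<epsilon> * real (card ?O)"
      using insert by auto
    moreover have "real (card (insert e0 A)) = real (card A) + 1"
      using insert.hyps by simp
    ultimately show ?case by (simp add: algebra_simps)
  qed simp
  from this[OF fin(2) subset_refl] have "\<bar>hyb {} - hyb \<E>\<bar> \<le> real (card \<E>) * \<epsilon> * real (card ?O)" .
  moreover have "hyb {} = (\<Sum>x\<in>?O. \<Prod>e\<in>\<E>. h e x)" by (simp add: hyb_def)
  moreover have "hyb \<E> = (\<Sum>x\<in>?O. \<Prod>e\<in>\<E>. w e x)"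
    unfolding hyb_def by (intro sum.cong prod.cong) auto
  ultimately show ?thesis by simp
qed

subsection \<open>The regularity lemma\<close>

definition cols :: "('i set \<Rightarrow> ('i \<Rightarrow> 'a) \<Rightarrow> nat) \<Rightarrow> 'i set \<Rightarrow> ('i \<Rightarrow> 'a) \<Rightarrow> 'i set \<Rightarrow> nat" where
  "cols \<kappa> e x = restrict (\<lambda>s. \<kappa> s x) (faces e)"

text \<open>The first part grows when the pair colours are refined; the second, made of squared
  densities of colour classes, grows on average when cells are split. The weight \<open>c\<close>
  will be small, because refining the colours may lower the second part.\<close>

definition total_energy ::
  "nat \<Rightarrow> (nat set \<Rightarrow> (nat \<Rightarrow> 'a) \<Rightarrow> real) \<Rightarrow> real \<Rightarrow> nat \<Rightarrow> (nat set \<Rightarrow> (nat \<Rightarrow> 'a) \<Rightarrow> nat) \<Rightarrow>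
    (nat \<Rightarrow> 'a) set \<Rightarrow> real" where
  "total_energy N h c t \<kappa> S =
     (\<Sum>e\<in>nsets {..<N} 3. energy S (cols \<kappa> e) (h e)) +
     c * (\<Sum>s\<in>nsets {..<N} 2. \<Sum>a<2^t. energy S (\<lambda>_. ()) (\<lambda>x. of_bool (\<kappa> s x = a)))"

lemma faces_nsets: "e \<in> nsets A (Suc k) \<Longrightarrow> s \<in> faces e \<Longrightarrow> s \<in> nsets A k"
  by (auto simp: faces_def nsets_def)

lemma finite_nsets: "finite A \<Longrightarrow> finite (nsets A k)"
  by (rule finite_imp_finite_nsets)

lemma cols_eqD: "cols \<kappa> e x = cols \<kappa> e y \<Longrightarrow> s \<in> faces e \<Longrightarrow> \<kappa> s x = \<kappa> s y"
  unfolding cols_def by (metis restrict_apply')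

lemma cols_eqI: "(\<And>s. s \<in> faces e \<Longrightarrow> \<kappa> s x = \<kappa> s y) \<Longrightarrow> cols \<kappa> e x = cols \<kappa> e y"
  unfolding cols_def by (rule restrict_ext)

lemma abs_prod_01_le_1:
  fixes T :: "'b \<Rightarrow> real"
  assumes "\<And>f. f \<in> F \<Longrightarrow> T f \<in> {0, 1}"
  shows "\<bar>\<Prod>f\<in>F. T f\<bar> \<le> 1"
  unfolding abs_prod by (rule prod_le_1) (use assms in force)

text \<open>The energy of an indicator is at most its mass, and the colour classes of one pair
  partition \<open>S\<close>. Hence the second part is at most \<open>c\<close> times the number of
  pairs times \<open>card S\<close>, however many colours there are.\<close>

lemma total_energy_bounds:
  fixes h :: "nat set \<Rightarrow> (nat \<Rightarrow> 'a) \<Rightarrow> real"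
  assumes fin: "finite S" and c: "c \<ge> 0"
    and h: "\<And>e x. e \<in> nsets {..<N} 3 \<Longrightarrow> 0 \<le> h e x \<and> h e x \<le> 1"
    and \<kappa>: "\<And>s x. s \<in> nsets {..<N} 2 \<Longrightarrow> \<kappa> s x < 2^t"
  shows "0 \<le> total_energy N h c t \<kappa> S"
    "(\<Sum>e\<in>nsets {..<N} 3. energy S (cols \<kappa> e) (h e)) \<le> total_energy N h c t \<kappa> S"
    "total_energy N h c t \<kappa> S \<le> (\<Sum>e\<in>nsets {..<N} 3. energy S (cols \<kappa> e) (h e))
       + c * real (card (nsets {..<N} 2)) * real (card S)"
    "total_energy N h c t \<kappa> S
      \<le> (real (card (nsets {..<N} 3)) + c * real (card (nsets {..<N} 2))) * real (card S)"
proof -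
  let ?P = "\<lambda>s a x. of_bool (\<kappa> s x = a) :: real"
  let ?E3 = "\<Sum>e\<in>nsets {..<N} 3. energy S (cols \<kappa> e) (h e)"
  let ?E2 = "\<Sum>s\<in>nsets {..<N} 2. \<Sum>a<2^t. energy S (\<lambda>_. ()) (?P s a)"
  have E3: "0 \<le> ?E3" by (intro sum_nonneg energy_bounds(1)) (use h in auto)
  have E3': "?E3 \<le> real (card (nsets {..<N} 3)) * real (card S)"
    by (intro sum_bounded_above energy_bounds(2)) (use h in auto)
  have E2: "0 \<le> ?E2" by (intro sum_nonneg energy_bounds(1)) auto
  have one: "(\<Sum>a<2^t. energy S (\<lambda>_. ()) (?P s a)) \<le> real (card S)"
    if s: "s \<in> nsets {..<N} 2" for s
  proof -
    have "energy S (\<lambda>_. ()) (?P s a) \<le> (\<Sum>x\<in>S. ?P s a x)" for a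
    proof -
      have "energy S (\<lambda>_. ()) (?P s a) \<le> (\<Sum>x\<in>S. cexp S (\<lambda>_. ()) (?P s a) x)"
        unfolding energy_def power2_eq_square
        by (intro sum_mono mult_left_le cexp_le_1 cexp_nonneg) auto
      also have "\<dots> = (\<Sum>x\<in>S. ?P s a x)" by (rule sum_cexp[OF fin])
      finally show ?thesis .
    qed
    then have "(\<Sum>a<2^t. energy S (\<lambda>_. ()) (?P s a)) \<le> (\<Sum>a<2^t. \<Sum>x\<in>S. ?P s a x)"
      by (intro sum_mono)
    also have "\<dots> = (\<Sum>x\<in>S. \<Sum>a<2^t. ?P s a x)" by (rule sum.swap)
    also have "\<dots> = (\<Sum>x\<in>S. 1)"
    proof (rule sum.cong)
      fix x
      have "(\<Sum>a<2^t. ?P s a x) = (\<Sum>a<2^t. if \<kappa> s x = a then 1 else 0)"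
        by (rule sum.cong) auto
      also have "\<dots> = 1" using \<kappa>[OF s, of x] by (subst sum.delta') auto
      finally show "(\<Sum>a<2^t. ?P s a x) = 1" .
    qed simp
    finally show ?thesis by simp
  qed
  have "?E2 \<le> real (card (nsets {..<N} 2)) * real (card S)"
    by (intro sum_bounded_above one)
  then have E2': "c * ?E2 \<le> c * (real (card (nsets {..<N} 2)) * real (card S))"
    using c by (rule mult_left_mono)
  have cE2: "0 \<le> c * ?E2" using c E2 by simp
  show "0 \<le> total_energy N h c t \<kappa> S" "?E3 \<le> total_energy N h c t \<kappa> S"
    "total_energy N h c t \<kappa> S \<le> ?E3 + c * real (card (nsets {..<N} 2)) * real (card S)"
    "total_energy N h c t \<kappa> S
      \<le> (real (card (nsets {..<N} 3)) + c * real (card (nsets {..<N} 2))) * real (card S)"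
    unfolding total_energy_def using E3 E3' cE2 E2' by (simp_all add: algebra_simps)
qed

text \<open>The violated test is appended to the colours of the faces of \<open>e\<close> as a last
  binary digit. The energy of \<open>e\<close> rises by \<open>\<epsilon>\<^sup>2 * card S\<close>,
  that of the other triples does not fall, and the subtracted term pays for a possible loss in the
  second part.\<close>

lemma refine_colouring:
  fixes h :: "nat set \<Rightarrow> (nat \<Rightarrow> 'a) \<Rightarrow> real"
  assumes fin: "finite S" and c: "c \<ge> 0"
    and h: "\<And>e x. e \<in> nsets {..<N} 3 \<Longrightarrow> 0 \<le> h e x \<and> h e x \<le> 1"
    and \<kappa>: "\<And>s x. s \<in> nsets {..<N} 2 \<Longrightarrow> \<kappa> s x < 2^t"
      "\<And>s. s \<in> nsets {..<N} 2 \<Longrightarrow> depends_on s (\<kappa> s)"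
    and e: "e \<in> nsets {..<N} 3"
    and T: "\<And>s. s \<in> faces e \<Longrightarrow> depends_on s (T s)" "\<And>s x. s \<in> faces e \<Longrightarrow> T s x \<in> {0, 1}"
    and irr: "\<bar>\<Sum>x\<in>S. (h e x - cexp S (cols \<kappa> e) (h e) x) * (\<Prod>s\<in>faces e. T s x)\<bar> > \<epsilon> * real (card S)"
    and \<epsilon>: "\<epsilon> \<ge> 0"
  shows "\<exists>\<kappa>'. (\<forall>s\<in>nsets {..<N} 2. depends_on s (\<kappa>' s) \<and> (\<forall>x. \<kappa>' s x < 2^(Suc t))) \<and>
    total_energy N h c (Suc t) \<kappa>' S \<ge> total_energy N h c t \<kappa> S
       + (\<epsilon>\<^sup>2 - c * real (card (nsets {..<N} 2))) * real (card S)"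
proof -
  define \<kappa>' where "\<kappa>' s x = 2 * \<kappa> s x + (if s \<in> faces e \<and> T s x = 1 then 1 else 0)" for s x
  have k1: "\<kappa>' s x < 2^(Suc t)" if "s \<in> nsets {..<N} 2" for s x
    using \<kappa>(1)[OF that, of x] by (auto simp: \<kappa>'_def)
  have k2: "depends_on s (\<kappa>' s)" if s: "s \<in> nsets {..<N} 2" for s
  proof (rule depends_onI)
    fix x y :: "nat \<Rightarrow> 'a" assume xy: "\<And>i. i \<in> s \<Longrightarrow> x i = y i"
    have "\<kappa> s x = \<kappa> s y" by (rule depends_onD[OF \<kappa>(2)[OF s] xy])
    moreover have "T s x = T s y" if "s \<in> faces e"
      by (rule depends_onD[OF T(1)[OF that] xy])
    ultimately show "\<kappa>' s x = \<kappa>' s y" by (auto simp: \<kappa>'_def)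
  qed
  have k3: "\<kappa> s x = \<kappa> s y \<and> (s \<in> faces e \<longrightarrow> T s x = T s y)" if "\<kappa>' s x = \<kappa>' s y" for s x y
  proof -
    have a: "\<kappa> s z = \<kappa>' s z div 2" for z by (auto simp: \<kappa>'_def)
    have b: "T s z = (if odd (\<kappa>' s z) then 1 else 0)" if "s \<in> faces e" for z
      using T(2)[OF that, of z] that by (auto simp: \<kappa>'_def)
    show ?thesis using a b that by simp
  qed
  have ref: "cols \<kappa> e' x = cols \<kappa> e' y" if "cols \<kappa>' e' x = cols \<kappa>' e' y" for e' x y
    by (rule cols_eqI) (use cols_eqD[OF that] k3 in blast)
  have mono: "energy S (cols \<kappa> e') (h e') \<le> energy S (cols \<kappa>' e') (h e')" for e'
    by (rule energy_mono[OF fin]) (rule ref)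
  let ?D = "\<Sum>x\<in>S. (h e x - cexp S (cols \<kappa> e) (h e) x) * (\<Prod>s\<in>faces e. T s x)"
  have gain: "energy S (cols \<kappa> e) (h e) + ?D\<^sup>2 / real (card S) \<le> energy S (cols \<kappa>' e) (h e)"
  proof (rule energy_gain[OF fin])
    fix x y assume *: "cols \<kappa>' e x = cols \<kappa>' e y"
    show "cols \<kappa> e x = cols \<kappa> e y" by (rule ref[OF *])
    show "(\<Prod>s\<in>faces e. T s x) = (\<Prod>s\<in>faces e. T s y)"
    proof (rule prod.cong)
      fix s assume s: "s \<in> faces e"
      from k3[OF cols_eqD[OF * s]] s show "T s x = T s y" by simp
    qed simp
  next
    fix x
    show "\<bar>\<Prod>s\<in>faces e. T s x\<bar> \<le> 1"
      by (rule abs_prod_01_le_1) (rule T(2))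
  qed
  have "(\<epsilon> * real (card S))\<^sup>2 \<le> \<bar>?D\<bar>\<^sup>2"
    using irr \<epsilon> by (intro power_mono) auto
  then have "\<epsilon>\<^sup>2 * real (card S) \<le> ?D\<^sup>2 / real (card S)"
    by (cases "card S = 0") (auto simp: field_simps power2_eq_square)
  then have gain': "energy S (cols \<kappa> e) (h e) + \<epsilon>\<^sup>2 * real (card S) \<le> energy S (cols \<kappa>' e) (h e)"
    using gain by linarith
  have "(\<Sum>e\<in>nsets {..<N} 3. energy S (cols \<kappa> e) (h e)) + \<epsilon>\<^sup>2 * real (card S)
      \<le> (\<Sum>e\<in>nsets {..<N} 3. energy S (cols \<kappa>' e) (h e))"
  proof -
    have f3: "finite (nsets {..<N} 3)" by (simp add: finite_nsets)
    have "(\<Sum>e\<in>nsets {..<N} 3 - {e}. energy S (cols \<kappa> e) (h e))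
        \<le> (\<Sum>e\<in>nsets {..<N} 3 - {e}. energy S (cols \<kappa>' e) (h e))"
      by (rule sum_mono) (rule mono)
    then show ?thesis using gain' sum.remove[OF f3 e, of "\<lambda>e. energy S (cols \<kappa> e) (h e)"]
        sum.remove[OF f3 e, of "\<lambda>e. energy S (cols \<kappa>' e) (h e)"] by linarith
  qed
  moreover have "total_energy N h c t \<kappa> S \<le> (\<Sum>e\<in>nsets {..<N} 3. energy S (cols \<kappa> e) (h e))
       + c * real (card (nsets {..<N} 2)) * real (card S)"
    by (rule total_energy_bounds(3)[OF fin c h \<kappa>(1)])
  moreover have "(\<Sum>e\<in>nsets {..<N} 3. energy S (cols \<kappa>' e) (h e)) \<le> total_energy N h c (Suc t) \<kappa>' S"
    by (rule total_energy_bounds(2)[OF fin c h k1])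
  ultimately have "total_energy N h c (Suc t) \<kappa>' S \<ge> total_energy N h c t \<kappa> S
       + (\<epsilon>\<^sup>2 - c * real (card (nsets {..<N} 2))) * real (card S)"
    by (simp add: algebra_simps)
  with k1 k2 show ?thesis by blast
qed

text \<open>The violated tests of a pair cut \<open>S\<close> into the classes of
  \<open>\<tau>\<close>. Averaged over these classes, every energy becomes that of a partition
  refined by \<open>\<tau>\<close>, and the irregular colour class gains because its test is
  constant on each class.\<close>

lemma split_cells:
  fixes h :: "nat set \<Rightarrow> (nat \<Rightarrow> 'a) \<Rightarrow> real"
  assumes fin: "finite S" and c: "c \<ge> 0"
    and s: "s \<in> nsets {..<N} 2" and a: "a < 2^t"
    and T: "\<And>f x. f \<in> faces s \<Longrightarrow> T f x \<in> {0, 1}"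
    and irr: "\<bar>\<Sum>x\<in>S. (of_bool (\<kappa> s x = a) - cexp S (\<lambda>_. ()) (\<lambda>x. of_bool (\<kappa> s x = a)) x)
      * (\<Prod>f\<in>faces s. T f x)\<bar> > \<epsilon> * real (card S)"
    and \<epsilon>: "\<epsilon> \<ge> 0"
    and \<tau>: "\<tau> = (\<lambda>x. restrict (\<lambda>f. T f x) (faces s))"
  shows "total_energy N h c t \<kappa> S + c * \<epsilon>\<^sup>2 * real (card S)
    \<le> (\<Sum>x\<in>S. total_energy N h c t \<kappa> {y\<in>S. \<tau> y = \<tau> x} / real (card {y\<in>S. \<tau> y = \<tau> x}))"
proof -
  let ?P = "\<lambda>s a x. of_bool (\<kappa> s x = a) :: real"
  let ?F = "\<lambda>s a. energy S (\<lambda>x. ((), \<tau> x)) (?P s a)"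
  have m2: "energy S (\<lambda>_. ()) (?P s a) \<le> ?F s a" for s a
    by (rule energy_mono[OF fin]) auto
  have m3: "energy S (cols \<kappa> e) (h e) \<le> energy S (\<lambda>x. (cols \<kappa> e x, \<tau> x)) (h e)" for e
    by (rule energy_mono[OF fin]) auto
  let ?D = "\<Sum>x\<in>S. (?P s a x - cexp S (\<lambda>_. ()) (?P s a) x) * (\<Prod>f\<in>faces s. T f x)"
  have gain: "energy S (\<lambda>_. ()) (?P s a) + ?D\<^sup>2 / real (card S) \<le> ?F s a"
  proof (rule energy_gain[OF fin])
    fix x y assume "((), \<tau> x) = ((), \<tau> y)"
    then have *: "\<tau> x = \<tau> y" by simp
    have "T f x = T f y" if "f \<in> faces s" for f
      using fun_cong[OF *, of f] that by (simp add: \<tau>)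
    then show "(\<Prod>f\<in>faces s. T f x) = (\<Prod>f\<in>faces s. T f y)"
      by (intro prod.cong) auto
  next
    fix x
    show "\<bar>\<Prod>f\<in>faces s. T f x\<bar> \<le> 1"
      by (rule abs_prod_01_le_1) (rule T)
  qed simp
  have "(\<epsilon> * real (card S))\<^sup>2 \<le> \<bar>?D\<bar>\<^sup>2"
    using irr \<epsilon> by (intro power_mono) auto
  then have "\<epsilon>\<^sup>2 * real (card S) \<le> ?D\<^sup>2 / real (card S)"
    by (cases "card S = 0") (auto simp: field_simps power2_eq_square)
  then have gain': "energy S (\<lambda>_. ()) (?P s a) + \<epsilon>\<^sup>2 * real (card S) \<le> ?F s a"
    using gain by linarith
  have f2: "finite (nsets {..<N} 2)" by (simp add: finite_nsets)
  have "(\<Sum>b<2^t. energy S (\<lambda>_. ()) (?P s b)) + \<epsilon>\<^sup>2 * real (card S) \<le> (\<Sum>b<2^t. ?F s b)"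
  proof -
    have "(\<Sum>b\<in>{..<2^t} - {a}. energy S (\<lambda>_. ()) (?P s b)) \<le> (\<Sum>b\<in>{..<2^t} - {a}. ?F s b)"
      by (rule sum_mono) (rule m2)
    then show ?thesis using gain' a sum.remove[of "{..<2^t}" a "\<lambda>b. energy S (\<lambda>_. ()) (?P s b)"]
        sum.remove[of "{..<2^t}" a "\<lambda>b. ?F s b"] by simp
  qed
  moreover have "(\<Sum>s\<in>nsets {..<N} 2 - {s}. \<Sum>b<2^t. energy S (\<lambda>_. ()) (?P s b))
      \<le> (\<Sum>s\<in>nsets {..<N} 2 - {s}. \<Sum>b<2^t. ?F s b)"
    by (intro sum_mono m2)
  ultimately have "(\<Sum>s\<in>nsets {..<N} 2. \<Sum>b<2^t. energy S (\<lambda>_. ()) (?P s b)) + \<epsilon>\<^sup>2 * real (card S)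
      \<le> (\<Sum>s\<in>nsets {..<N} 2. \<Sum>b<2^t. ?F s b)"
    using sum.remove[OF f2 s, of "\<lambda>s. \<Sum>b<2^t. energy S (\<lambda>_. ()) (?P s b)"]
      sum.remove[OF f2 s, of "\<lambda>s. \<Sum>b<2^t. ?F s b"] by linarith
  from mult_left_mono[OF this c]
  have 2: "c * (\<Sum>s\<in>nsets {..<N} 2. \<Sum>b<2^t. energy S (\<lambda>_. ()) (?P s b)) + c * \<epsilon>\<^sup>2 * real (card S)
      \<le> c * (\<Sum>s\<in>nsets {..<N} 2. \<Sum>b<2^t. ?F s b)"
    by (simp add: algebra_simps)
  have 3: "(\<Sum>e\<in>nsets {..<N} 3. energy S (cols \<kappa> e) (h e))
      \<le> (\<Sum>e\<in>nsets {..<N} 3. energy S (\<lambda>x. (cols \<kappa> e x, \<tau> x)) (h e))"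
    by (rule sum_mono) (rule m3)
  let ?S = "\<lambda>x. {y\<in>S. \<tau> y = \<tau> x}"
  have "(\<Sum>x\<in>S. total_energy N h c t \<kappa> (?S x) / real (card (?S x)))
     = (\<Sum>x\<in>S. (\<Sum>e\<in>nsets {..<N} 3. energy (?S x) (cols \<kappa> e) (h e) / real (card (?S x)))
        + c * (\<Sum>s\<in>nsets {..<N} 2. \<Sum>b<2^t. energy (?S x) (\<lambda>_. ()) (?P s b) / real (card (?S x))))"
    by (simp add: total_energy_def add_divide_distrib flip: sum_divide_distrib)
  also have "\<dots> = (\<Sum>e\<in>nsets {..<N} 3. \<Sum>x\<in>S. energy (?S x) (cols \<kappa> e) (h e) / real (card (?S x)))
     + c * (\<Sum>s\<in>nsets {..<N} 2. \<Sum>b<2^t. \<Sum>x\<in>S. energy (?S x) (\<lambda>_. ()) (?P s b) / real (card (?S x)))"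
    by (simp add: sum.distrib sum_distrib_left[symmetric] sum.swap[of _ _ S])
  also have "\<dots> = (\<Sum>e\<in>nsets {..<N} 3. energy S (\<lambda>x. (cols \<kappa> e x, \<tau> x)) (h e))
     + c * (\<Sum>s\<in>nsets {..<N} 2. \<Sum>b<2^t. ?F s b)"
    by (simp add: sum_cell_energy[OF fin])
  finally show ?thesis using 2 3 by (simp add: total_energy_def)
qed

text \<open>The faces of a pair are singletons, so each test sees one vertex, and fixing the values
  of both shrinks two of the sets \<open>U i\<close>. The classes of \<open>\<tau>\<close> are
  therefore again products of cells.\<close>

lemma cell_eq_PiE:
  fixes T :: "'i set \<Rightarrow> ('i \<Rightarrow> 'a) \<Rightarrow> real"
  assumes s: "s \<in> nsets I 2" and T: "\<And>f. f \<in> faces s \<Longrightarrow> depends_on f (T f)"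
    and \<tau>: "\<tau> = (\<lambda>x. restrict (\<lambda>f. T f x) (faces s))"
  shows "{y \<in> PiE I U. \<tau> y = \<tau> x} = PiE I (\<lambda>i. {u \<in> U i. i \<in> s \<longrightarrow> T {i} (\<lambda>_. u) = T {i} x})"
proof -
  obtain i j where ij: "s = {i, j}" "i \<noteq> j" "i \<in> I" "j \<in> I"
    using s by (auto simp: nsets_2_eq)
  have f: "faces s = {{i}, {j}}"
    using ij by (auto simp: faces_def)
  have sub: "s \<subseteq> I" using ij by auto
  have one: "T {k} y = T {k} (\<lambda>_. y k)" if "k \<in> s" for k y
  proof -
    have "{k} \<in> faces s" using that unfolding f by (auto simp: ij(1))
    then show ?thesis by (intro depends_onD[OF T]) simp_all
  qed
  have "\<tau> y = \<tau> x \<longleftrightarrow> (\<forall>f\<in>faces s. T f y = T f x)" for y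
  proof
    assume *: "\<tau> y = \<tau> x"
    show "\<forall>f\<in>faces s. T f y = T f x"
    proof
      fix f assume "f \<in> faces s"
      then show "T f y = T f x" using fun_cong[OF *, of f] by (simp add: \<tau>)
    qed
  qed (auto simp: \<tau> intro: restrict_ext)
  also have "\<dots> y \<longleftrightarrow> (\<forall>k\<in>s. T {k} (\<lambda>_. y k) = T {k} x)" for y
    unfolding f using one[of i y] one[of j y] by (simp add: ij(1))
  finally have iff: "\<tau> y = \<tau> x \<longleftrightarrow> (\<forall>k\<in>s. T {k} (\<lambda>_. y k) = T {k} x)" for y .
  show ?thesis
    using sub by (auto simp: iff PiE_iff extensional_def)
qed

text \<open>Only one regular tuple of cells is needed, not a partition of all vertices. Shrinking
  the given cells instead of partitioning them leaves no exceptional pairs or triples, and the price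
  is the factor \<open>\<theta>\<close> in their sizes. The precision \<open>\<mu> t\<close> for
  pairs may depend on the number of colours.\<close>

lemma regularity_lemma:
  fixes \<epsilon> :: real and \<mu> :: "nat \<Rightarrow> real"
  assumes \<epsilon>: "\<epsilon> > 0" and \<mu>: "\<And>t. \<mu> t > 0" "antimono \<mu>"
  obtains T \<theta> where "\<theta> > 0" and "\<And>(U0 :: nat \<Rightarrow> 'a set) h.
    (\<And>i. i < N \<Longrightarrow> finite (U0 i) \<and> U0 i \<noteq> {}) \<Longrightarrow>
    (\<And>e x. e \<in> nsets {..<N} 3 \<Longrightarrow> 0 \<le> h e x \<and> h e x \<le> 1) \<Longrightarrow>
    \<exists>t\<le>T. \<exists>U \<kappa>. (\<forall>i<N. U i \<subseteq> U0 i \<and> U i \<noteq> {} \<and> \<theta> * real (card (U0 i)) \<le> real (card (U i))) \<and>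
      (\<forall>s\<in>nsets {..<N} 2. depends_on s (\<kappa> s) \<and> (\<forall>x. \<kappa> s x < 2^t)) \<and>
      (\<forall>e\<in>nsets {..<N} 3. regular (PiE {..<N} U) e
         (\<lambda>x. h e x - cexp (PiE {..<N} U) (cols \<kappa> e) (h e) x) \<epsilon>) \<and>
      (\<forall>s\<in>nsets {..<N} 2. \<forall>a<2^t. regular (PiE {..<N} U) s
         (\<lambda>x. of_bool (\<kappa> s x = a) - cexp (PiE {..<N} U) (\<lambda>_. ()) (\<lambda>x. of_bool (\<kappa> s x = a)) x) (\<mu> t))"
proof -
  define n2 n3 where "n2 = real (card (nsets {..<N} 2))" and "n3 = real (card (nsets {..<N} 3))"
  \<comment> \<open>\<open>c\<close> limits the loss in \<open>refine_colouring\<close> to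
    \<open>\<epsilon>\<^sup>2 / 4\<close>. Splitting a pair makes at most four cells, and
    \<open>4 * lam t\<close> is half of the gain \<open>c * (\<mu> t)\<^sup>2\<close>. The slack
    \<open>\<delta>\<close> must be fixed before \<open>t\<close> is known, hence
    \<open>\<mu> T\<close> in it, which is at most \<open>\<mu> t\<close> once
    \<open>t \<le> T\<close>.\<close>
  define c where "c = \<epsilon>\<^sup>2 / (4 * (n2 + 1))"
  define lam where "lam t = c * (\<mu> t)\<^sup>2 / 8" for t
  define T where "T = nat \<lceil>2 * n3 / \<epsilon>\<^sup>2 + 1\<rceil>"
  define \<delta> where "\<delta> = min (\<epsilon>\<^sup>2 / 8) (c * (\<mu> T)\<^sup>2 / 4)"
  define \<theta> where "\<theta> = exp (- ((n3 + \<epsilon>\<^sup>2) / lam T))"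
  have n: "n2 \<ge> 0" "n3 \<ge> 0" by (simp_all add: n2_def n3_def)
  have e2: "\<epsilon>\<^sup>2 > 0" using \<epsilon> by simp
  have c: "c > 0" "c * n2 \<le> \<epsilon>\<^sup>2 / 4"
    using n e2 by (simp_all add: c_def divide_le_eq algebra_simps)
  have lam: "lam t > 0" for t using c \<mu>(1)[of t] by (simp add: lam_def)
  have lam_mono: "lam t' \<le> lam t" if "t \<le> t'" for t t'
    using antimonoD[OF \<mu>(2) that] \<mu>(1)[of t'] c by (simp add: lam_def power_mono)
  have \<delta>: "\<delta> > 0" using e2 c \<mu>(1)[of T] by (simp add: \<delta>_def)
  have \<theta>: "\<theta> > 0" by (simp add: \<theta>_def)
  have main: "\<exists>t\<le>T. \<exists>U \<kappa>. (\<forall>i<N. U i \<subseteq> U0 i \<and> U i \<noteq> {} \<and> \<theta> * real (card (U0 i)) \<le> real (card (U i))) \<and>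
      (\<forall>s\<in>nsets {..<N} 2. depends_on s (\<kappa> s) \<and> (\<forall>x. \<kappa> s x < 2^t)) \<and>
      (\<forall>e\<in>nsets {..<N} 3. regular (PiE {..<N} U) e
         (\<lambda>x. h e x - cexp (PiE {..<N} U) (cols \<kappa> e) (h e) x) \<epsilon>) \<and>
      (\<forall>s\<in>nsets {..<N} 2. \<forall>a<2^t. regular (PiE {..<N} U) s
         (\<lambda>x. of_bool (\<kappa> s x = a) - cexp (PiE {..<N} U) (\<lambda>_. ()) (\<lambda>x. of_bool (\<kappa> s x = a)) x) (\<mu> t))"
    if U0: "\<And>i. i < N \<Longrightarrow> finite (U0 i) \<and> U0 i \<noteq> {}"
      and h: "\<And>e x. e \<in> nsets {..<N} 3 \<Longrightarrow> 0 \<le> h e x \<and> h e x \<le> 1"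
    for U0 :: "nat \<Rightarrow> 'a set" and h
  proof -
    let ?O = "\<lambda>U. PiE {..<N} U" and ?n = "\<lambda>U. real (card (PiE {..<N} U))"
    let ?TE = "\<lambda>t U \<kappa>. total_energy N h c t \<kappa> (?O U)"
    define cells where "cells U \<longleftrightarrow> (\<forall>i<N. U i \<subseteq> U0 i \<and> U i \<noteq> {})" for U
    define colg where "colg t \<kappa> \<longleftrightarrow> (\<forall>s\<in>nsets {..<N} 2. depends_on s (\<kappa> s) \<and> (\<forall>x. \<kappa> s x < 2^t))"
      for t and \<kappa> :: "nat set \<Rightarrow> (nat \<Rightarrow> 'a) \<Rightarrow> nat"
    \<comment> \<open>At a near-maximiser of \<open>\<Psi>\<close>, the term \<open>\<epsilon>\<^sup>2 / 2\<close> per colour bit forbids refining the colouring for less than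
      the energy gained by an irregular triple, and the logarithm forbids passing to smaller cells for
      less than the energy gained by an irregular pair.\<close>
    define \<Psi> where "\<Psi> t U \<kappa> = ?TE t U \<kappa> / ?n U + lam t * ln (?n U / ?n U0) - real t * \<epsilon>\<^sup>2 / 2"
      for t U \<kappa>
    have finO: "finite (?O U)" and posO: "?n U > 0" and leO: "?n U \<le> ?n U0" if "cells U" for U
    proof -
      have *: "finite (U i)" if "i < N" for i
        using \<open>cells U\<close> U0 that by (meson cells_def finite_subset)
      show f: "finite (?O U)" by (intro finite_PiE) (use * in auto)
      have "?O U \<noteq> {}" using \<open>cells U\<close> by (auto simp: cells_def PiE_eq_empty_iff)
      then show "?n U > 0" using f by (simp add: card_gt_0_iff)
      have "?O U \<subseteq> ?O U0" using \<open>cells U\<close> by (intro PiE_mono) (auto simp: cells_def)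
      moreover have "finite (?O U0)" by (intro finite_PiE) (use U0 in auto)
      ultimately show "?n U \<le> ?n U0" by (simp add: card_mono)
    qed
    have cU0: "cells U0" using U0 by (simp add: cells_def)
    have lnle: "lam t * ln (?n U / ?n U0) \<le> 0" if "cells U" for t U
      using posO[OF that] leO[OF that] lam[of t] posO[OF cU0]
      by (intro mult_nonneg_nonpos) (simp_all add: ln_div)
    have TEb: "0 \<le> ?TE t U \<kappa> / ?n U \<and> ?TE t U \<kappa> / ?n U \<le> n3 + \<epsilon>\<^sup>2 / 4" if "cells U" "colg t \<kappa>" for t U \<kappa>
    proof -
      have \<kappa>: "\<And>s x. s \<in> nsets {..<N} 2 \<Longrightarrow> \<kappa> s x < 2^t" using that(2) by (simp add: colg_def)
      have "0 \<le> ?TE t U \<kappa>"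
        by (rule total_energy_bounds(1)[OF finO[OF that(1)] less_imp_le[OF c(1)] h \<kappa>])
      moreover have "?TE t U \<kappa> \<le> (n3 + c * n2) * ?n U"
        unfolding n2_def n3_def
        by (rule total_energy_bounds(4)[OF finO[OF that(1)] less_imp_le[OF c(1)] h \<kappa>])
      moreover have "(n3 + c * n2) * ?n U \<le> (n3 + \<epsilon>\<^sup>2 / 4) * ?n U"
        using c by (intro mult_right_mono) auto
      ultimately have "0 \<le> ?TE t U \<kappa>" "?TE t U \<kappa> \<le> (n3 + \<epsilon>\<^sup>2 / 4) * ?n U" by linarith+
      then show ?thesis using posO[OF that(1)] by (simp add: divide_le_eq)
    qed
    have \<Psi>le: "\<Psi> t U \<kappa> \<le> n3 + \<epsilon>\<^sup>2 / 4" if "cells U" "colg t \<kappa>" for t U \<kappa>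
    proof -
      have "0 \<le> real t * \<epsilon>\<^sup>2 / 2" by simp
      then show ?thesis using TEb[OF that] lnle[OF that(1), of t] unfolding \<Psi>_def by linarith
    qed
    define A where "A = {\<Psi> t U \<kappa> | t U \<kappa>. cells U \<and> colg t \<kappa>}"
    have col0: "colg 0 (\<lambda>_ _. 0)" by (auto simp: colg_def depends_on_def)
    have A0: "\<Psi> 0 U0 (\<lambda>_ _. 0) \<in> A" using cU0 col0 unfolding A_def by blast
    have bdd: "bdd_above A" using \<Psi>le by (auto simp: A_def intro!: bdd_aboveI)
    have "\<exists>y\<in>A. Sup A - \<delta> < y"
      using less_cSupD[of A "Sup A - \<delta>"] A0 \<delta> by auto
    then obtain t U \<kappa> where cU: "cells U" and ck: "colg t \<kappa>" and near: "Sup A - \<delta> < \<Psi> t U \<kappa>"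
      by (auto simp: A_def)
    have max: "\<Psi> t' U' \<kappa>' \<le> \<Psi> t U \<kappa> + \<delta>" if "cells U'" "colg t' \<kappa>'" for t' U' \<kappa>'
    proof -
      have "\<Psi> t' U' \<kappa>' \<in> A" using that unfolding A_def by blast
      then have "\<Psi> t' U' \<kappa>' \<le> Sup A" using bdd by (rule cSup_upper)
      with near show ?thesis by simp
    qed
    \<comment> \<open>The comparison with the undivided cells and a single colour, where
      \<open>\<Psi>\<close> is non-negative. It bounds both the number \<open>t\<close> of bits and
      the logarithmic price paid so far.\<close>
    have low: "\<Psi> t U \<kappa> \<ge> - \<delta>"
      using max[OF cU0 col0] TEb[OF cU0 col0] posO[OF cU0] by (simp add: \<Psi>_def)
    have d8: "\<delta> \<le> \<epsilon>\<^sup>2 / 8" by (simp add: \<delta>_def)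
    have tT: "t \<le> T"
    proof -
      have "real t * \<epsilon>\<^sup>2 / 2 \<le> n3 + \<epsilon>\<^sup>2 / 4 + \<delta>"
        using low TEb[OF cU ck] lnle[OF cU, of t] unfolding \<Psi>_def by linarith
      then have "real t * \<epsilon>\<^sup>2 \<le> 2 * n3 + \<epsilon>\<^sup>2" using d8 e2 by linarith
      then have "real t \<le> 2 * n3 / \<epsilon>\<^sup>2 + 1" using e2 by (simp add: field_simps)
      then show ?thesis unfolding T_def by linarith
    qed
    have \<kappa>: "\<And>s x. s \<in> nsets {..<N} 2 \<Longrightarrow> \<kappa> s x < 2^t" "\<And>s. s \<in> nsets {..<N} 2 \<Longrightarrow> depends_on s (\<kappa> s)"
      using ck by (auto simp: colg_def)
    have size: "\<theta> * real (card (U0 i)) \<le> real (card (U i))" if i: "i < N" for i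
    proof -
      have "lam t * ln (?n U / ?n U0) \<ge> - (n3 + \<epsilon>\<^sup>2)"
      proof -
        have "0 \<le> real t * \<epsilon>\<^sup>2 / 2" by simp
        then show ?thesis using low TEb[OF cU ck] d8 e2 unfolding \<Psi>_def by linarith
      qed
      then have "ln (?n U / ?n U0) \<ge> - ((n3 + \<epsilon>\<^sup>2) / lam t)"
        using lam[of t] by (simp add: field_simps)
      moreover have "(n3 + \<epsilon>\<^sup>2) / lam t \<le> (n3 + \<epsilon>\<^sup>2) / lam T"
        using lam lam_mono[OF tT] n e2 by (intro divide_left_mono mult_pos_pos) auto
      ultimately have "ln (?n U / ?n U0) \<ge> - ((n3 + \<epsilon>\<^sup>2) / lam T)" by linarith
      then have "?n U / ?n U0 \<ge> \<theta>"
        using posO[OF cU] posO[OF cU0] by (simp add: \<theta>_def ln_ge_iff)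
      then have 1: "\<theta> * ?n U0 \<le> ?n U" using posO[OF cU0] by (simp add: field_simps)
      \<comment> \<open>A lower bound for the size of the product gives one for each factor, since
        the other factors have only shrunk.\<close>
      let ?R = "\<lambda>V. \<Prod>j\<in>{..<N} - {i}. real (card (V j))"
      have pr: "?n V = real (card (V i)) * ?R V" for V
        using i by (simp add: card_PiE prod.remove[of "{..<N}" i])
      have R: "?R U \<le> ?R U0"
        using cU U0 by (intro prod_mono) (auto simp: cells_def card_mono)
      have R0: "?R U0 > 0" using U0 by (intro prod_pos) (auto simp: card_gt_0_iff)
      have "\<theta> * real (card (U0 i)) * ?R U0 \<le> real (card (U i)) * ?R U"
        using 1 unfolding pr by (simp add: mult_ac)
      also have "\<dots> \<le> real (card (U i)) * ?R U0" using R by (intro mult_left_mono) auto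
      finally show ?thesis using R0 by simp
    qed
    have reg3: "regular (?O U) e (\<lambda>x. h e x - cexp (?O U) (cols \<kappa> e) (h e) x) \<epsilon>"
      if e: "e \<in> nsets {..<N} 3" for e
    proof (rule regular_if_01[OF finO[OF cU]])
      show "finite e" using e by (simp add: nsets_def)
      fix T :: "nat set \<Rightarrow> (nat \<Rightarrow> 'a) \<Rightarrow> real"
      assume T: "\<And>s. s \<in> faces e \<Longrightarrow> depends_on s (T s)" "\<And>s x. s \<in> faces e \<Longrightarrow> T s x \<in> {0, 1}"
      show "\<bar>\<Sum>x\<in>?O U. (h e x - cexp (?O U) (cols \<kappa> e) (h e) x) * (\<Prod>s\<in>faces e. T s x)\<bar> \<le> \<epsilon> * ?n U"
      proof (rule ccontr)
        assume "\<not> ?thesis"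
        then have irr: "\<epsilon> * ?n U < \<bar>\<Sum>x\<in>?O U. (h e x - cexp (?O U) (cols \<kappa> e) (h e) x) * (\<Prod>s\<in>faces e. T s x)\<bar>"
          by simp
        have "\<exists>\<kappa>'. (\<forall>s\<in>nsets {..<N} 2. depends_on s (\<kappa>' s) \<and> (\<forall>x. \<kappa>' s x < 2^(Suc t))) \<and>
          ?TE (Suc t) U \<kappa>' \<ge> ?TE t U \<kappa> + (\<epsilon>\<^sup>2 - c * n2) * ?n U"
          unfolding n2_def
          by (rule refine_colouring[where T = T]; fact finO[OF cU] less_imp_le[OF c(1)] h \<kappa> e T irr less_imp_le[OF \<epsilon>])
        then obtain \<kappa>' where k: "colg (Suc t) \<kappa>'"
          "?TE (Suc t) U \<kappa>' \<ge> ?TE t U \<kappa> + (\<epsilon>\<^sup>2 - c * n2) * ?n U"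
          unfolding colg_def by blast
        have "?TE (Suc t) U \<kappa>' / ?n U \<ge> ?TE t U \<kappa> / ?n U + (\<epsilon>\<^sup>2 - c * n2)"
        proof -
          have "(?TE t U \<kappa> + (\<epsilon>\<^sup>2 - c * n2) * ?n U) / ?n U \<le> ?TE (Suc t) U \<kappa>' / ?n U"
            by (rule divide_right_mono[OF k(2)]) simp
          then show ?thesis using posO[OF cU] by (simp add: add_divide_distrib)
        qed
        moreover have "lam (Suc t) * ln (?n U / ?n U0) \<ge> lam t * ln (?n U / ?n U0)"
          using lam_mono[of t "Suc t"] leO[OF cU] posO[OF cU]
          by (intro mult_right_mono_neg) (simp_all add: ln_div)
        moreover have "real (Suc t) * \<epsilon>\<^sup>2 / 2 = real t * \<epsilon>\<^sup>2 / 2 + \<epsilon>\<^sup>2 / 2"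
          by (simp add: algebra_simps)
        moreover have "\<Psi> (Suc t) U \<kappa>' \<le> \<Psi> t U \<kappa> + \<delta>"
          by (rule max[OF cU k(1)])
        ultimately have "\<epsilon>\<^sup>2 - c * n2 - \<epsilon>\<^sup>2 / 2 \<le> \<delta>" unfolding \<Psi>_def by linarith
        then show False using c d8 e2 by simp
      qed
    qed
    have reg2: "regular (?O U) s (\<lambda>x. of_bool (\<kappa> s x = a)
         - cexp (?O U) (\<lambda>_. ()) (\<lambda>x. of_bool (\<kappa> s x = a)) x) (\<mu> t)"
      if s: "s \<in> nsets {..<N} 2" and a: "a < 2^t" for s a
    proof (rule regular_if_01[OF finO[OF cU]])
      show "finite s" using s by (simp add: nsets_def)
      fix T' :: "nat set \<Rightarrow> (nat \<Rightarrow> 'a) \<Rightarrow> real"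
      assume T': "\<And>f. f \<in> faces s \<Longrightarrow> depends_on f (T' f)" "\<And>f x. f \<in> faces s \<Longrightarrow> T' f x \<in> {0, 1}"
      let ?D = "\<Sum>x\<in>?O U. (of_bool (\<kappa> s x = a) - cexp (?O U) (\<lambda>_. ()) (\<lambda>x. of_bool (\<kappa> s x = a)) x)
          * (\<Prod>f\<in>faces s. T' f x)"
      show "\<bar>?D\<bar> \<le> \<mu> t * ?n U"
      proof (rule ccontr)
        assume "\<not> \<bar>?D\<bar> \<le> \<mu> t * ?n U"
        then have irr: "\<bar>?D\<bar> > \<mu> t * ?n U" by simp
        define \<tau> where "\<tau> = (\<lambda>x. restrict (\<lambda>f. T' f x) (faces s))"
        let ?S = "\<lambda>x. {y \<in> ?O U. \<tau> y = \<tau> x}"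
        let ?E = "?TE t U \<kappa> / ?n U"
        have "?TE t U \<kappa> + c * (\<mu> t)\<^sup>2 * ?n U
           \<le> (\<Sum>x\<in>?O U. total_energy N h c t \<kappa> (?S x) / real (card (?S x)))"
          by (rule split_cells[where T = T' and s = s and a = a];
              fact finO[OF cU] less_imp_le[OF c(1)] s a T'(2) irr less_imp_le[OF \<mu>(1)] \<tau>_def)
        \<comment> \<open>No class of \<open>\<tau>\<close> can beat the near-maximiser by more than
          \<open>\<delta>\<close>, so its energy exceeds \<open>?E\<close> by at most
          \<open>\<delta>\<close> and the logarithmic price. After \<open>ln z \<le> z\<close> the
          sum of these prices depends only on the number of classes.\<close>
        also have "\<dots> \<le> (\<Sum>x\<in>?O U. ?E + \<delta> + lam t * ?n U * (1 / real (card (?S x))))"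
        proof (rule sum_mono)
          fix x assume x: "x \<in> ?O U"
          define U' where "U' i = {u \<in> U i. i \<in> s \<longrightarrow> T' {i} (\<lambda>_. u) = T' {i} x}" for i
          have S: "?S x = ?O U'"
            unfolding U'_def by (rule cell_eq_PiE[where T = T']; fact s T'(1) \<tau>_def)
          have "x \<in> ?O U'" using x S by auto
          then have cU': "cells U'" using cU by (auto simp: cells_def U'_def PiE_iff)
          have "\<Psi> t U' \<kappa> \<le> \<Psi> t U \<kappa> + \<delta>" by (rule max[OF cU' ck])
          then have "?TE t U' \<kappa> / ?n U' \<le> ?E + \<delta> + lam t * (ln (?n U / ?n U0) - ln (?n U' / ?n U0))"
            by (simp add: \<Psi>_def algebra_simps)
          also have "ln (?n U / ?n U0) - ln (?n U' / ?n U0) = ln (?n U / ?n U')"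
            using posO[OF cU] posO[OF cU'] posO[OF cU0] by (simp add: ln_div)
          also have "lam t * ln (?n U / ?n U') \<le> lam t * (?n U / ?n U')"
            using lam[of t] posO[OF cU] posO[OF cU'] ln_bound[of "?n U / ?n U'"]
            by (intro mult_left_mono) auto
          finally show "total_energy N h c t \<kappa> (?S x) / real (card (?S x))
              \<le> ?E + \<delta> + lam t * ?n U * (1 / real (card (?S x)))"
            by (simp add: S)
        qed
        also have "\<dots> = ?n U * (?E + \<delta>) + lam t * ?n U * real (card (\<tau> ` ?O U))"
          by (simp add: sum.distrib sum_distrib_left[symmetric] sum_inverse_card_cell[OF finO[OF cU]]
              del: times_divide_eq_right)
        also have "\<dots> \<le> ?n U * (?E + \<delta>) + lam t * ?n U * 4"
        proof -
          have fs: "finite (faces s)" "card (faces s) \<le> 2"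
            using s card_image_le[of s "\<lambda>i. s - {i}"] by (auto simp: faces_def nsets_def)
          have "\<tau> ` ?O U \<subseteq> PiE (faces s) (\<lambda>_. {0, 1})"
            unfolding \<tau>_def by (rule image_subsetI, rule restrict_PiE_iff[THEN iffD2]) (use T'(2) in blast)
          then have "card (\<tau> ` ?O U) \<le> card (PiE (faces s) (\<lambda>_. {0, 1 :: real}))"
            by (intro card_mono finite_PiE fs) auto
          also have "\<dots> = 2 ^ card (faces s)" using fs by (simp add: card_PiE numeral_2_eq_2)
          also have "\<dots> \<le> 2 ^ 2" using fs by (intro power_increasing) auto
          finally have "real (card (\<tau> ` ?O U)) \<le> 4" by simp
          then show ?thesis using lam[of t] by (intro add_left_mono mult_left_mono) auto
        qed
        finally have "c * (\<mu> t)\<^sup>2 * ?n U \<le> (\<delta> + lam t * 4) * ?n U"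
          using posO[OF cU] by (simp add: algebra_simps)
        then have "c * (\<mu> t)\<^sup>2 \<le> \<delta> + lam t * 4" using posO[OF cU] by simp
        moreover have "\<delta> \<le> c * (\<mu> t)\<^sup>2 / 4"
        proof -
          have "c * (\<mu> T)\<^sup>2 \<le> c * (\<mu> t)\<^sup>2"
            using antimonoD[OF \<mu>(2) tT] \<mu>(1)[of T] c by (intro mult_left_mono power_mono) auto
          then show ?thesis by (simp add: \<delta>_def)
        qed
        ultimately have "c * (\<mu> t)\<^sup>2 \<le> 0" by (simp add: lam_def)
        then show False using c(1) \<mu>(1)[of t] by (simp add: mult_le_0_iff)
      qed
    qed
    show ?thesis
    proof (intro exI conjI)
      show "t \<le> T" by (rule tT)
      show "\<forall>i<N. U i \<subseteq> U0 i \<and> U i \<noteq> {} \<and> \<theta> * real (card (U0 i)) \<le> real (card (U i))"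
        using cU size by (simp add: cells_def)
      show "\<forall>s\<in>nsets {..<N} 2. depends_on s (\<kappa> s) \<and> (\<forall>x. \<kappa> s x < 2^t)"
        using ck by (simp add: colg_def)
    qed (use reg3 reg2 in simp_all)
  qed
  show thesis by (rule that[OF \<theta>]) (rule main)
qed

subsection \<open>Random colourings\<close>

definition cweights :: "'s set \<Rightarrow> nat \<Rightarrow> ('s \<Rightarrow> nat \<Rightarrow> real) \<Rightarrow> bool" where
  "cweights S K p \<longleftrightarrow> finite S \<and> (\<forall>s\<in>S. (\<forall>a. 0 \<le> p s a) \<and> (\<Sum>a<K. p s a) = 1)"

text \<open>The expectation of \<open>Q\<close> when the members \<open>s\<close> of
  \<open>S\<close> get independent colours, with colour \<open>a\<close> having probability
  \<open>p s a\<close>.\<close>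

definition cE :: "'s set \<Rightarrow> nat \<Rightarrow> ('s \<Rightarrow> nat \<Rightarrow> real) \<Rightarrow> (('s \<Rightarrow> nat) \<Rightarrow> real) \<Rightarrow> real" where
  "cE S K p Q = (\<Sum>X\<in>PiE S (\<lambda>_. {..<K}). (\<Prod>s\<in>S. p s (X s)) * Q X)"

lemma cE_prod:
  assumes "cweights S K p"
  shows "cE S K p (\<lambda>X. \<Prod>s\<in>S. g s (X s)) = (\<Prod>s\<in>S. \<Sum>a<K. p s a * g s a)"
  using prod_sum_PiE[of S "\<lambda>_. {..<K}" "\<lambda>s a. p s a * g s a"] assms
  by (simp add: cE_def cweights_def prod.distrib)

lemma cE_mono:
  assumes "cweights S K p" "\<And>X. Q X \<le> Q' X"
  shows "cE S K p Q \<le> cE S K p Q'"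
  unfolding cE_def
  by (intro sum_mono mult_left_mono prod_nonneg) (use assms in \<open>auto simp: cweights_def\<close>)

lemma cE_cmult: "cE S K p (\<lambda>X. c * Q X) = c * cE S K p Q"
  by (simp add: cE_def sum_distrib_left mult_ac)

lemma cE_const:
  assumes "cweights S K p"
  shows "cE S K p (\<lambda>_. c) = c"
proof -
  have "cE S K p (\<lambda>X. \<Prod>s\<in>S. 1) = 1"
    using assms by (subst cE_prod) (simp_all add: cweights_def)
  then show ?thesis using cE_cmult[of S K p c "\<lambda>_. 1"] by simp
qed

lemma cE_sum: "cE S K p (\<lambda>X. \<Sum>i\<in>I. Q i X) = (\<Sum>i\<in>I. cE S K p (Q i))"
  unfolding cE_def by (simp add: sum_distrib_left) (rule sum.swap)

lemma cE_bounds: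
  assumes "cweights S K p"
  shows "(\<And>X. 0 \<le> Q X) \<Longrightarrow> 0 \<le> cE S K p Q" "(\<And>X. Q X \<le> 1) \<Longrightarrow> cE S K p Q \<le> 1"
  using cE_mono[OF assms, of "\<lambda>_. 0" Q] cE_mono[OF assms, of Q "\<lambda>_. 1"] cE_const[OF assms]
  by simp_all

lemma cE_marginal:
  assumes "cweights S K p" "s \<in> S"
  shows "cE S K p (\<lambda>X. g (X s)) = (\<Sum>a<K. p s a * g a)"
proof -
  have fin: "finite S" using assms by (simp add: cweights_def)
  have "cE S K p (\<lambda>X. g (X s)) = cE S K p (\<lambda>X. \<Prod>s'\<in>S. if s' = s then g (X s') else 1)"
    using fin assms(2) by (simp add: prod.delta)
  also have "\<dots> = (\<Prod>s'\<in>S. \<Sum>a<K. p s' a * (if s' = s then g a else 1))"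
    by (rule cE_prod[OF assms(1)])
  also have "\<dots> = (\<Prod>s'\<in>S. if s' = s then \<Sum>a<K. p s a * g a else 1)"
    using assms by (intro prod.cong) (auto simp: cweights_def)
  also have "\<dots> = (\<Sum>a<K. p s a * g a)"
    using fin assms(2) by (simp add: prod.delta)
  finally show ?thesis .
qed

lemma cE_forall_ge:
  assumes w: "cweights S K p" and sub: "F \<subseteq> S" and c: "0 \<le> c"
    and B: "\<And>s. s \<in> F \<Longrightarrow> c \<le> (\<Sum>a<K. p s a * of_bool (a \<in> B s))"
  shows "c ^ card F \<le> cE S K p (\<lambda>X. of_bool (\<forall>s\<in>F. X s \<in> B s))"
proof -
  have fin: "finite S" "finite F" using w sub finite_subset by (auto simp: cweights_def)
  have "c ^ card F = (\<Prod>s\<in>S. if s \<in> F then c else 1)"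
    using fin sub by (subst prod.If_cases) (auto simp: Int_absorb1)
  also have "\<dots> \<le> (\<Prod>s\<in>S. \<Sum>a<K. p s a * (if s \<in> F then of_bool (a \<in> B s) else 1))"
    using B c w by (intro prod_mono) (auto simp: cweights_def)
  also have "\<dots> = cE S K p (\<lambda>X. \<Prod>s\<in>S. if s \<in> F then of_bool (X s \<in> B s) else 1)"
    by (rule cE_prod[OF w, symmetric])
  also have "(\<lambda>X. \<Prod>s\<in>S. if s \<in> F then of_bool (X s \<in> B s) else 1 :: real)
      = (\<lambda>X. of_bool (\<forall>s\<in>F. X s \<in> B s))"
  proof
    fix X :: "'a \<Rightarrow> nat"
    have "(\<Prod>s\<in>S. if s \<in> F then of_bool (X s \<in> B s) else 1 :: real) = (\<Prod>s\<in>F. of_bool (X s \<in> B s))"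
      using fin sub by (subst prod.If_cases) (auto simp: Int_absorb1)
    also have "\<dots> = of_bool (\<forall>s\<in>F. X s \<in> B s)"
      using fin(2) by (induction F rule: finite_induct) auto
    finally show "(\<Prod>s\<in>S. if s \<in> F then of_bool (X s \<in> B s) else 1 :: real) = of_bool (\<forall>s\<in>F. X s \<in> B s)" .
  qed
  finally show ?thesis .
qed

text \<open>Taking some colours from one random colouring and the others from an independent copy
  yields a colouring with the same distribution. This allows pairs in different roles to be coloured
  by independent copies.\<close>

lemma cE_mix:
  assumes "cweights S K p"
  shows "cE S K p (\<lambda>X. cE S K p (\<lambda>Y. Q (mix D X Y))) = cE S K p Q"
proof -
  let ?O = "PiE S (\<lambda>_. {..<K})" and ?m = "\<lambda>X. \<Prod>s\<in>S. p s (X s)"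
  have "cE S K p (\<lambda>X. cE S K p (\<lambda>Y. Q (mix D X Y))) = (\<Sum>X\<in>?O. \<Sum>Y\<in>?O. ?m X * ?m Y * Q (mix D X Y))"
    by (simp add: cE_def sum_distrib_left mult_ac)
  also have "\<dots> = (\<Sum>X\<in>?O. ?m X) * (\<Sum>X\<in>?O. ?m X * Q X)"
  proof (rule sum_mix_weighted)
    fix X Y :: "'a \<Rightarrow> nat"
    show "?m (mix D X Y) * ?m (mix D Y X) = ?m X * ?m Y"
      unfolding prod.distrib[symmetric] by (intro prod.cong) (auto simp: mix_def)
  qed
  also have "(\<Sum>X\<in>?O. ?m X) = 1"
    using cE_const[OF assms, of 1] by (simp add: cE_def)
  finally show ?thesis by (simp add: cE_def)
qed

lemma cE_mix3:
  assumes "cweights S K p"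
  shows "cE S K p (\<lambda>X. cE S K p (\<lambda>Y. cE S K p (\<lambda>Z. Q (mix D X (mix D' Y Z))))) = cE S K p Q"
  using cE_mix[OF assms, of "\<lambda>W. Q (mix D X W)" D' for X] cE_mix[OF assms, of Q D] by simp

subsection \<open>Selecting cells by Ramsey's theorem\<close>

lemma ramsey_set:
  obtains R where "\<And>(J :: 'a set) P. finite J \<Longrightarrow> R \<le> card J \<Longrightarrow>
    \<exists>H\<subseteq>J. (card H = q1 \<and> (\<forall>Y\<in>nsets H r. P Y)) \<or> (card H = q2 \<and> (\<forall>Y\<in>nsets H r. \<not> P Y))"
proof -
  obtain R :: nat where R: "partn_lst {..<R} [q1, q2] r" using ramsey_full by blast
  have "\<exists>H\<subseteq>J. (card H = q1 \<and> (\<forall>Y\<in>nsets H r. P Y)) \<or> (card H = q2 \<and> (\<forall>Y\<in>nsets H r. \<not> P Y))"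
    if J: "finite J" "R \<le> card J" for J :: "'a set" and P
  proof -
    obtain \<phi> where \<phi>: "bij_betw \<phi> {..<card J} J"
      using ex_bij_betw_nat_finite[OF J(1)] by (auto simp: atLeast0LessThan)
    have inj: "inj_on \<phi> {..<R}" and im: "\<phi> ` {..<R} \<subseteq> J"
      using \<phi> J(2) by (auto simp: bij_betw_def intro: inj_on_subset)
    define g where "g Y = (if P (\<phi> ` Y) then 0 else 1 :: nat)" for Y
    have "g \<in> nsets {..<R} r \<rightarrow> {..<length [q1, q2]}" by (auto simp: g_def)
    from R[unfolded partn_lst_def, rule_format, OF this]
    obtain i H where i: "i < Suc (Suc 0)" and H: "H \<in> nsets {..<R} ([q1, q2] ! i)" and g: "g ` nsets H r \<subseteq> {i}"
      unfolding monochromatic_def by auto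
    have HR: "H \<subseteq> {..<R}" "card H = [q1, q2] ! i" using H by (auto simp: nsets_def)
    have cH: "card (\<phi> ` H) = [q1, q2] ! i"
      using HR inj_on_subset[OF inj] by (metis card_image)
    have pre: "\<exists>Y'\<in>nsets H r. Y = \<phi> ` Y'" if "Y \<in> nsets (\<phi> ` H) r" for Y
      by (rule nset_image_obtains[OF that inj_on_subset[OF inj HR(1)]]) blast
    have im': "\<phi> ` H \<subseteq> J" using im HR by auto
    consider "i = 0" | "i = 1" using i by linarith
    then show ?thesis
    proof cases
      case 1
      have "P Y" if "Y \<in> nsets (\<phi> ` H) r" for Y
        using pre[OF that] g 1 by (auto simp: g_def split: if_splits)
      then show ?thesis using cH 1 im' by (intro exI[of _ "\<phi> ` H"]) auto
    next
      case 2
      have "\<not> P Y" if "Y \<in> nsets (\<phi> ` H) r" for Y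
        using pre[OF that] g 2 by (auto simp: g_def split: if_splits)
      then show ?thesis using cH 2 im' by (intro exI[of _ "\<phi> ` H"]) auto
    qed
  qed
  then show thesis by (rule that)
qed

text \<open>A random colour lies in at least \<open>\<delta> * card Q\<close> of the sets on
  average. A colour lying in at least \<open>r\<close> of them lies in all sets of some
  \<open>r\<close>-subset, so the expected number of such subsets is at least
  \<open>\<delta> / 2\<close>. There are at most \<open>2 ^ card Q\<close> candidates, and the
  number \<open>K\<close> of colours does not enter.\<close>

lemma pigeonhole_intersection:
  fixes q :: "nat \<Rightarrow> real"
  assumes q: "\<And>a. 0 \<le> q a" "(\<Sum>a<K. q a) = 1"
    and Q: "finite Q" "2 * real r \<le> \<delta> * real (card Q)" "Q \<noteq> {}"
    and A: "\<And>k. k \<in> Q \<Longrightarrow> \<delta> \<le> (\<Sum>a<K. q a * of_bool (a \<in> A k))"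
  obtains K' where "K' \<subseteq> Q" "card K' = r"
    "\<delta> / 2 ^ Suc (card Q) \<le> (\<Sum>a<K. q a * of_bool (\<forall>k\<in>K'. a \<in> A k))"
proof (rule ccontr)
  assume "\<not> thesis"
  then have no: "(\<Sum>a<K. q a * of_bool (\<forall>k\<in>K'. a \<in> A k)) < \<delta> / 2 ^ Suc (card Q)"
    if "K' \<subseteq> Q" "card K' = r" for K'
    using \<open>\<And>K'. \<lbrakk>K' \<subseteq> Q; card K' = r; \<delta> / 2 ^ Suc (card Q) \<le> (\<Sum>a<K. q a * of_bool (\<forall>k\<in>K'. a \<in> A k))\<rbrakk> \<Longrightarrow> thesis\<close>
      that not_le by blast
  let ?n = "\<lambda>a. real (card {k\<in>Q. a \<in> A k})" and ?M = "real (card Q)"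
  let ?N = "\<lambda>a. real (card {K' \<in> nsets Q r. \<forall>k\<in>K'. a \<in> A k})"
  have M: "?M > 0" using Q by (simp add: card_gt_0_iff)
  have card_sum: "?n a = (\<Sum>k\<in>Q. of_bool (a \<in> A k))" for a
    using Q(1) by (simp add: sum.If_cases Int_def flip: of_bool_def)
  have N_sum: "?N a = (\<Sum>K'\<in>nsets Q r. of_bool (\<forall>k\<in>K'. a \<in> A k))" for a
    using Q(1) by (simp add: sum.If_cases Int_def finite_nsets flip: of_bool_def)
  have "?n a \<le> ?M * ?N a + real r" for a
  proof (cases "card {k\<in>Q. a \<in> A k} < r")
    case True
    then show ?thesis by (smt (verit) of_nat_0_le_iff of_nat_less_iff mult_nonneg_nonneg)
  next
    case False
    then obtain K' where K': "K' \<subseteq> {k\<in>Q. a \<in> A k}" "card K' = r"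
      by (meson not_less obtain_subset_with_card_n)
    then have "K' \<in> {K' \<in> nsets Q r. \<forall>k\<in>K'. a \<in> A k}"
      using Q(1) by (auto simp: nsets_def intro: finite_subset)
    then have "?N a \<ge> 1"
      using Q(1) by (metis (no_types, lifting) One_nat_def Suc_leI card_gt_0_iff empty_iff finite_nsets
          finite_Collect_conjI of_nat_1 of_nat_mono finite_subset mem_Collect_eq subsetI)
    then have "?M * 1 \<le> ?M * ?N a" using M by (intro mult_left_mono) auto
    moreover have "?n a \<le> ?M" using Q(1) by (simp add: card_mono)
    ultimately show ?thesis by simp
  qed
  then have "(\<Sum>a<K. q a * ?n a) \<le> (\<Sum>a<K. q a * (?M * ?N a + real r))"
    by (intro sum_mono mult_left_mono q) auto
  also have "\<dots> = ?M * (\<Sum>a<K. q a * ?N a) + real r"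
  proof -
    have "(\<Sum>a<K. q a * (?M * ?N a + real r)) = (\<Sum>a<K. ?M * (q a * ?N a) + real r * q a)"
      by (rule sum.cong) (simp_all add: algebra_simps)
    also have "\<dots> = ?M * (\<Sum>a<K. q a * ?N a) + real r * (\<Sum>a<K. q a)"
      by (simp only: sum.distrib sum_distrib_left)
    finally show ?thesis using q(2) by simp
  qed
  also have "(\<Sum>a<K. q a * ?N a) = (\<Sum>K'\<in>nsets Q r. \<Sum>a<K. q a * of_bool (\<forall>k\<in>K'. a \<in> A k))"
    unfolding N_sum sum_distrib_left by (rule sum.swap)
  finally have 1: "(\<Sum>a<K. q a * ?n a)
      \<le> ?M * (\<Sum>K'\<in>nsets Q r. \<Sum>a<K. q a * of_bool (\<forall>k\<in>K'. a \<in> A k)) + real r" .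
  have "\<delta> * ?M = (\<Sum>k\<in>Q. \<delta>)" by simp
  also have "\<dots> \<le> (\<Sum>k\<in>Q. \<Sum>a<K. q a * of_bool (a \<in> A k))" by (intro sum_mono A)
  also have "\<dots> = (\<Sum>a<K. q a * ?n a)"
    unfolding card_sum sum_distrib_left by (rule sum.swap)
  finally have 2: "\<delta> * ?M \<le> (\<Sum>a<K. q a * ?n a)" .
  have ne: "nsets Q r \<noteq> {}"
  proof
    assume "nsets Q r = {}"
    then have "\<delta> * ?M \<le> real r" using 1 2 by simp
    moreover have "real r > 0"
      using \<open>nsets Q r = {}\<close> by (cases r) auto
    ultimately show False using Q(2) by simp
  qed
  have "(\<Sum>K'\<in>nsets Q r. \<Sum>a<K. q a * of_bool (\<forall>k\<in>K'. a \<in> A k))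
      < (\<Sum>K'\<in>nsets Q r. \<delta> / 2 ^ Suc (card Q))"
    using Q(1) ne by (intro sum_strict_mono no) (auto simp: nsets_def finite_nsets)
  also have "\<dots> = real (card (nsets Q r)) * (\<delta> / 2 ^ Suc (card Q))" by simp
  also have "\<dots> \<le> 2 ^ card Q * (\<delta> / 2 ^ Suc (card Q))"
  proof (rule mult_right_mono)
    have "card (nsets Q r) \<le> card (Pow Q)"
      using Q(1) by (intro card_mono) (auto simp: nsets_def)
    then have "card (nsets Q r) \<le> 2 ^ card Q" using Q(1) by (simp add: card_Pow)
    then show "real (card (nsets Q r)) \<le> 2 ^ card Q"
      using of_nat_mono by fastforce
    have "0 \<le> \<delta> * ?M" using Q(2) by (smt (verit) of_nat_0_le_iff)
    then show "0 \<le> \<delta> / 2 ^ Suc (card Q)" using M by (simp add: zero_le_mult_iff)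
  qed
  also have "\<dots> = \<delta> / 2" by simp
  finally have "?M * (\<Sum>K'\<in>nsets Q r. \<Sum>a<K. q a * of_bool (\<forall>k\<in>K'. a \<in> A k)) < ?M * (\<delta> / 2)"
    using M by simp
  then show False using 1 2 Q(2) by (simp add: mult.commute)
qed

text \<open>Every set of at least two indices has exactly one pair to which all other indices are
  suited. Existence provides a pair for the pigeonhole argument; uniqueness lets a property of a
  pair together with some thirds be stated as a property of their union, as Ramsey's theorem
  requires.\<close>

definition selecting :: "(nat set \<Rightarrow> nat \<Rightarrow> bool) \<Rightarrow> bool" where
  "selecting suit \<longleftrightarrow>
     (\<forall>Q. finite Q \<and> 2 \<le> card Q \<longrightarrow> (\<exists>s\<in>nsets Q 2. \<forall>k\<in>Q - s. suit s k)) \<and>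
     (\<forall>Y s s'. finite Y \<and> s \<in> nsets Y 2 \<and> s' \<in> nsets Y 2 \<and>
        (\<forall>k\<in>Y - s. suit s k) \<and> (\<forall>k\<in>Y - s'. suit s' k) \<longrightarrow> s = s')"

section \<open>The two smallest, the two largest and the two extreme elements of a set\<close>

lemma nsets_2_neqE:
  assumes "s \<in> nsets Y 2" "s' \<in> nsets Y 2" "s \<noteq> s'"
  obtains i j where "i \<in> s - s'" "j \<in> s' - s" "i \<in> Y" "j \<in> Y"
proof -
  have "\<not> s \<subseteq> s'" "\<not> s' \<subseteq> s"
    using assms card_subset_eq[of s' s] card_subset_eq[of s s'] by (auto simp: nsets_def)
  then show ?thesis using that assms by (auto simp: nsets_def)
qed

lemma selecting_above: "selecting (\<lambda>s k. \<forall>i\<in>s. i < k)"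
  unfolding selecting_def
proof (intro conjI allI impI)
  fix Q :: "nat set" assume Q: "finite Q \<and> 2 \<le> card Q"
  define i where "i = Min Q"
  define j where "j = Min (Q - {i})"
  have Q0: "Q \<noteq> {}" "card (Q - {i}) > 0"
    using Q by (auto simp: i_def card_Diff_singleton_if)
  have "i \<in> Q" unfolding i_def using Q Q0(1) by (intro Min_in) auto
  have "j \<in> Q - {i}" unfolding j_def using Q Q0(2) by (intro Min_in) (auto simp: card_gt_0_iff)
  have "i < k \<and> j < k" if "k \<in> Q - {i, j}" for k
  proof -
    have "i \<le> k" "j \<le> k" using that Q by (auto simp: i_def j_def)
    then show ?thesis using that by auto
  qed
  with \<open>i \<in> Q\<close> \<open>j \<in> Q - {i}\<close> show "\<exists>s\<in>nsets Q 2. \<forall>k\<in>Q - s. \<forall>i\<in>s. i < k"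
    by (intro bexI[of _ "{i, j}"]) auto
next
  fix Y s s' :: "nat set"
  assume *: "finite Y \<and> s \<in> nsets Y 2 \<and> s' \<in> nsets Y 2 \<and>
    (\<forall>k\<in>Y - s. \<forall>i\<in>s. i < k) \<and> (\<forall>k\<in>Y - s'. \<forall>i\<in>s'. i < k)"
  show "s = s'"
  proof (rule ccontr)
    assume "s \<noteq> s'"
    then obtain i j where "i \<in> s - s'" "j \<in> s' - s" "i \<in> Y" "j \<in> Y"
      using * nsets_2_neqE by meson
    then have "i < j" "j < i" using * by auto
    then show False by simp
  qed
qed

lemma selecting_below: "selecting (\<lambda>s k. \<forall>i\<in>s. k < i)"
  unfolding selecting_def
proof (intro conjI allI impI)
  fix Q :: "nat set" assume Q: "finite Q \<and> 2 \<le> card Q"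
  define i where "i = Max Q"
  define j where "j = Max (Q - {i})"
  have Q0: "Q \<noteq> {}" "card (Q - {i}) > 0"
    using Q by (auto simp: i_def card_Diff_singleton_if)
  have "i \<in> Q" unfolding i_def using Q Q0(1) by (intro Max_in) auto
  have "j \<in> Q - {i}" unfolding j_def using Q Q0(2) by (intro Max_in) (auto simp: card_gt_0_iff)
  have "k < i \<and> k < j" if "k \<in> Q - {i, j}" for k
  proof -
    have "k \<le> i" "k \<le> j" using that Q by (auto simp: i_def j_def)
    then show ?thesis using that by auto
  qed
  with \<open>i \<in> Q\<close> \<open>j \<in> Q - {i}\<close> show "\<exists>s\<in>nsets Q 2. \<forall>k\<in>Q - s. \<forall>i\<in>s. k < i"
    by (intro bexI[of _ "{i, j}"]) auto
next
  fix Y s s' :: "nat set"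
  assume *: "finite Y \<and> s \<in> nsets Y 2 \<and> s' \<in> nsets Y 2 \<and>
    (\<forall>k\<in>Y - s. \<forall>i\<in>s. k < i) \<and> (\<forall>k\<in>Y - s'. \<forall>i\<in>s'. k < i)"
  show "s = s'"
  proof (rule ccontr)
    assume "s \<noteq> s'"
    then obtain i j where "i \<in> s - s'" "j \<in> s' - s" "i \<in> Y" "j \<in> Y"
      using * nsets_2_neqE by meson
    then have "i < j" "j < i" using * by auto
    then show False by simp
  qed
qed

lemma selecting_between: "selecting (\<lambda>s k. (\<exists>i\<in>s. i < k) \<and> (\<exists>i\<in>s. k < i))"
  unfolding selecting_def
proof (intro conjI allI impI)
  fix Q :: "nat set" assume Q: "finite Q \<and> 2 \<le> card Q"
  then have Q0: "Q \<noteq> {}" by auto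
  have in_Q: "Min Q \<in> Q" "Max Q \<in> Q" using Q Q0 by auto
  have "Min Q \<noteq> Max Q"
  proof
    assume eq: "Min Q = Max Q"
    have "Q \<subseteq> {Min Q}"
    proof
      fix x assume "x \<in> Q"
      then have "Min Q \<le> x" "x \<le> Max Q" using Q by auto
      then show "x \<in> {Min Q}" using eq by simp
    qed
    then have "card Q \<le> 1" by (metis card_mono card.empty card_insert_disjoint finite.emptyI
        finite.insertI empty_iff One_nat_def)
    then show False using Q by simp
  qed
  moreover have "Min Q < k \<and> k < Max Q" if "k \<in> Q - {Min Q, Max Q}" for k
  proof -
    have "Min Q \<le> k" "k \<le> Max Q" using that Q by auto
    then show ?thesis using that by auto
  qed
  ultimately show "\<exists>s\<in>nsets Q 2. \<forall>k\<in>Q - s. (\<exists>i\<in>s. i < k) \<and> (\<exists>i\<in>s. k < i)"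
    using in_Q by (intro bexI[of _ "{Min Q, Max Q}"]) auto
next
  fix Y s s' :: "nat set"
  assume *: "finite Y \<and> s \<in> nsets Y 2 \<and> s' \<in> nsets Y 2 \<and>
    (\<forall>k\<in>Y - s. (\<exists>i\<in>s. i < k) \<and> (\<exists>i\<in>s. k < i)) \<and> (\<forall>k\<in>Y - s'. (\<exists>i\<in>s'. i < k) \<and> (\<exists>i\<in>s'. k < i))"
  have ends: "u = {Min Y, Max Y}"
    if u: "u \<in> nsets Y 2" "\<forall>k\<in>Y - u. (\<exists>i\<in>u. i < k) \<and> (\<exists>i\<in>u. k < i)" for u
  proof -
    have uY: "u \<subseteq> Y" "card u = 2" "finite u" using u(1) by (auto simp: nsets_def)
    have Y: "finite Y" "Y \<noteq> {}" using * uY by auto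
    have mM: "Min Y \<in> u" "Max Y \<in> u"
    proof -
      show "Min Y \<in> u"
      proof (rule ccontr)
        assume "Min Y \<notin> u"
        then obtain i where "i \<in> u" "i < Min Y" using u(2) Min_in[OF Y] by blast
        moreover have "Min Y \<le> i" using \<open>i \<in> u\<close> uY Y by auto
        ultimately show False by simp
      qed
      show "Max Y \<in> u"
      proof (rule ccontr)
        assume "Max Y \<notin> u"
        then obtain i where "i \<in> u" "Max Y < i" using u(2) Max_in[OF Y] by blast
        moreover have "i \<le> Max Y" using \<open>i \<in> u\<close> uY Y by auto
        ultimately show False by simp
      qed
    qed
    obtain a b where ab: "u = {a, b}" "a < b"
      using uY(2) by (metis card_2_iff insert_commute linorder_neqE_nat)
    then have "Min Y \<le> a" "b \<le> Max Y" using uY Y by auto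
    then show ?thesis using mM ab by auto
  qed
  show "s = s'" using ends[of s] ends[of s'] * by simp
qed

text \<open>Call an \<open>(r + 2)\<close>-set good if its distinguished pair has colours of total
  mass at least \<open>c\<close> that serve all other \<open>r\<close> elements. A set of
  \<open>M + 2\<close> indices cannot have only bad subsets, by
  \<open>pigeonhole_intersection\<close> for its distinguished pair, so Ramsey's theorem gives
  \<open>q\<close> indices with only good ones.\<close>

lemma stage_size:
  assumes sel: "selecting suit" and \<delta>: "\<delta> > 0"
  shows "\<exists>R c. c > 0 \<and> (\<forall>J K p A. finite J \<longrightarrow> R \<le> card J \<longrightarrow> cweights (nsets J 2) K p \<longrightarrow>
    (\<forall>s\<in>nsets J 2. \<forall>k\<in>J - s. suit s k \<longrightarrow> \<delta> \<le> (\<Sum>a<K. p s a * of_bool (a \<in> A s k))) \<longrightarrow>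
    (\<exists>H\<subseteq>J. card H = q \<and> (\<forall>s\<in>nsets H 2. \<forall>L\<in>nsets (H - s) r. (\<forall>k\<in>L. suit s k) \<longrightarrow>
      c \<le> (\<Sum>a<K. p s a * of_bool (\<forall>k\<in>L. a \<in> A s k)))))"
proof -
  \<comment> \<open>Large enough for the pigeonhole argument; \<open>Suc\<close> keeps the set of
    thirds non-empty also for \<open>r = 0\<close>.\<close>
  define M where "M = Suc (nat \<lceil>2 * real r / \<delta>\<rceil>)"
  define c where "c = \<delta> / 2 ^ Suc M"
  have c: "c > 0" using \<delta> by (simp add: c_def)
  have M: "2 * real r \<le> \<delta> * real M"
  proof -
    have "2 * real r / \<delta> \<le> real M" unfolding M_def by linarith
    then show ?thesis using \<delta> by (simp add: divide_le_eq mult.commute)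
  qed
  obtain R where R: "\<And>(J :: nat set) P. finite J \<Longrightarrow> R \<le> card J \<Longrightarrow>
    \<exists>H\<subseteq>J. (card H = q \<and> (\<forall>Y\<in>nsets H (r + 2). P Y)) \<or> (card H = M + 2 \<and> (\<forall>Y\<in>nsets H (r + 2). \<not> P Y))"
    using ramsey_set[where 'a = nat and ?q1.0 = q and ?q2.0 = "M + 2" and r = "r + 2"] by blast
  have main: "\<exists>H\<subseteq>J. card H = q \<and> (\<forall>s\<in>nsets H 2. \<forall>L\<in>nsets (H - s) r. (\<forall>k\<in>L. suit s k) \<longrightarrow>
      c \<le> (\<Sum>a<K. p s a * of_bool (\<forall>k\<in>L. a \<in> A s k)))"
    if J: "finite J" "R \<le> card J" and w: "cweights (nsets J 2) K p"
      and A: "\<forall>s\<in>nsets J 2. \<forall>k\<in>J - s. suit s k \<longrightarrow> \<delta> \<le> (\<Sum>a<K. p s a * of_bool (a \<in> A s k))"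
    for J K p and A :: "nat set \<Rightarrow> nat \<Rightarrow> nat set"
  proof -
    define P where "P Y \<longleftrightarrow> (\<exists>s\<in>nsets Y 2. (\<forall>k\<in>Y - s. suit s k) \<and>
      c \<le> (\<Sum>a<K. p s a * of_bool (\<forall>k\<in>Y - s. a \<in> A s k)))" for Y
    obtain H where H: "H \<subseteq> J"
      "(card H = q \<and> (\<forall>Y\<in>nsets H (r + 2). P Y)) \<or> (card H = M + 2 \<and> (\<forall>Y\<in>nsets H (r + 2). \<not> P Y))"
      using R[OF J, of P] by auto
    have finH: "finite H" using H(1) J(1) finite_subset by blast
    from H(2) show ?thesis
    proof
      assume good: "card H = q \<and> (\<forall>Y\<in>nsets H (r + 2). P Y)"
      have "c \<le> (\<Sum>a<K. p s a * of_bool (\<forall>k\<in>L. a \<in> A s k))"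
        if s: "s \<in> nsets H 2" and L: "L \<in> nsets (H - s) r" and suit: "\<forall>k\<in>L. suit s k" for s L
      proof -
        have disj: "s \<inter> L = {}" and f: "finite s" "finite L"
          using s L by (auto simp: nsets_def)
        have "s \<union> L \<in> nsets H (r + 2)"
          using s L disj by (auto simp: nsets_def card_Un_disjoint)
        then have "P (s \<union> L)" using good by blast
        then obtain s' where s': "s' \<in> nsets (s \<union> L) 2" "\<forall>k\<in>(s \<union> L) - s'. suit s' k"
          "c \<le> (\<Sum>a<K. p s' a * of_bool (\<forall>k\<in>(s \<union> L) - s'. a \<in> A s' k))"
          unfolding P_def by blast
        have e: "(s \<union> L) - s = L" using disj by blast
        have "s \<in> nsets (s \<union> L) 2" using s by (auto simp: nsets_def)
        then have "s' = s"
          using sel s'(1,2) suit f e unfolding selecting_def by (metis finite_UnI)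
        then show ?thesis using s'(3) e by simp
      qed
      then show ?thesis using H(1) good by blast
    next
      assume bad: "card H = M + 2 \<and> (\<forall>Y\<in>nsets H (r + 2). \<not> P Y)"
      then obtain s where s: "s \<in> nsets H 2" "\<forall>k\<in>H - s. suit s k"
        using sel finH unfolding selecting_def by (metis le_add2)
      have sJ: "s \<in> nsets J 2" using s(1) H(1) nsets_mono by blast
      have sH: "s \<subseteq> H" "finite s" "card s = 2" using s(1) by (auto simp: nsets_def)
      have cQ: "card (H - s) = M" using bad sH by (simp add: card_Diff_subset)
      have ne: "H - s \<noteq> {}" using cQ by (metis M_def card.empty nat.distinct(1))
      have q1: "\<And>a. 0 \<le> p s a" and q2: "(\<Sum>a<K. p s a) = 1"
        using w sJ by (auto simp: cweights_def)
      have A': "\<delta> \<le> (\<Sum>a<K. p s a * of_bool (a \<in> A s k))" if "k \<in> H - s" for k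
        using A sJ s(2) that H(1) by blast
      obtain L where L: "L \<subseteq> H - s" "card L = r"
        "\<delta> / 2 ^ Suc (card (H - s)) \<le> (\<Sum>a<K. p s a * of_bool (\<forall>k\<in>L. a \<in> A s k))"
        by (rule pigeonhole_intersection[of "p s" K "H - s" r \<delta> "A s"])
          (use q1 q2 finH M cQ ne A' in auto)
      have e: "(s \<union> L) - s = L" using L by blast
      have fL: "finite L" using L(1) finH finite_subset by blast
      have "s \<union> L \<in> nsets H (r + 2)"
      proof -
        have "s \<inter> L = {}" using L by blast
        then have "card (s \<union> L) = r + 2" using L(2) sH fL by (simp add: card_Un_disjoint)
        then show ?thesis using L(1) sH fL unfolding nsets_def by blast
      qed
      moreover have "P (s \<union> L)"
        unfolding P_def
      proof (intro bexI conjI)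
        show "\<forall>k\<in>(s \<union> L) - s. suit s k" using s(2) L(1) e by blast
        show "c \<le> (\<Sum>a<K. p s a * of_bool (\<forall>k\<in>(s \<union> L) - s. a \<in> A s k))"
          unfolding e using L(3) cQ by (simp add: c_def)
        show "s \<in> nsets (s \<union> L) 2" using sH by (auto simp: nsets_def)
      qed
      ultimately show ?thesis using bad by blast
    qed
  qed
  show ?thesis
  proof (intro exI conjI)
    show "c > 0" by (rule c)
  qed (use main in blast)
qed

text \<open>The number of thirds suited to a pair varies with the pair, so all sizes up to
  \<open>f\<close> are needed. Each size costs one more Ramsey step: \<open>stage_size\<close>
  handles \<open>Suc f\<close> and leaves enough indices for the smaller sizes.\<close>

lemma stage_sizes:
  assumes sel: "selecting suit" and \<delta>: "\<delta> > 0"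
  shows "\<exists>R c. c > 0 \<and> (\<forall>J K p A. finite J \<longrightarrow> R \<le> card J \<longrightarrow> cweights (nsets J 2) K p \<longrightarrow>
    (\<forall>s\<in>nsets J 2. \<forall>k\<in>J - s. suit s k \<longrightarrow> \<delta> \<le> (\<Sum>a<K. p s a * of_bool (a \<in> A s k))) \<longrightarrow>
    (\<exists>H\<subseteq>J. card H = q \<and> (\<forall>s\<in>nsets H 2. \<forall>L\<subseteq>H - s. card L \<le> f \<longrightarrow> (\<forall>k\<in>L. suit s k) \<longrightarrow>
      c \<le> (\<Sum>a<K. p s a * of_bool (\<forall>k\<in>L. a \<in> A s k)))))"
proof (induction f)
  case 0
  show ?case
  proof (intro exI[of _ q] exI[of _ 1] conjI allI impI)
    fix J :: "nat set" and K p and A :: "nat set \<Rightarrow> nat \<Rightarrow> nat set"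
    assume J: "finite J" "q \<le> card J" and w: "cweights (nsets J 2) K p"
    obtain H where H: "H \<subseteq> J" "card H = q" "finite H" using obtain_subset_with_card_n[OF J(2)] .
    have "1 \<le> (\<Sum>a<K. p s a * of_bool (\<forall>k\<in>L. a \<in> A s k))"
      if "s \<in> nsets H 2" "L \<subseteq> H - s" "card L \<le> 0" for s L
    proof -
      have "finite L" using that(2) H(3) finite_subset by blast
      then have "L = {}" using that(3) by simp
      moreover have "s \<in> nsets J 2" using that(1) H(1) nsets_mono by blast
      ultimately show ?thesis using w by (simp add: cweights_def)
    qed
    then show "\<exists>H\<subseteq>J. card H = q \<and> (\<forall>s\<in>nsets H 2. \<forall>L\<subseteq>H - s. card L \<le> 0 \<longrightarrow> (\<forall>k\<in>L. suit s k) \<longrightarrow>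
      1 \<le> (\<Sum>a<K. p s a * of_bool (\<forall>k\<in>L. a \<in> A s k)))"
      using H by blast
  qed simp
next
  case (Suc f)
  then obtain R1 c1 where c1: "c1 > 0" and R1: "\<forall>J K p A. finite J \<longrightarrow> R1 \<le> card J \<longrightarrow> cweights (nsets J 2) K p \<longrightarrow>
    (\<forall>s\<in>nsets J 2. \<forall>k\<in>J - s. suit s k \<longrightarrow> \<delta> \<le> (\<Sum>a<K. p s a * of_bool (a \<in> A s k))) \<longrightarrow>
    (\<exists>H\<subseteq>J. card H = q \<and> (\<forall>s\<in>nsets H 2. \<forall>L\<subseteq>H - s. card L \<le> f \<longrightarrow> (\<forall>k\<in>L. suit s k) \<longrightarrow>
      c1 \<le> (\<Sum>a<K. p s a * of_bool (\<forall>k\<in>L. a \<in> A s k))))"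
    by (elim exE conjE) iprover
  from stage_size[OF sel \<delta>, of R1 "Suc f"]
  obtain R2 c2 where c2: "c2 > 0" and R2: "\<forall>J K p A. finite J \<longrightarrow> R2 \<le> card J \<longrightarrow> cweights (nsets J 2) K p \<longrightarrow>
    (\<forall>s\<in>nsets J 2. \<forall>k\<in>J - s. suit s k \<longrightarrow> \<delta> \<le> (\<Sum>a<K. p s a * of_bool (a \<in> A s k))) \<longrightarrow>
    (\<exists>H\<subseteq>J. card H = R1 \<and> (\<forall>s\<in>nsets H 2. \<forall>L\<in>nsets (H - s) (Suc f). (\<forall>k\<in>L. suit s k) \<longrightarrow>
      c2 \<le> (\<Sum>a<K. p s a * of_bool (\<forall>k\<in>L. a \<in> A s k))))"
    by (elim exE conjE) iprover
  show ?case
  proof (intro exI[of _ R2] exI[of _ "min c1 c2"] conjI allI impI)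
    fix J :: "nat set" and K p and A :: "nat set \<Rightarrow> nat \<Rightarrow> nat set"
    assume J: "finite J" "R2 \<le> card J" and w: "cweights (nsets J 2) K p"
      and A: "\<forall>s\<in>nsets J 2. \<forall>k\<in>J - s. suit s k \<longrightarrow> \<delta> \<le> (\<Sum>a<K. p s a * of_bool (a \<in> A s k))"
    have "\<exists>H\<subseteq>J. card H = R1 \<and> (\<forall>s\<in>nsets H 2. \<forall>L\<in>nsets (H - s) (Suc f). (\<forall>k\<in>L. suit s k) \<longrightarrow>
      c2 \<le> (\<Sum>a<K. p s a * of_bool (\<forall>k\<in>L. a \<in> A s k)))"
      using R2 J w A by iprover
    then obtain H where H: "H \<subseteq> J" "card H = R1"
      and H2: "\<And>s L. s \<in> nsets H 2 \<Longrightarrow> L \<in> nsets (H - s) (Suc f) \<Longrightarrow> (\<forall>k\<in>L. suit s k) \<Longrightarrow>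
        c2 \<le> (\<Sum>a<K. p s a * of_bool (\<forall>k\<in>L. a \<in> A s k))"
      by auto
    have finH: "finite H" using H(1) J(1) finite_subset by blast
    have sub: "nsets H 2 \<subseteq> nsets J 2" using H(1) by (rule nsets_mono)
    have w': "cweights (nsets H 2) K p"
      using w sub finite_subset[OF sub] unfolding cweights_def by blast
    have A': "\<forall>s\<in>nsets H 2. \<forall>k\<in>H - s. suit s k \<longrightarrow> \<delta> \<le> (\<Sum>a<K. p s a * of_bool (a \<in> A s k))"
      using A sub H(1) by blast
    have "\<exists>G\<subseteq>H. card G = q \<and> (\<forall>s\<in>nsets G 2. \<forall>L\<subseteq>G - s. card L \<le> f \<longrightarrow> (\<forall>k\<in>L. suit s k) \<longrightarrow>
      c1 \<le> (\<Sum>a<K. p s a * of_bool (\<forall>k\<in>L. a \<in> A s k)))"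
      using R1 finH eq_refl[OF H(2)[symmetric]] w' A' by iprover
    then obtain G where G: "G \<subseteq> H" "card G = q"
      and G2: "\<And>s L. s \<in> nsets G 2 \<Longrightarrow> L \<subseteq> G - s \<Longrightarrow> card L \<le> f \<Longrightarrow> (\<forall>k\<in>L. suit s k) \<Longrightarrow>
        c1 \<le> (\<Sum>a<K. p s a * of_bool (\<forall>k\<in>L. a \<in> A s k))"
      by auto
    have "min c1 c2 \<le> (\<Sum>a<K. p s a * of_bool (\<forall>k\<in>L. a \<in> A s k))"
      if s: "s \<in> nsets G 2" and L: "L \<subseteq> G - s" "card L \<le> Suc f" "\<forall>k\<in>L. suit s k" for s L
    proof (cases "card L \<le> f")
      case True
      then show ?thesis using G2[OF s L(1) _ L(3)] by simp
    next
      case False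
      have "finite L" using L(1) G(1) finH by (meson Diff_subset finite_subset)
      then have "L \<in> nsets (H - s) (Suc f)" using L False G(1) unfolding nsets_def by auto
      moreover have "s \<in> nsets H 2" using s G(1) nsets_mono by blast
      ultimately show ?thesis using H2 L(3) by fastforce
    qed
    then show "\<exists>H\<subseteq>J. card H = q \<and> (\<forall>s\<in>nsets H 2. \<forall>L\<subseteq>H - s. card L \<le> Suc f \<longrightarrow> (\<forall>k\<in>L. suit s k) \<longrightarrow>
      min c1 c2 \<le> (\<Sum>a<K. p s a * of_bool (\<forall>k\<in>L. a \<in> A s k)))"
      using G H(1) by (intro exI[of _ G]) auto
  qed (use c1 c2 in auto)
qed

text \<open>The requirements concern one pair each and the colours of the pairs are independent, so
  the lower bounds multiply: \<open>c1\<close> for each of the \<open>f choose 2\<close>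
  pairs.\<close>

lemma stage:
  assumes sel: "selecting suit" and \<delta>: "\<delta> > 0"
  obtains c R where "c > 0" and "\<And>J S K p A. finite J \<Longrightarrow> R \<le> card J \<Longrightarrow> cweights S K p \<Longrightarrow> nsets J 2 \<subseteq> S \<Longrightarrow>
    (\<And>s k. s \<in> nsets J 2 \<Longrightarrow> k \<in> J - s \<Longrightarrow> suit s k \<Longrightarrow> \<delta> \<le> (\<Sum>a<K. p s a * of_bool (a \<in> A s k))) \<Longrightarrow>
    \<exists>H\<subseteq>J. card H = f \<and>
      c \<le> cE S K p (\<lambda>X. of_bool (\<forall>s\<in>nsets H 2. \<forall>k\<in>H - s. suit s k \<longrightarrow> X s \<in> A s k))"
proof -
  from stage_sizes[OF sel \<delta>, of f f]
  obtain R c1 where c1: "c1 > 0" and R: "\<forall>J K p A. finite J \<longrightarrow> R \<le> card J \<longrightarrow> cweights (nsets J 2) K p \<longrightarrow>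
    (\<forall>s\<in>nsets J 2. \<forall>k\<in>J - s. suit s k \<longrightarrow> \<delta> \<le> (\<Sum>a<K. p s a * of_bool (a \<in> A s k))) \<longrightarrow>
    (\<exists>H\<subseteq>J. card H = f \<and> (\<forall>s\<in>nsets H 2. \<forall>L\<subseteq>H - s. card L \<le> f \<longrightarrow> (\<forall>k\<in>L. suit s k) \<longrightarrow>
      c1 \<le> (\<Sum>a<K. p s a * of_bool (\<forall>k\<in>L. a \<in> A s k))))"
    by (elim exE conjE) iprover
  define c where "c = c1 ^ (f choose 2)"
  have c: "c > 0" using c1 by (simp add: c_def)
  have "\<exists>H\<subseteq>J. card H = f \<and>
      c \<le> cE S K p (\<lambda>X. of_bool (\<forall>s\<in>nsets H 2. \<forall>k\<in>H - s. suit s k \<longrightarrow> X s \<in> A s k))"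
    if J: "finite J" "R \<le> card J" and w: "cweights S K p" and sub: "nsets J 2 \<subseteq> S"
      and A: "\<And>s k. s \<in> nsets J 2 \<Longrightarrow> k \<in> J - s \<Longrightarrow> suit s k \<Longrightarrow> \<delta> \<le> (\<Sum>a<K. p s a * of_bool (a \<in> A s k))"
    for J S K p A
  proof -
    have w': "cweights (nsets J 2) K p"
      using w sub finite_subset[OF sub] unfolding cweights_def by blast
    have A': "\<forall>s\<in>nsets J 2. \<forall>k\<in>J - s. suit s k \<longrightarrow> \<delta> \<le> (\<Sum>a<K. p s a * of_bool (a \<in> A s k))"
      using A by blast
    have "\<exists>H\<subseteq>J. card H = f \<and> (\<forall>s\<in>nsets H 2. \<forall>L\<subseteq>H - s. card L \<le> f \<longrightarrow> (\<forall>k\<in>L. suit s k) \<longrightarrow>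
      c1 \<le> (\<Sum>a<K. p s a * of_bool (\<forall>k\<in>L. a \<in> A s k)))"
      using R J w' A' by iprover
    then obtain H where H: "H \<subseteq> J" "card H = f"
      and H2: "\<And>s L. s \<in> nsets H 2 \<Longrightarrow> L \<subseteq> H - s \<Longrightarrow> card L \<le> f \<Longrightarrow> (\<forall>k\<in>L. suit s k) \<Longrightarrow>
        c1 \<le> (\<Sum>a<K. p s a * of_bool (\<forall>k\<in>L. a \<in> A s k))"
      by auto
    have finH: "finite H" using H(1) J(1) finite_subset by blast
    define B where "B s = {a. \<forall>k\<in>H - s. suit s k \<longrightarrow> a \<in> A s k}" for s
    have "c1 ^ card (nsets H 2) \<le> cE S K p (\<lambda>X. of_bool (\<forall>s\<in>nsets H 2. X s \<in> B s))"
    proof (rule cE_forall_ge[OF w])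
      show "nsets H 2 \<subseteq> S" using sub nsets_mono[OF H(1)] by blast
      fix s assume s: "s \<in> nsets H 2"
      let ?L = "{k \<in> H - s. suit s k}"
      have "card ?L \<le> f" unfolding H(2)[symmetric] by (rule card_mono[OF finH]) auto
      then have "c1 \<le> (\<Sum>a<K. p s a * of_bool (\<forall>k\<in>?L. a \<in> A s k))"
        by (intro H2[OF s]) auto
      also have "\<dots> = (\<Sum>a<K. p s a * of_bool (a \<in> B s))"
        by (intro sum.cong) (auto simp: B_def)
      finally show "c1 \<le> (\<Sum>a<K. p s a * of_bool (a \<in> B s))" .
    qed (use c1 in simp)
    then show ?thesis using H by (intro exI[of _ H]) (simp add: c_def B_def)
  qed
  with c show thesis by (rule that)
qed

section \<open>Choosing the red, blue and green colours\<close>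

lemma weighted_markov:
  fixes q G :: "nat \<Rightarrow> real"
  assumes q: "\<And>a. 0 \<le> q a" "(\<Sum>a<K. q a) = 1" and G: "\<And>a. G a \<le> 1"
    and \<delta>: "\<delta> > 0" "\<delta> \<le> (\<Sum>a<K. q a * G a)"
  shows "\<delta> / 2 \<le> (\<Sum>a<K. q a * of_bool (\<delta> / 2 \<le> G a))"
proof -
  have "(\<Sum>a<K. q a * G a) \<le> (\<Sum>a<K. q a * of_bool (\<delta> / 2 \<le> G a) + q a * (\<delta> / 2))"
  proof (rule sum_mono)
    fix a
    have "G a \<le> of_bool (\<delta> / 2 \<le> G a) + \<delta> / 2" using G[of a] \<delta>(1) by auto
    from mult_left_mono[OF this q(1)[of a]]
    show "q a * G a \<le> q a * of_bool (\<delta> / 2 \<le> G a) + q a * (\<delta> / 2)" by (simp add: distrib_left)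
  qed
  also have "\<dots> = (\<Sum>a<K. q a * of_bool (\<delta> / 2 \<le> G a)) + (\<Sum>a<K. q a) * (\<delta> / 2)"
    by (simp only: sum.distrib sum_distrib_right)
  finally show ?thesis using \<delta>(2) q(2) by simp
qed

lemma cE_markov:
  assumes w: "cweights S K p" and s: "s \<in> S" and G: "\<And>a. G a \<le> 1"
    and \<delta>: "\<delta> > 0" "\<delta> \<le> cE S K p (\<lambda>X. G (X s))"
  shows "\<delta> / 2 \<le> (\<Sum>a<K. p s a * of_bool (a \<in> {a. \<delta> / 2 \<le> G a}))"
proof -
  have "\<delta> / 2 \<le> (\<Sum>a<K. p s a * of_bool (\<delta> / 2 \<le> G a))"
    by (rule weighted_markov) (use w s G \<delta> cE_marginal[OF w s, of G] in \<open>auto simp: cweights_def\<close>)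
  then show ?thesis by simp
qed

lemma nsets_2_lessE:
  fixes J :: "nat set"
  assumes "s \<in> nsets J 2"
  obtains i j where "s = {i, j}" "i < j" "i \<in> J" "j \<in> J" "Min s = i" "Max s = j"
proof -
  obtain i j where ij: "s = {i, j}" "i \<in> J" "j \<in> J" "i \<noteq> j"
    using assms by (auto simp: nsets_2_eq)
  consider "i < j" | "j < i" using ij(4) by linarith
  then show thesis
  proof cases
    case 1
    then show ?thesis using that[of i j] ij by (simp add: min_def max_def)
  next
    case 2
    then show ?thesis using that[of j i] ij by (simp add: min_def max_def insert_commute)
  qed
qed

lemma cE_event:
  assumes w: "cweights S K p" and c: "0 \<le> c'" "c \<le> cE S K p (\<lambda>X. of_bool (ev X))"
    and ev: "\<And>X. ev X \<Longrightarrow> c' \<le> F X" and F: "\<And>X. 0 \<le> F X"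
  shows "c * c' \<le> cE S K p F"
proof -
  have "c * c' \<le> c' * cE S K p (\<lambda>X. of_bool (ev X))"
    using mult_left_mono[OF c(2,1)] by (simp add: mult.commute)
  also have "\<dots> = cE S K p (\<lambda>X. c' * of_bool (ev X))" by (rule cE_cmult[symmetric])
  also have "\<dots> \<le> cE S K p F"
    by (rule cE_mono[OF w]) (use ev F in \<open>auto simp: of_bool_def\<close>)
  finally show ?thesis .
qed

text \<open>The red, blue and green colourings are chosen one after the other: a red colour of a pair is
  required to leave positive density to all thirds above it, then blue colours are chosen for the
  thirds in between and green colours for the thirds below.\<close>

lemma selection:
  fixes \<delta> :: real
  assumes \<delta>: "\<delta> > 0"
  obtains c R where "c > 0" and "\<And>(J :: nat set) S K p W.
    finite J \<Longrightarrow> R \<le> card J \<Longrightarrow> cweights S K p \<Longrightarrow> nsets J 2 \<subseteq> S \<Longrightarrow>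
    (\<And>i j k a b c. (0 :: real) \<le> W i j k a b c \<and> W i j k a b c \<le> 1) \<Longrightarrow>
    (\<And>i j k. i \<in> J \<Longrightarrow> j \<in> J \<Longrightarrow> k \<in> J \<Longrightarrow> i < j \<Longrightarrow> j < k \<Longrightarrow>
      \<delta> \<le> cE S K p (\<lambda>X. cE S K p (\<lambda>Y. cE S K p (\<lambda>Z. W i j k (X {i, j}) (Y {i, k}) (Z {j, k}))))) \<Longrightarrow>
    \<exists>I\<subseteq>J. card I = f \<and> c \<le> cE S K p (\<lambda>X. cE S K p (\<lambda>Y. cE S K p (\<lambda>Z.
      of_bool (\<forall>i\<in>I. \<forall>j\<in>I. \<forall>k\<in>I. i < j \<longrightarrow> j < k \<longrightarrow> \<delta> / 8 \<le> W i j k (X {i, j}) (Y {i, k}) (Z {j, k})))))"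
proof -
  let ?above = "\<lambda>s k :: nat. \<forall>i\<in>s. i < k" and ?below = "\<lambda>s k :: nat. \<forall>i\<in>s. k < i"
  let ?btw = "\<lambda>s k :: nat. (\<exists>i\<in>s. i < k) \<and> (\<exists>i\<in>s. k < i)"
  \<comment> \<open>Each of the three stages applies \<open>cE_markov\<close> once, which halves the
    density. The sizes are fixed backwards: the last stage must leave \<open>f\<close> cells and
    needs \<open>R3\<close>, which the second stage has to deliver, and so on.\<close>
  have d: "\<delta> / 2 > 0" "\<delta> / 4 > 0" "\<delta> / 8 > 0" using \<delta> by auto
  obtain c3 R3 where c3: "c3 > 0" and R3: "\<And>J S K p A. finite J \<Longrightarrow> R3 \<le> card J \<Longrightarrow> cweights S K p \<Longrightarrow> nsets J 2 \<subseteq> S \<Longrightarrow>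
    (\<And>s k. s \<in> nsets J 2 \<Longrightarrow> k \<in> J - s \<Longrightarrow> ?below s k \<Longrightarrow> \<delta> / 8 \<le> (\<Sum>a<K. p s a * of_bool (a \<in> A s k))) \<Longrightarrow>
    \<exists>H\<subseteq>J. card H = f \<and>
      c3 \<le> cE S K p (\<lambda>X. of_bool (\<forall>s\<in>nsets H 2. \<forall>k\<in>H - s. ?below s k \<longrightarrow> X s \<in> A s k))"
    apply (rule stage[OF selecting_below d(3), of f])
    subgoal premises p using p(2,3) by (rule p(1))
    done
  obtain c2 R2 where c2: "c2 > 0" and R2: "\<And>J S K p A. finite J \<Longrightarrow> R2 \<le> card J \<Longrightarrow> cweights S K p \<Longrightarrow> nsets J 2 \<subseteq> S \<Longrightarrow>
    (\<And>s k. s \<in> nsets J 2 \<Longrightarrow> k \<in> J - s \<Longrightarrow> ?btw s k \<Longrightarrow> \<delta> / 4 \<le> (\<Sum>a<K. p s a * of_bool (a \<in> A s k))) \<Longrightarrow>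
    \<exists>H\<subseteq>J. card H = R3 \<and>
      c2 \<le> cE S K p (\<lambda>X. of_bool (\<forall>s\<in>nsets H 2. \<forall>k\<in>H - s. ?btw s k \<longrightarrow> X s \<in> A s k))"
    apply (rule stage[OF selecting_between d(2), of R3])
    subgoal premises p using p(2,3) by (rule p(1))
    done
  obtain c1 R1 where c1: "c1 > 0" and R1: "\<And>J S K p A. finite J \<Longrightarrow> R1 \<le> card J \<Longrightarrow> cweights S K p \<Longrightarrow> nsets J 2 \<subseteq> S \<Longrightarrow>
    (\<And>s k. s \<in> nsets J 2 \<Longrightarrow> k \<in> J - s \<Longrightarrow> ?above s k \<Longrightarrow> \<delta> / 2 \<le> (\<Sum>a<K. p s a * of_bool (a \<in> A s k))) \<Longrightarrow>
    \<exists>H\<subseteq>J. card H = R2 \<and>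
      c1 \<le> cE S K p (\<lambda>X. of_bool (\<forall>s\<in>nsets H 2. \<forall>k\<in>H - s. ?above s k \<longrightarrow> X s \<in> A s k))"
    apply (rule stage[OF selecting_above d(1), of R2])
    subgoal premises p using p(2,3) by (rule p(1))
    done
  \<comment> \<open>The cells found in the later stages depend on the colours chosen earlier. One
    fixed \<open>I\<close> results from averaging over the \<open>R1 choose f\<close> candidates;
    the summand \<open>1\<close> keeps the denominator positive and the comparison strict.\<close>
  define c where "c = c1 * (c2 * c3) / (1 + real (R1 choose f))"
  have c: "c > 0" using c1 c2 c3 by (simp add: c_def)
  have main: "\<exists>I\<subseteq>J'. card I = f \<and> c \<le> cE S K p (\<lambda>X. cE S K p (\<lambda>Y. cE S K p (\<lambda>Z.
      of_bool (\<forall>i\<in>I. \<forall>j\<in>I. \<forall>k\<in>I. i < j \<longrightarrow> j < k \<longrightarrow> \<delta> / 8 \<le> W i j k (X {i, j}) (Y {i, k}) (Z {j, k})))))"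
    if J': "finite J'" "R1 \<le> card J'" and w: "cweights S K p" and sub': "nsets J' 2 \<subseteq> S"
      and W: "\<And>i j k a b c. (0 :: real) \<le> W i j k a b c \<and> W i j k a b c \<le> 1"
      and dense': "\<And>i j k. i \<in> J' \<Longrightarrow> j \<in> J' \<Longrightarrow> k \<in> J' \<Longrightarrow> i < j \<Longrightarrow> j < k \<Longrightarrow>
      \<delta> \<le> cE S K p (\<lambda>X. cE S K p (\<lambda>Y. cE S K p (\<lambda>Z. W i j k (X {i, j}) (Y {i, k}) (Z {j, k}))))"
    for J' :: "nat set" and S K p W
  proof -
    let ?E = "cE S K p"
    \<comment> \<open>Trimming to exactly \<open>R1\<close> cells bounds the number of candidates
      for \<open>I\<close>.\<close>
    obtain J0 where J0: "J0 \<subseteq> J'" "card J0 = R1" "finite J0"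
      using obtain_subset_with_card_n[OF J'(2)] .
    have sub: "nsets H 2 \<subseteq> S" if "H \<subseteq> J0" for H
      using nsets_mono[of H J' 2] that J0(1) sub' by blast
    define fin where "fin I X Y Z \<longleftrightarrow> (\<forall>i\<in>I. \<forall>j\<in>I. \<forall>k\<in>I. i < j \<longrightarrow> j < k \<longrightarrow>
      \<delta> / 8 \<le> W i j k (X {i, j}) (Y {i, k}) (Z {j, k}))" for I X Y Z
    define some where "some X Y Z \<longleftrightarrow> (\<exists>I\<in>nsets J0 f. fin I X Y Z)" for X Y Z
    define A1 where "A1 s k = {a. \<delta> / 2 \<le> ?E (\<lambda>Y. ?E (\<lambda>Z.
      W (Min s) (Max s) k a (Y {Min s, k}) (Z {Max s, k})))}" for s k
    have "\<exists>H\<subseteq>J0. card H = R2 \<and>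
      c1 \<le> ?E (\<lambda>X. of_bool (\<forall>s\<in>nsets H 2. \<forall>k\<in>H - s. ?above s k \<longrightarrow> X s \<in> A1 s k))"
    proof (rule R1[OF J0(3) _ w sub])
      fix s k assume s: "s \<in> nsets J0 2" and k: "k \<in> J0 - s" "?above s k"
      obtain i j where ij: "s = {i, j}" "i < j" "i \<in> J0" "j \<in> J0" "Min s = i" "Max s = j"
        using nsets_2_lessE[OF s] .
      have "s \<in> S" using s sub by blast
      then show "\<delta> / 2 \<le> (\<Sum>a<K. p s a * of_bool (a \<in> A1 s k))"
        unfolding A1_def
      proof (rule cE_markov[OF w _ _ \<delta>])
        show "?E (\<lambda>Y. ?E (\<lambda>Z. W (Min s) (Max s) k a (Y {Min s, k}) (Z {Max s, k}))) \<le> 1" for a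
          using W by (intro cE_bounds(2)[OF w]) blast
        show "\<delta> \<le> ?E (\<lambda>X. ?E (\<lambda>Y. ?E (\<lambda>Z. W (Min s) (Max s) k (X s) (Y {Min s, k}) (Z {Max s, k}))))"
          unfolding ij(5,6) unfolding ij(1) by (rule dense') (use ij k J0(1) in auto)
      qed
    qed (use J0 in auto)
    then obtain H1 where H1: "H1 \<subseteq> J0" "card H1 = R2" and E1:
      "c1 \<le> ?E (\<lambda>X. of_bool (\<forall>s\<in>nsets H1 2. \<forall>k\<in>H1 - s. ?above s k \<longrightarrow> X s \<in> A1 s k))" by blast
    have fin1: "finite H1" using H1(1) J0(3) finite_subset by blast
    have "c1 * (c2 * c3) \<le> ?E (\<lambda>X. ?E (\<lambda>Y. ?E (\<lambda>Z. of_bool (some X Y Z))))"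
    proof (rule cE_event[OF w _ E1])
      fix X assume X: "\<forall>s\<in>nsets H1 2. \<forall>k\<in>H1 - s. ?above s k \<longrightarrow> X s \<in> A1 s k"
      define A2 where "A2 s j = {b. \<delta> / 4 \<le> ?E (\<lambda>Z.
        W (Min s) j (Max s) (X {Min s, j}) b (Z {j, Max s}))}" for s j
      have "\<exists>H\<subseteq>H1. card H = R3 \<and>
        c2 \<le> ?E (\<lambda>Y. of_bool (\<forall>s\<in>nsets H 2. \<forall>k\<in>H - s. ?btw s k \<longrightarrow> Y s \<in> A2 s k))"
      proof (rule R2[OF fin1 _ w sub])
        fix s j assume s: "s \<in> nsets H1 2" and j: "j \<in> H1 - s" "?btw s j"
        obtain i k where ik: "s = {i, k}" "i < k" "i \<in> H1" "k \<in> H1" "Min s = i" "Max s = k"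
          using nsets_2_lessE[OF s] .
        have ord: "i < j" "j < k" using j ik by auto
        have "X {i, j} \<in> A1 {i, j} k"
          using X ik ord j by auto
        then have X': "\<delta> / 2 \<le> ?E (\<lambda>Y. ?E (\<lambda>Z. W i j k (X {i, j}) (Y {i, k}) (Z {j, k})))"
          using ord by (simp add: A1_def min_def max_def)
        have "s \<in> S" using s sub[OF H1(1)] by blast
        then have "\<delta> / 2 / 2 \<le> (\<Sum>a<K. p s a * of_bool (a \<in> {b. \<delta> / 2 / 2 \<le> ?E (\<lambda>Z.
            W (Min s) j (Max s) (X {Min s, j}) b (Z {j, Max s}))}))"
        proof (rule cE_markov[OF w _ _ d(1)])
          show "?E (\<lambda>Z. W (Min s) j (Max s) (X {Min s, j}) b (Z {j, Max s})) \<le> 1" for b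
            using W by (intro cE_bounds(2)[OF w]) blast
          show "\<delta> / 2 \<le> ?E (\<lambda>Y. ?E (\<lambda>Z. W (Min s) j (Max s) (X {Min s, j}) (Y s) (Z {j, Max s})))"
            unfolding ik(5,6) unfolding ik(1) by (rule X')
        qed
        then show "\<delta> / 4 \<le> (\<Sum>a<K. p s a * of_bool (a \<in> A2 s j))"
          by (simp add: A2_def)
      qed (use H1 in auto)
      then obtain H2 where H2: "H2 \<subseteq> H1" "card H2 = R3" and E2:
        "c2 \<le> ?E (\<lambda>Y. of_bool (\<forall>s\<in>nsets H2 2. \<forall>k\<in>H2 - s. ?btw s k \<longrightarrow> Y s \<in> A2 s k))" by blast
      have fin2: "finite H2" using H2(1) fin1 finite_subset by blast
      have H2J: "H2 \<subseteq> J0" using H2(1) H1(1) by blast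
      show "c2 * c3 \<le> ?E (\<lambda>Y. ?E (\<lambda>Z. of_bool (some X Y Z)))"
      proof (rule cE_event[OF w _ E2])
        fix Y assume Y: "\<forall>s\<in>nsets H2 2. \<forall>k\<in>H2 - s. ?btw s k \<longrightarrow> Y s \<in> A2 s k"
        define A3 where "A3 s i = {b. \<delta> / 8 \<le> W i (Min s) (Max s) (X {i, Min s}) (Y {i, Max s}) b}" for s i
        have "\<exists>H\<subseteq>H2. card H = f \<and>
          c3 \<le> ?E (\<lambda>Z. of_bool (\<forall>s\<in>nsets H 2. \<forall>k\<in>H - s. ?below s k \<longrightarrow> Z s \<in> A3 s k))"
        proof (rule R3[OF fin2 _ w sub])
          fix s i assume s: "s \<in> nsets H2 2" and i: "i \<in> H2 - s" "?below s i"
          obtain j k where jk: "s = {j, k}" "j < k" "j \<in> H2" "k \<in> H2" "Min s = j" "Max s = k"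
            using nsets_2_lessE[OF s] .
          have ord: "i < j" "j < k" using i jk by auto
          have "Y {i, k} \<in> A2 {i, k} j"
            using Y jk ord i by auto
          then have Y': "\<delta> / 4 \<le> ?E (\<lambda>Z. W i j k (X {i, j}) (Y {i, k}) (Z {j, k}))"
            using ord by (simp add: A2_def min_def max_def)
          have "s \<in> S" using s sub[OF H2J] by blast
          then have "\<delta> / 4 / 2 \<le> (\<Sum>a<K. p s a * of_bool (a \<in> {b. \<delta> / 4 / 2 \<le>
              W i (Min s) (Max s) (X {i, Min s}) (Y {i, Max s}) b}))"
          proof (rule cE_markov[OF w _ _ d(2)])
            show "W i (Min s) (Max s) (X {i, Min s}) (Y {i, Max s}) b \<le> 1" for b
              using W by blast
            show "\<delta> / 4 \<le> ?E (\<lambda>Z. W i (Min s) (Max s) (X {i, Min s}) (Y {i, Max s}) (Z s))"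
              unfolding jk(5,6) unfolding jk(1) by (rule Y')
          qed
          then show "\<delta> / 8 \<le> (\<Sum>a<K. p s a * of_bool (a \<in> A3 s i))"
            by (simp add: A3_def)
        qed (use H2 H2J in auto)
        then obtain H3 where H3: "H3 \<subseteq> H2" "card H3 = f" and E3:
          "c3 \<le> ?E (\<lambda>Z. of_bool (\<forall>s\<in>nsets H3 2. \<forall>k\<in>H3 - s. ?below s k \<longrightarrow> Z s \<in> A3 s k))" by blast
        have "H3 \<in> nsets J0 f" using H3 H2J fin2 finite_subset unfolding nsets_def by blast
        moreover have "fin H3 X Y Z" if Z: "\<forall>s\<in>nsets H3 2. \<forall>k\<in>H3 - s. ?below s k \<longrightarrow> Z s \<in> A3 s k" for Z
          unfolding fin_def
        proof (intro ballI impI)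
          fix i j k assume ijk: "i \<in> H3" "j \<in> H3" "k \<in> H3" "i < j" "j < k"
          then have "Z {j, k} \<in> A3 {j, k} i" using Z by auto
          then show "\<delta> / 8 \<le> W i j k (X {i, j}) (Y {i, k}) (Z {j, k})"
            using ijk by (simp add: A3_def min_def max_def)
        qed
        ultimately have imp: "some X Y Z" if "\<forall>s\<in>nsets H3 2. \<forall>k\<in>H3 - s. ?below s k \<longrightarrow> Z s \<in> A3 s k" for Z
          using that unfolding some_def by blast
        have "?E (\<lambda>Z. of_bool (\<forall>s\<in>nsets H3 2. \<forall>k\<in>H3 - s. ?below s k \<longrightarrow> Z s \<in> A3 s k))
            \<le> ?E (\<lambda>Z. of_bool (some X Y Z))"
        proof (rule cE_mono[OF w])
          fix Z
          show "of_bool (\<forall>s\<in>nsets H3 2. \<forall>k\<in>H3 - s. ?below s k \<longrightarrow> Z s \<in> A3 s k)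
              \<le> (of_bool (some X Y Z) :: real)"
            by (cases "\<forall>s\<in>nsets H3 2. \<forall>k\<in>H3 - s. ?below s k \<longrightarrow> Z s \<in> A3 s k") (simp_all only: imp of_bool_eq, simp_all)
        qed
        then show "c3 \<le> ?E (\<lambda>Z. of_bool (some X Y Z))" using E3 by linarith
      next
        show "0 \<le> ?E (\<lambda>Z. of_bool (some X Y Z))" for Y by (intro cE_bounds(1)[OF w]) simp
      qed (use c3 in auto)
    next
      show "0 \<le> ?E (\<lambda>Y. ?E (\<lambda>Z. of_bool (some X Y Z)))" for X by (intro cE_bounds(1)[OF w]) simp
    qed (use c2 c3 in auto)
    also have "\<dots> \<le> ?E (\<lambda>X. ?E (\<lambda>Y. ?E (\<lambda>Z. \<Sum>I\<in>nsets J0 f. of_bool (fin I X Y Z))))"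
    proof (intro cE_mono[OF w])
      fix X Y Z
      show "of_bool (some X Y Z) \<le> (\<Sum>I\<in>nsets J0 f. of_bool (fin I X Y Z) :: real)"
      proof (cases "some X Y Z")
        case True
        then obtain I where I: "I \<in> nsets J0 f" "fin I X Y Z" unfolding some_def by blast
        have "of_bool (fin I X Y Z) \<le> (\<Sum>I\<in>nsets J0 f. of_bool (fin I X Y Z) :: real)"
          by (rule member_le_sum[OF I(1)]) (use J0(3) finite_nsets in auto)
        then show ?thesis using I(2) by simp
      qed (simp add: sum_nonneg)
    qed
    also have "\<dots> = (\<Sum>I\<in>nsets J0 f. ?E (\<lambda>X. ?E (\<lambda>Y. ?E (\<lambda>Z. of_bool (fin I X Y Z)))))"
      by (simp only: cE_sum)
    finally have tot: "c1 * (c2 * c3) \<le> (\<Sum>I\<in>nsets J0 f. ?E (\<lambda>X. ?E (\<lambda>Y. ?E (\<lambda>Z. of_bool (fin I X Y Z)))))" .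
    have "\<exists>I\<in>nsets J0 f. c \<le> ?E (\<lambda>X. ?E (\<lambda>Y. ?E (\<lambda>Z. of_bool (fin I X Y Z))))"
    proof (rule ccontr)
      assume "\<not> ?thesis"
      then have "(\<Sum>I\<in>nsets J0 f. ?E (\<lambda>X. ?E (\<lambda>Y. ?E (\<lambda>Z. of_bool (fin I X Y Z)))))
          \<le> real (card (nsets J0 f)) * c"
        by (intro sum_bounded_above) (simp add: not_le less_imp_le)
      also have "\<dots> = real (R1 choose f) * c" using J0 by simp
      also have "\<dots> < (1 + real (R1 choose f)) * c" using c by simp
      also have "\<dots> = c1 * (c2 * c3)" by (simp add: c_def add_pos_nonneg)
      finally show False using tot by simp
    qed
    then obtain I where I: "I \<in> nsets J0 f" "c \<le> ?E (\<lambda>X. ?E (\<lambda>Y. ?E (\<lambda>Z. of_bool (fin I X Y Z))))" by blast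
    then show ?thesis
      using J0(1) unfolding fin_def by (intro exI[of _ I]) (auto simp: nsets_def)
  qed
  show thesis by (rule that[OF c]) (rule main)
qed

subsection \<open>The colour distribution is nearly a product measure\<close>

lemma cexp_const: "cexp S (\<lambda>_. ()) h x = (\<Sum>y\<in>S. h y) / real (card S)"
  by (simp add: cexp_def)

lemma sum_of_bool_eq: "(a :: nat) < K \<Longrightarrow> (\<Sum>b<K. of_bool (a = b) * (f b :: real)) = f a"
proof -
  assume a: "a < K"
  have "(\<Sum>b<K. of_bool (a = b) * f b) = (\<Sum>b<K. if a = b then f b else 0)"
    by (rule sum.cong) auto
  also have "\<dots> = f a" using a by (subst sum.delta') auto
  finally show ?thesis .
qed

text \<open>For a fixed colour pattern, the counting lemma replaces the indicators of the
  quasirandom colour classes by their constant densities. Summing over all \<open>K ^ card S\<close>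
  patterns, weighted by values of \<open>\<Phi>\<close> in the unit interval, gives the error
  term.\<close>

lemma model_approx:
  fixes \<kappa> :: "'i set \<Rightarrow> ('i \<Rightarrow> 'a) \<Rightarrow> nat"
  assumes fin: "finite (PiE I U)" "PiE I U \<noteq> {}" "finite S" "\<And>s. s \<in> S \<Longrightarrow> finite s"
    and anti: "\<And>s s'. s \<in> S \<Longrightarrow> s' \<in> S \<Longrightarrow> s \<subseteq> s' \<Longrightarrow> s = s'"
    and \<kappa>: "\<And>s. s \<in> S \<Longrightarrow> depends_on s (\<kappa> s)" "\<And>s x. s \<in> S \<Longrightarrow> \<kappa> s x < K"
    and reg: "\<And>s a. s \<in> S \<Longrightarrow> a < K \<Longrightarrow> regular (PiE I U) s
      (\<lambda>x. of_bool (\<kappa> s x = a) - cexp (PiE I U) (\<lambda>_. ()) (\<lambda>x. of_bool (\<kappa> s x = a)) x) \<mu>"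
    and p: "p = (\<lambda>s a. (\<Sum>x\<in>PiE I U. of_bool (\<kappa> s x = a)) / real (card (PiE I U)))"
  shows "cweights S K p"
    and "\<And>\<Phi>. (\<And>X. 0 \<le> \<Phi> X \<and> \<Phi> X \<le> 1) \<Longrightarrow>
      \<bar>(\<Sum>x\<in>PiE I U. \<Phi> (restrict (\<lambda>s. \<kappa> s x) S)) - real (card (PiE I U)) * cE S K p \<Phi>\<bar>
        \<le> real K ^ card S * (real (card S) * \<mu> * real (card (PiE I U)))"
proof -
  let ?O = "PiE I U" and ?n = "real (card (PiE I U))" and ?C = "PiE S (\<lambda>_. {..<K})"
  have n: "?n > 0" using fin by (simp add: card_gt_0_iff)
  show "cweights S K p"
    unfolding cweights_def
  proof (intro conjI ballI allI)
    fix s assume s: "s \<in> S"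
    show "0 \<le> p s a" for a by (simp add: p sum_nonneg)
    have "(\<Sum>a<K. p s a) = (\<Sum>a<K. \<Sum>x\<in>?O. of_bool (\<kappa> s x = a)) / ?n"
      by (simp only: p sum_divide_distrib)
    also have "(\<Sum>a<K. \<Sum>x\<in>?O. of_bool (\<kappa> s x = a)) = (\<Sum>x\<in>?O. \<Sum>a<K. of_bool (\<kappa> s x = a) * 1 :: real)"
      by (simp only: mult_1_right) (rule sum.swap)
    also have "\<dots> = (\<Sum>x\<in>?O. 1)"
      by (rule sum.cong[OF refl]) (rule sum_of_bool_eq[OF \<kappa>(2)[OF s]])
    finally show "(\<Sum>a<K. p s a) = 1" using n by simp
  qed (rule fin)
  fix \<Phi> :: "('i set \<Rightarrow> nat) \<Rightarrow> real" assume \<Phi>: "\<And>X. 0 \<le> \<Phi> X \<and> \<Phi> X \<le> 1"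
  have finC: "finite ?C" using fin(3) by (intro finite_PiE) auto
  have one: "\<bar>(\<Sum>x\<in>?O. \<Prod>s\<in>S. of_bool (\<kappa> s x = X s)) - ?n * (\<Prod>s\<in>S. p s (X s))\<bar>
      \<le> real (card S) * \<mu> * ?n" if X: "X \<in> ?C" for X
  proof -
    have pb: "0 \<le> p s a \<and> p s a \<le> 1" for s a
    proof -
      have "(\<Sum>x\<in>?O. of_bool (\<kappa> s x = a) :: real) \<le> ?n * 1"
        by (rule sum_bounded_above) simp
      then show ?thesis using n by (simp add: p sum_nonneg)
    qed
    have "\<bar>(\<Sum>x\<in>?O. \<Prod>s\<in>S. of_bool (\<kappa> s x = X s)) - (\<Sum>x\<in>?O. \<Prod>s\<in>S. p s (X s))\<bar>
      \<le> real (card S) * \<mu> * ?n"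
    proof (rule counting_lemma[where h = "\<lambda>s x. of_bool (\<kappa> s x = X s)" and w = "\<lambda>s x. p s (X s)"])
      fix s assume s: "s \<in> S"
      have "X s < K" using X s by (auto simp: PiE_iff)
      from reg[OF s this] show "regular ?O s (\<lambda>x. of_bool (\<kappa> s x = X s) - p s (X s)) \<mu>"
        by (simp only: cexp_const p)
      show "depends_on s (\<lambda>x. of_bool (\<kappa> s x = X s) :: real)"
      proof (rule depends_onI)
        fix x y :: "'i \<Rightarrow> 'a" assume "\<And>i. i \<in> s \<Longrightarrow> x i = y i"
        then have "\<kappa> s x = \<kappa> s y" by (rule depends_onD[OF \<kappa>(1)[OF s]])
        then show "of_bool (\<kappa> s x = X s) = (of_bool (\<kappa> s y = X s) :: real)" by simp
      qed
      show "depends_on s (\<lambda>x :: 'i \<Rightarrow> 'a. p s (X s))" by (rule depends_onI) simp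
      show "0 \<le> p s (X s) \<and> p s (X s) \<le> 1" by (rule pb)
      show "finite s" by (rule fin(4)[OF s])
      show "0 \<le> (of_bool (\<kappa> s x = X s) :: real) \<and> of_bool (\<kappa> s x = X s) \<le> (1 :: real)" for x
        by simp
    qed (use fin anti in auto)
    then show ?thesis by simp
  qed
  have expand: "\<Phi> (restrict (\<lambda>s. \<kappa> s x) S) = (\<Sum>X\<in>?C. \<Phi> X * (\<Prod>s\<in>S. of_bool (\<kappa> s x = X s)))" for x
  proof -
    let ?X = "restrict (\<lambda>s. \<kappa> s x) S"
    have X: "?X \<in> ?C" using \<kappa>(2) by auto
    have "(\<Prod>s\<in>S. of_bool (\<kappa> s x = X s) :: real) = of_bool (X = ?X)" if "X \<in> ?C" for X
    proof (cases "X = ?X")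
      case True
      then show ?thesis by simp
    next
      case False
      have "\<exists>s\<in>S. \<kappa> s x \<noteq> X s"
      proof (rule ccontr)
        assume "\<not> ?thesis"
        then have "X = ?X" using that by (intro ext) (auto simp: PiE_iff extensional_def)
        with False show False by simp
      qed
      then have "(\<Prod>s\<in>S. of_bool (\<kappa> s x = X s) :: real) = 0"
        using fin(3) by (auto simp: prod_zero_iff)
      then show ?thesis using False by simp
    qed
    then have "(\<Sum>X\<in>?C. \<Phi> X * (\<Prod>s\<in>S. of_bool (\<kappa> s x = X s))) = (\<Sum>X\<in>?C. if X = ?X then \<Phi> X else 0)"
      by (intro sum.cong) auto
    then show ?thesis using X finC by (simp add: sum.delta)
  qed
  have "(\<Sum>x\<in>?O. \<Phi> (restrict (\<lambda>s. \<kappa> s x) S)) - ?n * cE S K p \<Phi>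
      = (\<Sum>X\<in>?C. \<Phi> X * (\<Sum>x\<in>?O. \<Prod>s\<in>S. of_bool (\<kappa> s x = X s))) - (\<Sum>X\<in>?C. \<Phi> X * (?n * (\<Prod>s\<in>S. p s (X s))))"
    by (simp only: expand sum_distrib_left cE_def sum.swap[of _ ?C ?O] mult_ac)
  also have "\<dots> = (\<Sum>X\<in>?C. \<Phi> X * ((\<Sum>x\<in>?O. \<Prod>s\<in>S. of_bool (\<kappa> s x = X s)) - ?n * (\<Prod>s\<in>S. p s (X s))))"
    by (simp only: right_diff_distrib sum_subtractf)
  also have "\<bar>\<dots>\<bar> \<le> (\<Sum>X\<in>?C. real (card S) * \<mu> * ?n)"
  proof (rule order_trans[OF sum_abs sum_mono])
    fix X assume "X \<in> ?C"
    from one[OF this] \<Phi>[of X]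
    have "\<bar>\<Phi> X\<bar> * \<bar>(\<Sum>x\<in>?O. \<Prod>s\<in>S. of_bool (\<kappa> s x = X s)) - ?n * (\<Prod>s\<in>S. p s (X s))\<bar>
      \<le> 1 * (real (card S) * \<mu> * ?n)" by (intro mult_mono) auto
    then show "\<bar>\<Phi> X * ((\<Sum>x\<in>?O. \<Prod>s\<in>S. of_bool (\<kappa> s x = X s)) - ?n * (\<Prod>s\<in>S. p s (X s)))\<bar>
        \<le> real (card S) * \<mu> * ?n" by (simp add: abs_mult)
  qed
  also have "\<dots> = real K ^ card S * (real (card S) * \<mu> * ?n)"
    using fin(3) by (simp add: card_PiE)
  finally show "\<bar>(\<Sum>x\<in>?O. \<Phi> (restrict (\<lambda>s. \<kappa> s x) S)) - ?n * cE S K p \<Phi>\<bar>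
        \<le> real K ^ card S * (real (card S) * \<mu> * ?n)" .
qed

subsection \<open>Dense triples of cells\<close>

lemma nsets_insert:
  assumes "v \<notin> V"
  shows "nsets (insert v V) (Suc k) = nsets V (Suc k) \<union> insert v ` nsets V k"
    and "nsets V (Suc k) \<inter> insert v ` nsets V k = {}" and "inj_on (insert v) (nsets V k)"
proof -
  show "nsets V (Suc k) \<inter> insert v ` nsets V k = {}" using assms by (auto simp: nsets_def)
  show "inj_on (insert v) (nsets V k)"
  proof (rule inj_onI)
    fix x y assume xy: "x \<in> nsets V k" "y \<in> nsets V k" "insert v x = insert v y"
    then have "v \<notin> x" "v \<notin> y" using assms by (auto simp: nsets_def)
    with xy(3) show "x = y" by (simp add: insert_ident)
  qed
  show "nsets (insert v V) (Suc k) = nsets V (Suc k) \<union> insert v ` nsets V k" (is "?L = ?R")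
  proof
    show "?R \<subseteq> ?L" using assms by (auto simp: nsets_def card_insert_if)
    show "?L \<subseteq> ?R"
    proof
      fix e assume e: "e \<in> ?L"
      show "e \<in> ?R"
      proof (cases "v \<in> e")
        case True
        then have "e - {v} \<in> nsets V k" "e = insert v (e - {v})"
          using e by (auto simp: nsets_def)
        then show ?thesis by blast
      next
        case False
        then show ?thesis using e by (auto simp: nsets_def)
      qed
    qed
  qed
qed

text \<open>The recursion of the elementary symmetric polynomials in the values of
  \<open>g\<close>.\<close>

lemma sum_nsets_insert:
  fixes g :: "'v \<Rightarrow> real"
  assumes "finite V" "v \<notin> V"
  shows "(\<Sum>e\<in>nsets (insert v V) (Suc k). \<Prod>u\<in>e. g u)
    = (\<Sum>e\<in>nsets V (Suc k). \<Prod>u\<in>e. g u) + g v * (\<Sum>e\<in>nsets V k. \<Prod>u\<in>e. g u)"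
proof -
  have "(\<Sum>e\<in>insert v ` nsets V k. \<Prod>u\<in>e. g u) = (\<Sum>e\<in>nsets V k. \<Prod>u\<in>insert v e. g u)"
    by (rule sum.reindex_cong[OF nsets_insert(3)[OF assms(2)] refl]) simp
  also have "\<dots> = (\<Sum>e\<in>nsets V k. g v * (\<Prod>u\<in>e. g u))"
  proof (rule sum.cong[OF refl])
    fix e assume "e \<in> nsets V k"
    then have "finite e" "v \<notin> e" using assms by (auto simp: nsets_def)
    then show "(\<Prod>u\<in>insert v e. g u) = g v * (\<Prod>u\<in>e. g u)" by simp
  qed
  also have "\<dots> = g v * (\<Sum>e\<in>nsets V k. \<Prod>u\<in>e. g u)" by (simp add: sum_distrib_left)
  finally show ?thesis
    unfolding nsets_insert(1)[OF assms(2)]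
    using assms nsets_insert(2)[OF assms(2), of k]
    by (subst sum.union_disjoint) (auto simp: finite_nsets)
qed

lemma sum_nsets_2_le:
  fixes g :: "'v \<Rightarrow> real"
  assumes "finite V" "\<And>v. 0 \<le> g v"
  shows "(\<Sum>e\<in>nsets V 2. \<Prod>u\<in>e. g u) \<le> (\<Sum>v\<in>V. g v)\<^sup>2 / 2"
  using assms(1)
proof (induction V rule: finite_induct)
  case empty
  then show ?case by (simp add: nsets_empty_iff)
next
  case (insert v V)
  have "(\<Sum>e\<in>nsets V 1. \<Prod>u\<in>e. g u) = (\<Sum>u\<in>V. g u)"
    by (simp add: nsets_one sum.reindex inj_on_def)
  then have "(\<Sum>e\<in>nsets (insert v V) 2. \<Prod>u\<in>e. g u)
      = (\<Sum>e\<in>nsets V 2. \<Prod>u\<in>e. g u) + g v * (\<Sum>u\<in>V. g u)"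
    using sum_nsets_insert[OF insert.hyps, of g 1] by (simp add: numeral_2_eq_2)
  moreover have "(g v + (\<Sum>u\<in>V. g u))\<^sup>2 / 2 = (\<Sum>u\<in>V. g u)\<^sup>2 / 2 + g v * (\<Sum>u\<in>V. g u) + (g v)\<^sup>2 / 2"
    by (simp add: power2_eq_square algebra_simps)
  moreover have "0 \<le> (g v)\<^sup>2 / 2" by simp
  ultimately show ?case
    unfolding sum.insert[OF insert.hyps] using insert.IH by linarith
qed

text \<open>The cube of the sum contains each product of three distinct values six times, and its
  other terms are non-negative.\<close>

lemma sum_nsets_3_le:
  fixes g :: "'v \<Rightarrow> real"
  assumes "finite V" "\<And>v. 0 \<le> g v"
  shows "(\<Sum>e\<in>nsets V 3. \<Prod>u\<in>e. g u) \<le> (\<Sum>v\<in>V. g v) ^ 3 / 6"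
  using assms(1)
proof (induction V rule: finite_induct)
  case empty
  then show ?case by (simp add: nsets_empty_iff)
next
  case (insert v V)
  let ?s = "\<Sum>u\<in>V. g u"
  have s: "0 \<le> ?s" using assms(2) by (simp add: sum_nonneg)
  have "(\<Sum>e\<in>nsets (insert v V) 3. \<Prod>u\<in>e. g u)
      = (\<Sum>e\<in>nsets V 3. \<Prod>u\<in>e. g u) + g v * (\<Sum>e\<in>nsets V 2. \<Prod>u\<in>e. g u)"
    using sum_nsets_insert[OF insert.hyps, of g 2] by (simp add: numeral_3_eq_3 numeral_2_eq_2)
  also have "\<dots> \<le> ?s ^ 3 / 6 + g v * (?s\<^sup>2 / 2)"
    using insert.IH sum_nsets_2_le[OF insert.hyps(1) assms(2)] assms(2)
    by (intro add_mono mult_left_mono) auto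
  also have "\<dots> \<le> ?s ^ 3 / 6 + g v * (?s\<^sup>2 / 2) + ((g v)\<^sup>2 * ?s / 2 + g v ^ 3 / 6)"
    using s assms(2)[of v] by simp
  also have "\<dots> = (g v + ?s) ^ 3 / 6"
    by (simp add: power2_eq_square power3_eq_cube algebra_simps)
  finally show ?case using insert.hyps by simp
qed

text \<open>Cells of different sizes call for weights instead of subsets. The difference
  \<open>P\<close> of the two sums is affine in each single weight, so it is smallest at weights
  \<open>0\<close> and \<open>1\<close>, where the claim is uniform density for a set
  \<open>U\<close>.\<close>

lemma unif_dense_weighted:
  fixes g :: "'v \<Rightarrow> real"
  assumes G: "is_3graph V E" and ud: "unif_dense d \<eta> V E"
    and g: "\<And>v. 0 \<le> g v \<and> g v \<le> 1"
  shows "d * (\<Sum>e\<in>nsets V 3. \<Prod>v\<in>e. g v) - \<eta> * real (card V) ^ 3 \<le> (\<Sum>e\<in>E. \<Prod>v\<in>e. g v)"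
proof -
  have finV: "finite V" and E: "E \<subseteq> nsets V 3"
    using G by (auto simp: is_3graph_def nsets_def intro: finite_subset)
  have finE: "finite E" using finite_subset[OF E] finV by (simp add: finite_nsets)
  define P where "P g = (\<Sum>e\<in>E. \<Prod>v\<in>e. g v) - d * (\<Sum>e\<in>nsets V 3. \<Prod>v\<in>e. g v)" for g :: "'v \<Rightarrow> real"
  have affine: "P g = (1 - g v) * P (g(v := 0)) + g v * P (g(v := 1))" for g v
  proof -
    have pr: "(\<Prod>u\<in>e. g u) = (1 - g v) * (\<Prod>u\<in>e. (g(v := 0)) u) + g v * (\<Prod>u\<in>e. (g(v := 1)) u)"
      if "finite e" for e
    proof (cases "v \<in> e")
      case True
      have "(\<Prod>u\<in>e - {v}. (g(v := c)) u) = (\<Prod>u\<in>e - {v}. g u)" for c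
        by (rule prod.cong) auto
      then show ?thesis
        using True that by (simp add: prod.remove[of e v])
    next
      case False
      have "(\<Prod>u\<in>e. (g(v := c)) u) = (\<Prod>u\<in>e. g u)" for c
        by (rule prod.cong) (use False in auto)
      then show ?thesis by (simp add: algebra_simps)
    qed
    have su: "(\<Sum>e\<in>F. \<Prod>u\<in>e. g u) = (1 - g v) * (\<Sum>e\<in>F. \<Prod>u\<in>e. (g(v := 0)) u) + g v * (\<Sum>e\<in>F. \<Prod>u\<in>e. (g(v := 1)) u)"
      if "F \<subseteq> nsets V 3" for F
    proof -
      have "(\<Sum>e\<in>F. \<Prod>u\<in>e. g u) = (\<Sum>e\<in>F. (1 - g v) * (\<Prod>u\<in>e. (g(v := 0)) u) + g v * (\<Prod>u\<in>e. (g(v := 1)) u))"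
        by (rule sum.cong[OF refl], rule pr) (use that in \<open>auto simp: nsets_def\<close>)
      then show ?thesis by (simp only: sum.distrib sum_distrib_left)
    qed
    show ?thesis unfolding P_def su[OF E] su[OF subset_refl] by (simp add: algebra_simps)
  qed
  have "- (\<eta> * real (card V) ^ 3) \<le> P g"
    if "finite A" "\<And>v. v \<notin> A \<Longrightarrow> g v \<in> {0, 1}" "\<And>v. 0 \<le> g v \<and> g v \<le> 1" for A g
    using that
  proof (induction A arbitrary: g rule: finite_induct)
    case empty
    define U where "U = {v \<in> V. g v = 1}"
    have pr: "(\<Prod>v\<in>e. g v) = of_bool (e \<subseteq> U)" if "e \<in> nsets V 3" for e
    proof (cases "e \<subseteq> U")
      case True
      then have "(\<Prod>v\<in>e. g v) = (\<Prod>v\<in>e. 1)" by (intro prod.cong) (auto simp: U_def)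
      then show ?thesis using True by simp
    next
      case False
      then obtain v where v: "v \<in> e" "v \<notin> U" by blast
      then have "g v = 0" using that empty(1)[of v] by (auto simp: U_def nsets_def)
      then show ?thesis using v(1) False that by (auto simp: nsets_def prod_zero_iff)
    qed
    have "U \<subseteq> V" by (auto simp: U_def)
    have cnt: "(\<Sum>e\<in>F. \<Prod>v\<in>e. g v) = real (card {e \<in> F. e \<subseteq> U})" if "F \<subseteq> nsets V 3" for F
    proof -
      have "finite F" using that finV finite_subset[OF that] by (simp add: finite_nsets)
      have "(\<Sum>e\<in>F. \<Prod>v\<in>e. g v) = (\<Sum>e\<in>F. of_bool (e \<subseteq> U))"
        by (rule sum.cong[OF refl], rule pr, rule subsetD[OF that])
      also have "\<dots> = real (card {e \<in> F. e \<subseteq> U})"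
        using \<open>finite F\<close> by (simp add: Int_def)
      finally show ?thesis .
    qed
    have "{e \<in> nsets V 3. e \<subseteq> U} = nsets U 3" using \<open>U \<subseteq> V\<close> by (auto simp: nsets_def)
    then have "P g = real (card {e \<in> E. e \<subseteq> U}) - d * real (card U choose 3)"
      unfolding P_def cnt[OF E] cnt[OF subset_refl] by simp
    moreover have "real (card {e \<in> E. e \<subseteq> U}) \<ge> d * real (card U choose 3) - \<eta> * real (card V) ^ 3"
      using ud \<open>U \<subseteq> V\<close> unfolding unif_dense_def by blast
    ultimately show ?case by simp
  next
    case (insert v A)
    let ?B = "- (\<eta> * real (card V) ^ 3)"
    have gv: "0 \<le> g v" "g v \<le> 1" using insert.prems by auto
    have "?B \<le> P (g(v := 0))" "?B \<le> P (g(v := 1))"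
      by (rule insert.IH; use insert.prems in auto)+
    then have "(1 - g v) * ?B + g v * ?B \<le> (1 - g v) * P (g(v := 0)) + g v * P (g(v := 1))"
      using gv by (intro add_mono mult_left_mono) auto
    then show ?case unfolding affine[of g v] by (simp add: algebra_simps)
  qed
  from this[of V "\<lambda>v. if v \<in> V then g v else 0"] finV g
  have "- (\<eta> * real (card V) ^ 3) \<le> P (\<lambda>v. if v \<in> V then g v else 0)" by simp
  also have "P (\<lambda>v. if v \<in> V then g v else 0) = P g"
  proof -
    have "(\<Sum>e\<in>F. \<Prod>v\<in>e. if v \<in> V then g v else 0) = (\<Sum>e\<in>F. \<Prod>v\<in>e. g v)" if "F \<subseteq> nsets V 3" for F
      by (intro sum.cong prod.cong) (use that in \<open>auto simp: nsets_def\<close>)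
    then show ?thesis using E by (simp add: P_def)
  qed
  finally show ?thesis by (simp add: P_def)
qed

section \<open>Weights of transversal edges\<close>

lemma real_choose_3: "real (n choose 3) * 6 = real n * (real n - 1) * (real n - 2)"
proof (induction n)
  case (Suc n)
  have "real (n choose 2) * 2 = real n * (real n - 1)"
  proof (induction n)
    case (Suc n)
    then show ?case by (simp add: numeral_2_eq_2 algebra_simps)
  qed simp
  then show ?case using Suc by (simp add: numeral_3_eq_3 numeral_2_eq_2 algebra_simps)
qed simp

text \<open>The weights \<open>m / card (U i)\<close> give every cell the same total weight
  \<open>m\<close>. The weight of the transversal members of \<open>\<F>\<close> then is
  \<open>m ^ card \<tau>\<close> times their density, whatever the sizes of the cells.\<close>

lemma sum_transversal:
  fixes g :: "'v \<Rightarrow> real"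
  assumes I: "finite I" and U: "\<And>i. i \<in> I \<Longrightarrow> finite (U i) \<and> U i \<noteq> {}"
    and disj: "disjoint_family_on U I" and \<tau>: "\<tau> \<subseteq> I" and fin: "finite \<F>"
    and g: "\<And>i v. i \<in> I \<Longrightarrow> v \<in> U i \<Longrightarrow> g v = m / real (card (U i))"
  shows "real (card (PiE I U)) * (\<Sum>e\<in>\<F>. of_bool (\<exists>x\<in>PiE I U. x ` \<tau> = e) * (\<Prod>v\<in>e. g v))
    = m ^ card \<tau> * (\<Sum>x\<in>PiE I U. of_bool (x ` \<tau> \<in> \<F>))"
proof -
  let ?O = "PiE I U"
  have finO: "finite ?O" using I U by (intro finite_PiE) auto
  have fint: "finite \<tau>" using I \<tau> finite_subset by blast
  have same: "i = j" if "i \<in> I" "j \<in> I" "v \<in> U i" "v \<in> U j" for i j v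
    using disj that unfolding disjoint_family_on_def by blast
  have one: "real (card ?O) * (of_bool (\<exists>x\<in>?O. x ` \<tau> = e) * (\<Prod>v\<in>e. g v))
      = m ^ card \<tau> * real (card {x\<in>?O. x ` \<tau> = e})" for e
  proof (cases "\<exists>x\<in>?O. x ` \<tau> = e")
    case False
    then have "{x\<in>?O. x ` \<tau> = e} = {}" by blast
    then have "card {x\<in>?O. x ` \<tau> = e} = 0" by (simp only: card.empty)
    then show ?thesis using False by simp
  next
    case True
    then obtain x0 where x0: "x0 \<in> ?O" "x0 ` \<tau> = e" by blast
    have x0U: "x0 i \<in> U i" if "i \<in> I" for i using x0(1) that by (auto simp: PiE_iff)
    have inj: "inj_on x0 \<tau>"
      by (rule inj_onI) (metis \<tau> same subsetD x0U)
    have set: "{x\<in>?O. x ` \<tau> = e} = PiE I (\<lambda>i. if i \<in> \<tau> then {x0 i} else U i)" (is "?L = ?R")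
    proof
      show "?L \<subseteq> ?R"
      proof
        fix x assume "x \<in> ?L"
        then have x: "x \<in> ?O" "x ` \<tau> = x0 ` \<tau>" using x0 by auto
        have "x i = x0 i" if i: "i \<in> \<tau>" for i
        proof -
          obtain j where j: "j \<in> \<tau>" "x i = x0 j" using x(2) i by (metis imageE imageI)
          have "x i \<in> U i" using x(1) i \<tau> by (auto simp: PiE_iff)
          then have "i = j" using same[of i j "x i"] x0U[of j] j i \<tau> by auto
          then show ?thesis using j by simp
        qed
        then show "x \<in> ?R" using x(1) by (auto simp: PiE_iff)
      qed
      show "?R \<subseteq> ?L"
      proof
        fix x assume x: "x \<in> ?R"
        have eq: "x i = x0 i" if "i \<in> \<tau>" for i
        proof -
          have "x i \<in> (if i \<in> \<tau> then {x0 i} else U i)" by (rule PiE_mem[OF x]) (use that \<tau> in auto)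
          then show ?thesis using that by simp
        qed
        have "x \<in> ?O"
        proof (rule PiE_I)
          fix i assume i: "i \<in> I"
          then have "x i \<in> (if i \<in> \<tau> then {x0 i} else U i)" by (rule PiE_mem[OF x])
          then show "x i \<in> U i" using x0U[OF i] by (auto split: if_splits)
        qed (use x in auto)
        moreover have "x ` \<tau> = x0 ` \<tau>" using eq by (intro image_cong) auto
        ultimately show "x \<in> ?L" using x0 by simp
      qed
    qed
    have split: "(\<Prod>i\<in>I. f i) = (\<Prod>i\<in>\<tau>. f i) * (\<Prod>i\<in>I - \<tau>. f i)" for f :: "_ \<Rightarrow> real"
      using prod.subset_diff[OF \<tau> I, of f] by (simp add: mult.commute)
    have "real (card {x\<in>?O. x ` \<tau> = e}) = (\<Prod>i\<in>I. if i \<in> \<tau> then 1 else real (card (U i)))"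
      unfolding set using I by (subst card_PiE) (auto intro!: prod.cong)
    also have "\<dots> = (\<Prod>i\<in>I - \<tau>. real (card (U i)))"
      unfolding split by simp
    finally have 1: "real (card {x\<in>?O. x ` \<tau> = e}) = (\<Prod>i\<in>I - \<tau>. real (card (U i)))" .
    have 2: "real (card ?O) = (\<Prod>i\<in>\<tau>. real (card (U i))) * (\<Prod>i\<in>I - \<tau>. real (card (U i)))"
      using I by (simp add: card_PiE split)
    have "(\<Prod>v\<in>e. g v) = (\<Prod>i\<in>\<tau>. g (x0 i))"
      unfolding x0(2)[symmetric] using inj by (simp add: prod.reindex)
    also have "\<dots> = (\<Prod>i\<in>\<tau>. m / real (card (U i)))"
      using \<tau> x0U by (intro prod.cong g) auto
    also have "\<dots> = m ^ card \<tau> / (\<Prod>i\<in>\<tau>. real (card (U i)))"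
      by (simp add: prod_dividef)
    finally have 3: "(\<Prod>v\<in>e. g v) = m ^ card \<tau> / (\<Prod>i\<in>\<tau>. real (card (U i)))" .
    have "(\<Prod>i\<in>\<tau>. real (card (U i))) \<noteq> 0"
    proof -
      have "card (U a) \<noteq> 0" if "a \<in> \<tau>" for a
        using U[of a] subsetD[OF \<tau> that] by (simp add: card_eq_0_iff)
      then show ?thesis using fint by (simp add: prod_zero_iff)
    qed
    then show ?thesis using True 1 2 3 by simp
  qed
  have "real (card ?O) * (\<Sum>e\<in>\<F>. of_bool (\<exists>x\<in>?O. x ` \<tau> = e) * (\<Prod>v\<in>e. g v))
      = (\<Sum>e\<in>\<F>. m ^ card \<tau> * real (card {x\<in>?O. x ` \<tau> = e}))"
    unfolding sum_distrib_left using one by (intro sum.cong) auto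
  also have "\<dots> = m ^ card \<tau> * (\<Sum>e\<in>\<F>. \<Sum>x\<in>?O. of_bool (x ` \<tau> = e))"
    using finO by (simp add: sum_distrib_left Int_def)
  also have "(\<Sum>e\<in>\<F>. \<Sum>x\<in>?O. of_bool (x ` \<tau> = e) :: real) = (\<Sum>x\<in>?O. \<Sum>e\<in>\<F>. of_bool (x ` \<tau> = e))"
    by (rule sum.swap)
  also have "\<dots> = (\<Sum>x\<in>?O. of_bool (x ` \<tau> \<in> \<F>))"
  proof (rule sum.cong[OF refl])
    fix x
    have "(\<Sum>e\<in>\<F>. of_bool (x ` \<tau> = e) :: real) = (\<Sum>e\<in>\<F>. if x ` \<tau> = e then 1 else 0)"
      by (rule sum.cong) auto
    then show "(\<Sum>e\<in>\<F>. of_bool (x ` \<tau> = e) :: real) = of_bool (x ` \<tau> \<in> \<F>)"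
      using fin by (simp add: sum.delta')
  qed
  finally show ?thesis .
qed

text \<open>If all triples of \<open>Q\<close> had density below \<open>d / 2\<close>, the
  transversal edges would have about half the weight that uniform density demands. Triples with two
  vertices in one cell have weight of order \<open>(card Q)\<^sup>2\<close> only, against
  \<open>(card Q) ^ 3\<close>, and cannot make up for this when \<open>card Q\<close> exceeds
  \<open>32 / d\<close>.\<close>

lemma dense_triple:
  fixes V :: "'v set"
  assumes G: "is_3graph V E" and ud: "unif_dense d \<eta> V E" and d: "0 < d" and V: "V \<noteq> {}"
    and I: "finite I" and U: "\<And>i. i \<in> I \<Longrightarrow> U i \<subseteq> V \<and> U i \<noteq> {}" "disjoint_family_on U I"
    and \<theta>: "0 < \<theta>" "\<And>i. i \<in> I \<Longrightarrow> \<theta> * real (card V) \<le> real (card (U i))" "\<eta> \<le> \<theta> ^ 3"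
    and Q: "Q \<subseteq> I" "card Q \<ge> 4" "real (card Q) * d > 32"
  shows "\<exists>\<tau>\<in>nsets Q 3. d / 2 * real (card (PiE I U)) \<le> (\<Sum>x\<in>PiE I U. of_bool (x ` \<tau> \<in> E))"
proof (rule ccontr)
  assume no: "\<not> ?thesis"
  let ?O = "PiE I U" and ?n = "real (card V)" and ?q = "real (card Q)"
  have finV: "finite V" and E: "E \<subseteq> nsets V 3"
    using G by (auto simp: is_3graph_def nsets_def intro: finite_subset)
  have finE: "finite E" using finite_subset[OF E] finV by (simp add: finite_nsets)
  have finU: "finite (U i)" if "i \<in> I" for i using U(1)[OF that] finV finite_subset by blast
  have finQ: "finite Q" using Q(1) I finite_subset by blast
  have O: "real (card ?O) > 0"
    using I U(1) finU by (auto simp: card_gt_0_iff PiE_eq_empty_iff intro!: finite_PiE)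
  have n: "?n > 0" using V finV by (simp add: card_gt_0_iff)
  \<comment> \<open>A common lower bound for the sizes of the cells, so that all weights are at most
    \<open>1\<close>. The error term of uniform density is then at most \<open>m ^ 3\<close> because
    of \<open>\<eta> \<le> \<theta> ^ 3\<close>.\<close>
  define m where "m = \<theta> * ?n"
  have m: "m > 0" using \<theta> n by (simp add: m_def)
  have same: "i = j" if "i \<in> I" "j \<in> I" "v \<in> U i" "v \<in> U j" for i j v
    using U(2) that unfolding disjoint_family_on_def by blast
  define g where "g v = (\<Sum>i\<in>Q. of_bool (v \<in> U i) * (m / real (card (U i))))" for v
  have cU: "real (card (U i)) > 0" if "i \<in> I" for i
    using U(1)[OF that] finU[OF that] by (simp add: card_gt_0_iff)
  have gU: "g v = m / real (card (U i))" if "i \<in> Q" "v \<in> U i" for i v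
  proof -
    have "g v = (\<Sum>j\<in>Q. if j = i then m / real (card (U i)) else 0)"
      unfolding g_def
    proof (rule sum.cong[OF refl])
      fix j assume "j \<in> Q"
      then have "v \<in> U j \<longleftrightarrow> j = i" using that same[of j i v] Q(1) by blast
      then show "of_bool (v \<in> U j) * (m / real (card (U j))) = (if j = i then m / real (card (U i)) else 0)"
        by simp
    qed
    then show ?thesis using finQ that by (simp add: sum.delta)
  qed
  have g0: "0 \<le> g v" for v using m by (auto simp: g_def intro!: sum_nonneg)
  have g1: "g v \<le> 1" for v
  proof (cases "\<exists>i\<in>Q. v \<in> U i")
    case True
    then obtain i where i: "i \<in> Q" "v \<in> U i" by blast
    then have "i \<in> I" using Q(1) by blast
    then show ?thesis using gU[OF i] \<theta>(2)[of i] cU[of i] by (simp add: m_def)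
  next
    case False
    then have "g v = 0" by (simp add: g_def)
    then show ?thesis by simp
  qed
  have sumg: "(\<Sum>v\<in>V. g v) = ?q * m"
  proof -
    have "(\<Sum>v\<in>V. g v) = (\<Sum>i\<in>Q. \<Sum>v\<in>V. of_bool (v \<in> U i) * (m / real (card (U i))))"
      unfolding g_def by (rule sum.swap)
    also have "\<dots> = (\<Sum>i\<in>Q. m)"
    proof (rule sum.cong[OF refl])
      fix i assume i: "i \<in> Q"
      then have iI: "i \<in> I" using Q(1) by blast
      have "(\<Sum>v\<in>V. of_bool (v \<in> U i) * (m / real (card (U i)))) = (\<Sum>v\<in>U i. m / real (card (U i)))"
        using U(1)[OF iI] by (intro sum.mono_neutral_cong_right finV) auto
      then show "(\<Sum>v\<in>V. of_bool (v \<in> U i) * (m / real (card (U i)))) = m" using cU[OF iI] by simp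
    qed
    finally show ?thesis by simp
  qed
  define ty where "ty e \<tau> \<longleftrightarrow> (\<exists>x\<in>?O. x ` \<tau> = e)" for e \<tau>
  let ?pr = "\<lambda>e. \<Prod>v\<in>e. g v"
  have pr0: "0 \<le> ?pr e" for e using g0 by (intro prod_nonneg) auto
  have tr: "(\<Sum>e\<in>\<F>. of_bool (ty e \<tau>) * ?pr e) = m ^ 3 * ((\<Sum>x\<in>?O. of_bool (x ` \<tau> \<in> \<F>)) / real (card ?O))"
    if \<tau>: "\<tau> \<in> nsets Q 3" and F: "finite \<F>" for \<tau> \<F>
  proof -
    \<comment> \<open>\<open>sum_transversal\<close> asks for weights on all cells of
      \<open>I\<close>, whereas \<open>g\<close> is zero outside those of \<open>Q\<close>. Both
      agree on the triples that are transversal to \<open>\<tau>\<close>.\<close>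
    define g' where "g' v = (\<Sum>i\<in>I. of_bool (v \<in> U i) * (m / real (card (U i))))" for v
    have g'U: "g' v = m / real (card (U i))" if "i \<in> I" "v \<in> U i" for i v
    proof -
      have "g' v = (\<Sum>j\<in>I. if j = i then m / real (card (U i)) else 0)"
        unfolding g'_def
      proof (rule sum.cong[OF refl])
        fix j assume "j \<in> I"
        then have "v \<in> U j \<longleftrightarrow> j = i" using that same[of j i v] by blast
        then show "of_bool (v \<in> U j) * (m / real (card (U j))) = (if j = i then m / real (card (U i)) else 0)"
          by simp
      qed
      then show ?thesis using I that by (simp add: sum.delta)
    qed
    have \<tau>Q: "\<tau> \<subseteq> Q" "card \<tau> = 3" using \<tau> by (auto simp: nsets_def)
    have "of_bool (ty e \<tau>) * ?pr e = of_bool (ty e \<tau>) * (\<Prod>v\<in>e. g' v)" for e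
    proof (cases "ty e \<tau>")
      case True
      then obtain x where x: "x \<in> ?O" "x ` \<tau> = e" unfolding ty_def by blast
      have "?pr e = (\<Prod>v\<in>e. g' v)"
      proof (rule prod.cong[OF refl])
        fix v assume "v \<in> e"
        then obtain i where i: "i \<in> \<tau>" "v = x i" using x(2) by blast
        then have "v \<in> U i" "i \<in> Q" "i \<in> I" using x(1) \<tau>Q Q(1) by (auto simp: PiE_iff)
        then show "g v = g' v" using gU g'U by simp
      qed
      then show ?thesis by simp
    qed simp
    then have "real (card ?O) * (\<Sum>e\<in>\<F>. of_bool (ty e \<tau>) * ?pr e)
        = real (card ?O) * (\<Sum>e\<in>\<F>. of_bool (\<exists>x\<in>?O. x ` \<tau> = e) * (\<Prod>v\<in>e. g' v))"
      unfolding ty_def[symmetric] by (simp only:)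
    also have "\<dots> = m ^ card \<tau> * (\<Sum>x\<in>?O. of_bool (x ` \<tau> \<in> \<F>))"
      by (rule sum_transversal) (use I U finU \<tau>Q Q(1) F g'U in auto)
    finally show ?thesis using O \<tau>Q by (simp add: field_simps)
  qed
  have fin3: "finite (nsets Q 3)" using finQ by (rule finite_nsets)
  have finV3: "finite (nsets V 3)" using finV by (rule finite_nsets)
  have ty1: "(\<Sum>\<tau>\<in>nsets Q 3. of_bool (ty e \<tau>) :: real) \<le> 1" for e
  proof -
    have uniq: "\<tau> \<subseteq> \<tau>'" if t: "\<tau> \<in> nsets Q 3" "\<tau>' \<in> nsets Q 3" "ty e \<tau>" "ty e \<tau>'" for \<tau> \<tau>'
    proof
      fix i assume i: "i \<in> \<tau>"
      obtain x y where x: "x \<in> ?O" "x ` \<tau> = e" and y: "y \<in> ?O" "y ` \<tau>' = e"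
        using t(3,4) unfolding ty_def by blast
      then obtain j where j: "j \<in> \<tau>'" "x i = y j" using i by (metis imageE imageI)
      have "i \<in> I" "j \<in> I" using i j t(1,2) Q(1) by (auto simp: nsets_def)
      then have "i = j" using same[of i j "x i"] x(1) y(1) j by (auto simp: PiE_iff)
      then show "i \<in> \<tau>'" using j by simp
    qed
    have "(\<Sum>\<tau>\<in>nsets Q 3. of_bool (ty e \<tau>) :: real) = real (card {\<tau>\<in>nsets Q 3. ty e \<tau>})"
      using fin3 by (simp add: Int_def)
    also have "\<dots> \<le> 1"
    proof -
      have "card {\<tau>\<in>nsets Q 3. ty e \<tau>} \<le> Suc 0"
        by (rule card_le_Suc0_iff_eq[THEN iffD2]) (use fin3 uniq in \<open>auto intro!: equalityI\<close>)
      then show ?thesis by simp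
    qed
    finally show ?thesis .
  qed
  define C where "C = real (card Q choose 3)"
  have C6: "C * 6 = ?q * (?q - 1) * (?q - 2)" unfolding C_def by (rule real_choose_3)
  let ?T = "\<lambda>e. \<Sum>\<tau>\<in>nsets Q 3. of_bool (ty e \<tau>) :: real"
  have trans: "(\<Sum>e\<in>\<F>. ?T e * ?pr e)
      = m ^ 3 * (\<Sum>\<tau>\<in>nsets Q 3. (\<Sum>x\<in>?O. of_bool (x ` \<tau> \<in> \<F>)) / real (card ?O))" if "finite \<F>" for \<F>
  proof -
    have "(\<Sum>e\<in>\<F>. ?T e * ?pr e) = (\<Sum>\<tau>\<in>nsets Q 3. \<Sum>e\<in>\<F>. of_bool (ty e \<tau>) * ?pr e)"
      unfolding sum_distrib_right by (rule sum.swap)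
    also have "\<dots> = (\<Sum>\<tau>\<in>nsets Q 3. m ^ 3 * ((\<Sum>x\<in>?O. of_bool (x ` \<tau> \<in> \<F>)) / real (card ?O)))"
      by (rule sum.cong[OF refl]) (rule tr[OF _ that])
    finally show ?thesis by (simp only: sum_distrib_left)
  qed
  have all: "(\<Sum>e\<in>nsets V 3. ?T e * ?pr e) = C * m ^ 3"
  proof -
    have one: "(\<Sum>x\<in>?O. of_bool (x ` \<tau> \<in> nsets V 3)) / real (card ?O) = 1" if \<tau>: "\<tau> \<in> nsets Q 3" for \<tau>
    proof -
      have "x ` \<tau> \<in> nsets V 3" if x: "x \<in> ?O" for x
      proof -
        have \<tau>I: "\<tau> \<subseteq> I" "card \<tau> = 3" "finite \<tau>" using \<tau> Q(1) by (auto simp: nsets_def)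
        have xU: "x i \<in> U i" if "i \<in> \<tau>" for i using x \<tau>I that by (auto simp: PiE_iff)
        have "inj_on x \<tau>" by (rule inj_onI) (metis \<tau>I(1) same subsetD xU)
        then have "card (x ` \<tau>) = 3" using \<tau>I by (simp add: card_image)
        moreover have "x ` \<tau> \<subseteq> V" using xU U(1) \<tau>I by blast
        ultimately show ?thesis using \<tau>I by (simp add: nsets_def)
      qed
      then show ?thesis using O by simp
    qed
    have "(\<Sum>\<tau>\<in>nsets Q 3. (\<Sum>x\<in>?O. of_bool (x ` \<tau> \<in> nsets V 3)) / real (card ?O)) = (\<Sum>\<tau>\<in>nsets Q 3. 1)"
      by (rule sum.cong[OF refl one])
    then show ?thesis unfolding trans[OF finV3] using finQ by (simp add: C_def)
  qed
  have "d * (C * m ^ 3) \<le> d * (\<Sum>e\<in>nsets V 3. ?pr e)"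
  proof -
    have "(\<Sum>e\<in>nsets V 3. ?T e * ?pr e) \<le> (\<Sum>e\<in>nsets V 3. 1 * ?pr e)"
      by (intro sum_mono mult_right_mono ty1 pr0)
    then show ?thesis using d unfolding all by simp
  qed
  moreover have "d * (\<Sum>e\<in>nsets V 3. ?pr e) - \<eta> * ?n ^ 3 \<le> (\<Sum>e\<in>E. ?pr e)"
    by (rule unif_dense_weighted[OF G ud]) (use g0 g1 in auto)
  moreover have "\<eta> * ?n ^ 3 \<le> m ^ 3"
    using \<theta>(3) n by (simp add: m_def power_mult_distrib mult_right_mono)
  moreover have "(\<Sum>e\<in>E. ?pr e) \<le> m ^ 3 * (C * (d / 2)) + (?q ^ 3 / 6 - C) * m ^ 3"
  proof -
    have "(\<Sum>e\<in>E. ?pr e) = (\<Sum>e\<in>E. ?T e * ?pr e) + (\<Sum>e\<in>E. (1 - ?T e) * ?pr e)"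
      by (simp only: sum.distrib[symmetric] distrib_right[symmetric]) simp
    moreover have "(\<Sum>e\<in>E. ?T e * ?pr e) \<le> m ^ 3 * (C * (d / 2))"
    proof -
      have "(\<Sum>\<tau>\<in>nsets Q 3. (\<Sum>x\<in>?O. of_bool (x ` \<tau> \<in> E)) / real (card ?O)) \<le> real (card (nsets Q 3)) * (d / 2)"
      proof (rule sum_bounded_above)
        fix \<tau> assume "\<tau> \<in> nsets Q 3"
        then have "(\<Sum>x\<in>?O. of_bool (x ` \<tau> \<in> E)) \<le> d / 2 * real (card ?O)"
          using no by (meson less_imp_le not_le)
        then show "(\<Sum>x\<in>?O. of_bool (x ` \<tau> \<in> E)) / real (card ?O) \<le> d / 2"
          using O by (simp add: divide_le_eq)
      qed
      then show ?thesis unfolding trans[OF finE] using m finQ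
        by (intro mult_left_mono) (auto simp: C_def)
    qed
    moreover have "(\<Sum>e\<in>E. (1 - ?T e) * ?pr e) \<le> (\<Sum>e\<in>nsets V 3. (1 - ?T e) * ?pr e)"
      by (rule sum_mono2[OF finV3 E]) (use ty1 pr0 in simp)
    moreover have "(\<Sum>e\<in>nsets V 3. (1 - ?T e) * ?pr e) = (\<Sum>e\<in>nsets V 3. ?pr e) - C * m ^ 3"
      unfolding all[symmetric] by (simp add: left_diff_distrib sum_subtractf)
    moreover have "(\<Sum>e\<in>nsets V 3. ?pr e) \<le> (?q * m) ^ 3 / 6"
      unfolding sumg[symmetric] by (rule sum_nsets_3_le[OF finV g0])
    ultimately show ?thesis by (simp add: power_mult_distrib algebra_simps)
  qed
  ultimately have "d * (C * m ^ 3) - m ^ 3 \<le> m ^ 3 * (C * (d / 2)) + (?q ^ 3 / 6 - C) * m ^ 3"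
    by linarith
  then have "(d * C - 1) * m ^ 3 \<le> (C * (d / 2) + (?q ^ 3 / 6 - C)) * m ^ 3"
    by (simp add: algebra_simps)
  then have "d * C - 1 \<le> C * (d / 2) + (?q ^ 3 / 6 - C)" using m by simp
  then have "d * (C * 6) \<le> 12 + 2 * ?q ^ 3 - 2 * (C * 6)" by (simp add: algebra_simps)
  then have 1: "d * (?q * (?q - 1) * (?q - 2)) \<le> 12 + 6 * ?q\<^sup>2 - 4 * ?q"
    unfolding C6 by (simp add: algebra_simps power2_eq_square power3_eq_cube)
  have q4: "?q \<ge> 4" using Q(2) by simp
  \<comment> \<open>This is where \<open>4 \<le> card Q\<close> enters: it makes
    \<open>(?q - 1) * (?q - 2)\<close> comparable with the square of \<open>?q\<close>, so that the
    cubic inequality reduces to a bound for \<open>?q * d\<close>.\<close>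
  have "0 \<le> (?q - 4) * (5 * ?q - 4)" using q4 by simp
  then have "3 * ?q\<^sup>2 \<le> 8 * ((?q - 1) * (?q - 2))"
    by (simp add: algebra_simps power2_eq_square)
  then have "(?q * d) * (3 * ?q\<^sup>2) \<le> (?q * d) * (8 * ((?q - 1) * (?q - 2)))"
    using d by (intro mult_left_mono) auto
  also have "\<dots> = 8 * (d * (?q * (?q - 1) * (?q - 2)))" by (simp add: algebra_simps)
  also have "\<dots> \<le> 8 * (12 + 6 * ?q\<^sup>2 - 4 * ?q)" using 1 by simp
  also have "\<dots> \<le> 96 * ?q\<^sup>2"
  proof -
    have "8 * (12 + 6 * x - 4 * y) \<le> 96 * x" if "12 \<le> 4 * y" "0 \<le> x" for x y :: real
      using that by argo
    from this[of ?q "?q\<^sup>2"] q4 show ?thesis by fastforce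
  qed
  finally have "(?q * d) * (3 * ?q\<^sup>2) \<le> 32 * (3 * ?q\<^sup>2)" by simp
  moreover have "3 * ?q\<^sup>2 > 0" using q4 by simp
  ultimately have "?q * d \<le> 32" by (meson mult_le_cancel_right_pos)
  then show False using Q(3) by simp
qed

subsection \<open>Vanishing 3-graphs in uniformly dense 3-graphs\<close>

text \<open>The colours \<open>0\<close>, \<open>1\<close> and \<open>2\<close> are red, blue and
  green, and \<open>pos\<close> is the ordering of the vertices.\<close>

definition vanishing :: "'b set \<Rightarrow> 'b set set \<Rightarrow> bool" where
  "vanishing VF EF \<longleftrightarrow> (\<exists>(pos :: 'b \<Rightarrow> nat) (col :: 'b set \<Rightarrow> nat). inj_on pos VF \<and>
     (\<forall>x\<in>VF. \<forall>y\<in>VF. \<forall>z\<in>VF. {x, y, z} \<in> EF \<longrightarrow> pos x < pos y \<longrightarrow> pos y < pos z \<longrightarrow>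
        col {x, y} = 0 \<and> col {x, z} = 1 \<and> col {y, z} = 2))"

lemma card_3_sortedE:
  fixes pos :: "'b \<Rightarrow> 'n :: linorder"
  assumes "card e = 3" "inj_on pos e"
  obtains x y z where "e = {x, y, z}" "pos x < pos y" "pos y < pos z"
proof -
  obtain a b c where abc: "e = {a, b, c}" "a \<noteq> b" "b \<noteq> c" "a \<noteq> c"
    using assms(1) by (metis card_3_iff)
  have ne: "pos a \<noteq> pos b" "pos b \<noteq> pos c" "pos a \<noteq> pos c"
    using assms(2) abc by (auto simp: inj_on_def)
  have perm: "{a, c, b} = e" "{b, a, c} = e" "{b, c, a} = e" "{c, a, b} = e" "{c, b, a} = e"
    using abc(1) by auto
  consider "pos a < pos b" "pos b < pos c" | "pos a < pos c" "pos c < pos b"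
    | "pos b < pos a" "pos a < pos c" | "pos b < pos c" "pos c < pos a"
    | "pos c < pos a" "pos a < pos b" | "pos c < pos b" "pos b < pos a"
    using ne by (metis linorder_neq_iff)
  then show thesis
    by cases (use that perm abc(1) in metis)+
qed

lemma faces_triple:
  assumes "i < j" "j < (k :: nat)"
  shows "faces {i, j, k} = {{i, j}, {i, k}, {j, k}}"
  using assms by (auto simp: faces_def)

lemma disjoint_cells:
  assumes "finite V" "N > 0"
  obtains U0 :: "nat \<Rightarrow> 'v set" where "\<And>i. i < N \<Longrightarrow> U0 i \<subseteq> V" "\<And>i. i < N \<Longrightarrow> card (U0 i) = card V div N"
    "disjoint_family_on U0 {..<N}"
proof -
  define k where "k = card V div N"
  obtain \<psi> where \<psi>: "bij_betw \<psi> {..<card V} V"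
    using ex_bij_betw_nat_finite[OF assms(1)] by (auto simp: atLeast0LessThan)
  define U0 where "U0 i = \<psi> ` {i * k..<(i + 1) * k}" for i
  have sub: "{i * k..<(i + 1) * k} \<subseteq> {..<card V}" if "i < N" for i
  proof -
    have "(i + 1) * k \<le> N * k" using that by (intro mult_le_mono1) simp
    also have "\<dots> \<le> card V" by (simp add: k_def)
    finally show ?thesis by auto
  qed
  show thesis
  proof (rule that[of U0])
    fix i assume i: "i < N"
    show "U0 i \<subseteq> V" unfolding U0_def using sub[OF i] \<psi> by (auto simp: bij_betw_def)
    have "inj_on \<psi> {i * k..<(i + 1) * k}"
      using \<psi> sub[OF i] by (meson bij_betw_def inj_on_subset)
    then show "card (U0 i) = card V div N"
      unfolding U0_def by (simp add: card_image k_def)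
  next
    show "disjoint_family_on U0 {..<N}"
      unfolding disjoint_family_on_def
    proof (intro ballI impI)
      fix i j assume ij: "i \<in> {..<N}" "j \<in> {..<N}" "i \<noteq> j"
      have "{i * k..<(i + 1) * k} \<inter> {j * k..<(j + 1) * k} = {}"
      proof (cases "i < j")
        case True
        then have "(i + 1) * k \<le> j * k" by (intro mult_le_mono1) simp
        then show ?thesis by auto
      next
        case False
        then have "(j + 1) * k \<le> i * k" using ij by (intro mult_le_mono1) simp
        then show ?thesis by auto
      qed
      moreover have "\<psi> ` ({i * k..<(i + 1) * k} \<inter> {j * k..<(j + 1) * k}) = U0 i \<inter> U0 j"
        unfolding U0_def using \<psi> sub[of i] sub[of j] ij
        by (intro inj_on_image_Int[of \<psi> "{..<card V}"]) (auto simp: bij_betw_def)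
      ultimately show "U0 i \<inter> U0 j = {}" by auto
    qed
  qed
qed

lemma depends_on_cexp_cols:
  assumes "\<And>s. s \<in> faces e \<Longrightarrow> depends_on s (\<kappa> s)"
  shows "depends_on e (cexp S (cols \<kappa> e) h)"
proof (rule depends_onI)
  fix x y :: "'a \<Rightarrow> 'b" assume xy: "\<And>i. i \<in> e \<Longrightarrow> x i = y i"
  have "cols \<kappa> e x = cols \<kappa> e y"
  proof (rule cols_eqI)
    fix s assume s: "s \<in> faces e"
    show "\<kappa> s x = \<kappa> s y"
      by (rule depends_onD[OF assms[OF s] xy]) (use s in \<open>auto simp: faces_def\<close>)
  qed
  then show "cexp S (cols \<kappa> e) h x = cexp S (cols \<kappa> e) h y" by (rule cexp_cong[where p = "cols \<kappa> e"])
qed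

text \<open>The conditional expectation as a function of the colours alone. It has to make sense for
  all \<open>X\<close>, since independent colours may combine in a way that no point of
  \<open>S\<close> realises; the quotient is then \<open>0\<close>.\<close>

definition colour_density ::
  "('i \<Rightarrow> 'a) set \<Rightarrow> ('i set \<Rightarrow> ('i \<Rightarrow> 'a) \<Rightarrow> nat) \<Rightarrow> (('i \<Rightarrow> 'a) \<Rightarrow> real) \<Rightarrow> 'i set \<Rightarrow> ('i set \<Rightarrow> nat) \<Rightarrow> real" where
  "colour_density S \<kappa> h e X = (\<Sum>y\<in>{y\<in>S. \<forall>s\<in>faces e. \<kappa> s y = X s}. h y) /
     real (card {y\<in>S. \<forall>s\<in>faces e. \<kappa> s y = X s})"

lemma cexp_cols: "cexp S (cols \<kappa> e) h x = colour_density S \<kappa> h e (\<lambda>s. \<kappa> s x)"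
proof -
  have "cols \<kappa> e y = cols \<kappa> e x \<longleftrightarrow> (\<forall>s\<in>faces e. \<kappa> s y = \<kappa> s x)" for y
    using cols_eqI cols_eqD by metis
  then show ?thesis by (simp add: cexp_def colour_density_def)
qed

lemma colour_density_cong:
  assumes "\<And>s. s \<in> faces e \<Longrightarrow> X s = X' s"
  shows "colour_density S \<kappa> h e X = colour_density S \<kappa> h e X'"
proof -
  have "{y\<in>S. \<forall>s\<in>faces e. \<kappa> s y = X s} = {y\<in>S. \<forall>s\<in>faces e. \<kappa> s y = X' s}" using assms by auto
  then show ?thesis by (simp add: colour_density_def)
qed

lemma colour_density_bounds:
  assumes "\<And>x. 0 \<le> h x \<and> h x \<le> 1"
  shows "0 \<le> colour_density S \<kappa> h e X \<and> colour_density S \<kappa> h e X \<le> 1"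
proof
  let ?A = "{y\<in>S. \<forall>s\<in>faces e. \<kappa> s y = X s}"
  show "0 \<le> colour_density S \<kappa> h e X"
    unfolding colour_density_def using assms by (intro divide_nonneg_nonneg sum_nonneg) auto
  have "(\<Sum>y\<in>?A. h y) \<le> real (card ?A) * 1"
    by (rule sum_bounded_above) (use assms in auto)
  then show "colour_density S \<kappa> h e X \<le> 1"
    by (auto simp: colour_density_def divide_le_eq_1)
qed

text \<open>The points of the product of the cells are candidate embeddings, so it suffices that the
  number of points mapping all edges into \<open>E\<close> is positive. The counting lemma passes
  from edge indicators to densities relative to the pair colours, \<open>model_approx\<close> passes
  to independent colours, and \<open>selection\<close> bounds the expectation that remains.\<close>

theorem vanishing_contained:
  fixes VF :: "'b set" and EF :: "'b set set" and d :: real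
  assumes F: "is_3graph VF EF" and van: "vanishing VF EF" and d: "0 < d" "d \<le> 1"
  obtains \<eta> n0 where "\<eta> > 0" and "\<And>(V :: 'v set) E. is_3graph V E \<Longrightarrow> unif_dense d \<eta> V E \<Longrightarrow>
    n0 \<le> card V \<Longrightarrow> contains_copy V E VF EF"
proof -
  define f where "f = card VF"
  have finF: "finite VF" and EF: "\<And>e. e \<in> EF \<Longrightarrow> e \<subseteq> VF \<and> card e = 3"
    using F by (auto simp: is_3graph_def)
  have finEF: "finite EF" using EF finF by (intro finite_subset[of EF "Pow VF"]) auto
  obtain pos :: "'b \<Rightarrow> nat" and col :: "'b set \<Rightarrow> nat" where inj: "inj_on pos VF" and
    col: "\<And>x y z. x \<in> VF \<Longrightarrow> y \<in> VF \<Longrightarrow> z \<in> VF \<Longrightarrow> {x, y, z} \<in> EF \<Longrightarrow> pos x < pos y \<Longrightarrow> pos y < pos z \<Longrightarrow>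
        col {x, y} = 0 \<and> col {x, z} = 1 \<and> col {y, z} = 2"
    using van unfolding vanishing_def by metis
  have d4: "d / 4 > 0" using d by simp
  obtain c0 R where c0: "c0 > 0" and sel: "\<And>(J :: nat set) S K p W.
    finite J \<Longrightarrow> R \<le> card J \<Longrightarrow> cweights S K p \<Longrightarrow> nsets J 2 \<subseteq> S \<Longrightarrow>
    (\<And>i j k a b c. (0 :: real) \<le> W i j k a b c \<and> W i j k a b c \<le> 1) \<Longrightarrow>
    (\<And>i j k. i \<in> J \<Longrightarrow> j \<in> J \<Longrightarrow> k \<in> J \<Longrightarrow> i < j \<Longrightarrow> j < k \<Longrightarrow>
      d / 4 \<le> cE S K p (\<lambda>X. cE S K p (\<lambda>Y. cE S K p (\<lambda>Z. W i j k (X {i, j}) (Y {i, k}) (Z {j, k}))))) \<Longrightarrow>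
    \<exists>I\<subseteq>J. card I = f \<and> c0 \<le> cE S K p (\<lambda>X. cE S K p (\<lambda>Y. cE S K p (\<lambda>Z.
      of_bool (\<forall>i\<in>I. \<forall>j\<in>I. \<forall>k\<in>I. i < j \<longrightarrow> j < k \<longrightarrow> d / 4 / 8 \<le> W i j k (X {i, j}) (Y {i, k}) (Z {j, k})))))"
    apply (rule selection[OF d4, of f])
    subgoal premises p by (rule p(1)[OF p(2)]) (rule p(3))
    done
  \<comment> \<open>The number of cells that \<open>dense_triple\<close> asks for.\<close>
  define q where "q = 5 + nat \<lceil>32 / d\<rceil>"
  have q: "q \<ge> 4" "real q * d > 32"
  proof -
    have "32 / d < real q" unfolding q_def by linarith
    then show "real q * d > 32" using d by (simp add: divide_less_eq)
  qed (simp add: q_def)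
  \<comment> \<open>A set of \<open>q\<close> cells without a dense triple is impossible by
    \<open>dense_triple\<close>, so Ramsey's theorem will give \<open>R\<close> cells all of whose
    triples are dense.\<close>
  obtain N0 where N0: "\<And>(J :: nat set) P. finite J \<Longrightarrow> N0 \<le> card J \<Longrightarrow>
    \<exists>H\<subseteq>J. (card H = R \<and> (\<forall>Y\<in>nsets H 3. P Y)) \<or> (card H = q \<and> (\<forall>Y\<in>nsets H 3. \<not> P Y))"
    using ramsey_set[where 'a = nat and ?q1.0 = R and ?q2.0 = q and r = 3] by blast
  define N where "N = Suc N0"
  define S where "S = nsets {..<N} 2"
  \<comment> \<open>The main term: with probability \<open>c0\<close> each of the at most
    \<open>card EF\<close> densities is at least \<open>d / 4 / 8\<close>. The tolerances
    \<open>\<epsilon>\<close>, \<open>b\<close> and \<open>\<mu>\<close> make the counting and the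
    model error at most a quarter of it; the bound \<open>d / 4\<close> on \<open>b\<close> protects
    the densities of single triples.\<close>
  define c' where "c' = c0 * (d / 4 / 8) ^ card EF"
  have c': "c' > 0" using c0 d by (simp add: c'_def)
  define \<epsilon> where "\<epsilon> = c' / (4 * (real (card EF) + 1))"
  define b where "b = min (c' / 4) (d / 4)"
  have b: "b > 0" using c' d by (simp add: b_def)
  define \<mu> where "\<mu> t = b / ((2 ^ t) ^ card S * (real (card S) + 1))" for t :: nat
  have \<epsilon>: "\<epsilon> > 0" "real (card EF) * \<epsilon> \<le> c' / 4"
    using c' by (simp_all add: \<epsilon>_def divide_le_eq algebra_simps add_pos_nonneg)
  have \<mu>: "\<mu> t > 0" for t using b by (simp add: \<mu>_def add_nonneg_pos)
  have \<mu>': "real (2 ^ t) ^ card S * (real (card S) * \<mu> t) \<le> b" for t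
  proof -
    have "real (2 ^ t) ^ card S * (real (card S) * \<mu> t) = b * (real (card S) / (real (card S) + 1))"
      by (simp add: \<mu>_def)
    also have "\<dots> \<le> b * 1" using b by (intro mult_left_mono) (simp_all add: divide_le_eq_1)
    finally show ?thesis by simp
  qed
  have anti: "antimono \<mu>"
  proof (rule antimonoI)
    fix t t' :: nat assume "t \<le> t'"
    then have "((2 :: real) ^ t) ^ card S \<le> (2 ^ t') ^ card S" by (intro power_mono power_increasing) auto
    then show "\<mu> t' \<le> \<mu> t" unfolding \<mu>_def using b
      by (intro divide_left_mono mult_right_mono mult_pos_pos) (auto simp: add_nonneg_pos)
  qed
  obtain \<theta> T where \<theta>: "\<theta> > 0" and reg: "\<And>(U0 :: nat \<Rightarrow> 'v set) h.
    (\<And>i. i < N \<Longrightarrow> finite (U0 i) \<and> U0 i \<noteq> {}) \<Longrightarrow>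
    (\<And>e x. e \<in> nsets {..<N} 3 \<Longrightarrow> 0 \<le> h e x \<and> h e x \<le> 1) \<Longrightarrow>
    \<exists>t\<le>T. \<exists>U \<kappa>. (\<forall>i<N. U i \<subseteq> U0 i \<and> U i \<noteq> {} \<and> \<theta> * real (card (U0 i)) \<le> real (card (U i))) \<and>
      (\<forall>s\<in>nsets {..<N} 2. depends_on s (\<kappa> s) \<and> (\<forall>x. \<kappa> s x < 2^t)) \<and>
      (\<forall>e\<in>nsets {..<N} 3. regular (PiE {..<N} U) e
         (\<lambda>x. h e x - cexp (PiE {..<N} U) (cols \<kappa> e) (h e) x) \<epsilon>) \<and>
      (\<forall>s\<in>nsets {..<N} 2. \<forall>a<2^t. regular (PiE {..<N} U) s
         (\<lambda>x. of_bool (\<kappa> s x = a) - cexp (PiE {..<N} U) (\<lambda>_. ()) (\<lambda>x. of_bool (\<kappa> s x = a)) x) (\<mu> t))"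
    apply (rule regularity_lemma[where 'a = 'v and N = N, OF \<epsilon>(1) \<mu> anti])
    subgoal premises p by (rule p(1)[OF p(2)]) (rule p(3))
    done
  \<comment> \<open>Cells of \<open>card V div N\<close> vertices contain at least a fraction
    \<open>1 / (2 * N)\<close> of \<open>V\<close> when \<open>card V \<ge> 2 * N\<close>, and
    regularisation keeps a fraction \<open>\<theta>\<close> of each.\<close>
  define \<theta>' where "\<theta>' = \<theta> / (2 * real N)"
  have N: "N > 0" by (simp add: N_def)
  have \<theta>': "\<theta>' > 0" using \<theta> N by (simp add: \<theta>'_def)
  have main: "contains_copy V E VF EF"
    if G: "is_3graph V E" and ud: "unif_dense d (\<theta>' ^ 3) V E" and n: "2 * N \<le> card V" for V :: "'v set" and E
  proof -
    have finV: "finite V" using G by (simp add: is_3graph_def)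
    define k where "k = card V div N"
    have k1: "k \<ge> 1" using n N by (simp add: k_def less_eq_div_iff_mult_less_eq)
    have kN: "real (card V) \<le> 2 * real N * real k"
    proof -
      have "card V = k * N + card V mod N" by (simp add: k_def)
      also have "\<dots> \<le> k * N + N" using mod_less_divisor[OF N, of "card V"] by linarith
      also have "\<dots> \<le> k * N + k * N" using k1 by simp
      finally have "card V \<le> 2 * N * k" by (simp add: algebra_simps)
      then show ?thesis by (metis of_nat_le_iff of_nat_mult of_nat_numeral)
    qed
    obtain U0 :: "nat \<Rightarrow> 'v set" where U0: "\<And>i. i < N \<Longrightarrow> U0 i \<subseteq> V" "\<And>i. i < N \<Longrightarrow> card (U0 i) = k"
      "disjoint_family_on U0 {..<N}"
      using disjoint_cells[OF finV N] unfolding k_def by metis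
    have U0': "finite (U0 i) \<and> U0 i \<noteq> {}" if "i < N" for i
      using U0(1,2)[OF that] k1 finV finite_subset by fastforce
    define h where "h e x = (of_bool (x ` e \<in> E) :: real)" for e :: "nat set" and x :: "nat \<Rightarrow> 'v"
    have h: "0 \<le> h e x \<and> h e x \<le> 1" for e x by (simp add: h_def)
    obtain t U \<kappa> where U: "\<forall>i<N. U i \<subseteq> U0 i \<and> U i \<noteq> {} \<and> \<theta> * real (card (U0 i)) \<le> real (card (U i))"
      and \<kappa>: "\<forall>s\<in>nsets {..<N} 2. depends_on s (\<kappa> s) \<and> (\<forall>x. \<kappa> s x < 2^t)"
      and reg3: "\<forall>e\<in>nsets {..<N} 3. regular (PiE {..<N} U) e
         (\<lambda>x. h e x - cexp (PiE {..<N} U) (cols \<kappa> e) (h e) x) \<epsilon>"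
      and reg2: "\<forall>s\<in>nsets {..<N} 2. \<forall>a<2^t. regular (PiE {..<N} U) s
         (\<lambda>x. of_bool (\<kappa> s x = a) - cexp (PiE {..<N} U) (\<lambda>_. ()) (\<lambda>x. of_bool (\<kappa> s x = a)) x) (\<mu> t)"
      using reg[of U0 h, OF U0' h] by blast
    define \<Omega> where "\<Omega> = PiE {..<N} U"
    let ?n = "real (card \<Omega>)"
    have UV: "U i \<subseteq> V \<and> U i \<noteq> {}" if "i \<in> {..<N}" for i
      using U U0(1)[of i] that by blast
    have finU: "finite (U i)" if "i \<in> {..<N}" for i
      using UV[OF that] finV finite_subset by blast
    have disj: "disjoint_family_on U {..<N}"
      unfolding disjoint_family_on_def
    proof (intro ballI impI)
      fix i j assume ij: "i \<in> {..<N}" "j \<in> {..<N}" "i \<noteq> j"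
      have "U0 i \<inter> U0 j = {}" using U0(3) ij unfolding disjoint_family_on_def by blast
      moreover have "U i \<subseteq> U0 i" "U j \<subseteq> U0 j" using U ij by auto
      ultimately show "U i \<inter> U j = {}" by blast
    qed
    have fin\<Omega>: "finite \<Omega>" unfolding \<Omega>_def using finU by (intro finite_PiE) auto
    have ne\<Omega>: "\<Omega> \<noteq> {}" unfolding \<Omega>_def using UV by (auto simp: PiE_eq_empty_iff)
    have n0: "?n > 0" using fin\<Omega> ne\<Omega> by (simp add: card_gt_0_iff)
    have finS: "finite S" unfolding S_def by (simp add: finite_nsets)
    have faceS: "s \<in> S" if "e \<in> nsets {..<N} 3" "s \<in> faces e" for e s
      using that faces_nsets[of e "{..<N}" 2 s] by (simp add: S_def)
    define K :: nat where "K = 2 ^ t"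
    define p where "p = (\<lambda>s a. (\<Sum>x\<in>PiE {..<N} U. of_bool (\<kappa> s x = a)) / real (card (PiE {..<N} U)))"
    have S2: "finite s \<and> card s = 2" if "s \<in> S" for s using that by (auto simp: S_def nsets_def)
    have antiS: "s = s'" if "s \<in> S" "s' \<in> S" "s \<subseteq> s'" for s s'
      using S2[OF that(1)] S2[OF that(2)] that(3) by (simp add: card_subset_eq)
    have prem: "finite (PiE {..<N} U)" "PiE {..<N} U \<noteq> {}" "\<And>s. s \<in> S \<Longrightarrow> finite s"
      "\<And>s. s \<in> S \<Longrightarrow> depends_on s (\<kappa> s)" "\<And>s x. s \<in> S \<Longrightarrow> \<kappa> s x < K"
      "\<And>s a. s \<in> S \<Longrightarrow> a < K \<Longrightarrow> regular (PiE {..<N} U) s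
         (\<lambda>x. of_bool (\<kappa> s x = a) - cexp (PiE {..<N} U) (\<lambda>_. ()) (\<lambda>x. of_bool (\<kappa> s x = a)) x) (\<mu> t)"
      using fin\<Omega> ne\<Omega> S2 \<kappa> reg2 unfolding \<Omega>_def S_def K_def by blast+
    note ma = model_approx[where I = "{..<N}" and U = U and S = S and \<kappa> = \<kappa> and K = K and \<mu> = "\<mu> t" and p = p]
    have w: "cweights S K p"
      by (rule ma(1); fact prem finS antiS p_def)
    have model: "\<bar>(\<Sum>x\<in>\<Omega>. \<Phi> (restrict (\<lambda>s. \<kappa> s x) S)) - ?n * cE S K p \<Phi>\<bar> \<le> b * ?n"
      if \<Phi>: "\<And>X. 0 \<le> \<Phi> X \<and> \<Phi> X \<le> 1" for \<Phi>
    proof -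
      have "\<bar>(\<Sum>x\<in>PiE {..<N} U. \<Phi> (restrict (\<lambda>s. \<kappa> s x) S)) - real (card (PiE {..<N} U)) * cE S K p \<Phi>\<bar>
          \<le> real K ^ card S * (real (card S) * \<mu> t * real (card (PiE {..<N} U)))"
        by (rule ma(2); fact prem finS antiS p_def \<Phi>)
      also have "\<dots> = (real (2 ^ t) ^ card S * (real (card S) * \<mu> t)) * ?n"
        by (simp add: \<Omega>_def K_def)
      also have "\<dots> \<le> b * ?n" by (rule mult_right_mono[OF \<mu>']) simp
      finally show ?thesis by (simp add: \<Omega>_def)
    qed
    define D where "D e = colour_density \<Omega> \<kappa> (h e) e" for e
    have D01: "0 \<le> D e X \<and> D e X \<le> 1" for e X
      unfolding D_def by (rule colour_density_bounds[OF h])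
    have Dres: "cexp \<Omega> (cols \<kappa> e) (h e) x = D e (restrict (\<lambda>s. \<kappa> s x) S)" if "e \<in> nsets {..<N} 3" for e x
      unfolding cexp_cols D_def by (rule colour_density_cong) (simp add: faceS[OF that])
    \<comment> \<open>The density of a triple as a function of three separate colours, one per face,
      in the shape that \<open>selection\<close> expects.\<close>
    define W where "W i j k a b c = D {i, j, k} (\<lambda>s. if s = {i, j} then a else if s = {i, k} then b else c)"
      for i j k a b c
    have DW: "D {i, j, k} X = W i j k (X {i, j}) (X {i, k}) (X {j, k})" if "i < j" "j < k" for i j k X
      unfolding W_def D_def
    proof (rule colour_density_cong)
      fix s assume "s \<in> faces {i, j, k}"
      then have "s = {i, j} \<or> s = {i, k} \<or> s = {j, k}" using faces_triple[OF that] by blast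
      then show "X s = (if s = {i, j} then X {i, j} else if s = {i, k} then X {i, k} else X {j, k})"
        using that by (auto simp: doubleton_eq_iff)
    qed
    obtain H where H: "H \<subseteq> {..<N}" "card H = R"
      and dense: "\<And>e. e \<in> nsets H 3 \<Longrightarrow> d / 2 * ?n \<le> (\<Sum>x\<in>\<Omega>. of_bool (x ` e \<in> E))"
    proof -
      obtain H where H: "H \<subseteq> {..<N}"
        "(card H = R \<and> (\<forall>e\<in>nsets H 3. d / 2 * ?n \<le> (\<Sum>x\<in>\<Omega>. of_bool (x ` e \<in> E)))) \<or>
         (card H = q \<and> (\<forall>e\<in>nsets H 3. \<not> d / 2 * ?n \<le> (\<Sum>x\<in>\<Omega>. of_bool (x ` e \<in> E))))"
        using N0[of "{..<N}" "\<lambda>e. d / 2 * ?n \<le> (\<Sum>x\<in>\<Omega>. of_bool (x ` e \<in> E))"] by (auto simp: N_def)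
      moreover have "\<exists>e\<in>nsets H 3. d / 2 * ?n \<le> (\<Sum>x\<in>\<Omega>. of_bool (x ` e \<in> E))" if "card H = q"
        unfolding \<Omega>_def
      proof (rule dense_triple[OF G ud d(1)])
        show "V \<noteq> {}" using n N by auto
        show "\<theta>' * real (card V) \<le> real (card (U i))" if "i \<in> {..<N}" for i
        proof -
          have "\<theta>' * real (card V) \<le> \<theta>' * (2 * real N * real k)"
            using kN \<theta>' by (intro mult_left_mono) auto
          also have "\<dots> = \<theta> * real k" using N by (simp add: \<theta>'_def)
          also have "\<dots> \<le> real (card (U i))" using U U0(2)[of i] that by auto
          finally show ?thesis .
        qed
      qed (use UV disj \<theta>' H(1) that q in auto)
      ultimately show thesis using that by blast
    qed
    have finH: "finite H" using H(1) finite_subset by blast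
    have HS: "nsets H 2 \<subseteq> S" unfolding S_def by (rule nsets_mono[OF H(1)])
    have "\<exists>I\<subseteq>H. card I = f \<and> c0 \<le> cE S K p (\<lambda>X. cE S K p (\<lambda>Y. cE S K p (\<lambda>Z.
      of_bool (\<forall>i\<in>I. \<forall>j\<in>I. \<forall>k\<in>I. i < j \<longrightarrow> j < k \<longrightarrow> d / 4 / 8 \<le> W i j k (X {i, j}) (Y {i, k}) (Z {j, k})))))"
    proof (rule sel[OF finH _ w HS])
      show "R \<le> card H" using H(2) by simp
      show "0 \<le> W i j k a b c \<and> W i j k a b c \<le> 1" for i j k a b c
        unfolding W_def by (rule D01)
      fix i j k assume ijk: "i \<in> H" "j \<in> H" "k \<in> H" "i < j" "j < k"
      let ?e = "{i, j, k}"
      have e: "?e \<in> nsets H 3" using ijk by (auto simp: nsets_def card_insert_if)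
      have eN: "?e \<in> nsets {..<N} 3" using e nsets_mono[OF H(1)] by blast
      have "d / 2 * ?n \<le> (\<Sum>x\<in>\<Omega>. h ?e x)" using dense[OF e] by (simp add: h_def)
      also have "\<dots> = (\<Sum>x\<in>\<Omega>. cexp \<Omega> (cols \<kappa> ?e) (h ?e) x)" by (rule sum_cexp[OF fin\<Omega>, symmetric])
      also have "\<dots> = (\<Sum>x\<in>\<Omega>. D ?e (restrict (\<lambda>s. \<kappa> s x) S))" by (simp only: Dres[OF eN])
      \<comment> \<open>Passing to independent colours costs \<open>b \<le> d / 4\<close> of the
        density \<open>d / 2\<close>; this is why \<open>selection\<close> is used with
        \<open>d / 4\<close>.\<close>
      also have "\<dots> \<le> ?n * cE S K p (D ?e) + b * ?n" using model[of "D ?e", OF D01] by linarith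
      also have "\<dots> \<le> ?n * cE S K p (D ?e) + d / 4 * ?n"
        by (intro add_left_mono mult_right_mono) (simp_all add: b_def)
      finally have "d / 4 * ?n \<le> cE S K p (D ?e) * ?n" by (simp add: algebra_simps)
      then have "d / 4 \<le> cE S K p (D ?e)" using n0 by simp
      also have "\<dots> = cE S K p (\<lambda>X. cE S K p (\<lambda>Y. cE S K p (\<lambda>Z. D ?e (mix {{i, j}} X (mix {{i, k}} Y Z)))))"
        by (rule cE_mix3[OF w, symmetric])
      also have "\<dots> = cE S K p (\<lambda>X. cE S K p (\<lambda>Y. cE S K p (\<lambda>Z. W i j k (X {i, j}) (Y {i, k}) (Z {j, k}))))"
        using ijk by (simp add: DW mix_def doubleton_eq_iff)
      finally show "d / 4 \<le> \<dots>" .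
    qed
    then obtain I where I: "I \<subseteq> H" "card I = f" and big: "c0 \<le> cE S K p (\<lambda>X. cE S K p (\<lambda>Y. cE S K p (\<lambda>Z.
      of_bool (\<forall>i\<in>I. \<forall>j\<in>I. \<forall>k\<in>I. i < j \<longrightarrow> j < k \<longrightarrow> d / 4 / 8 \<le> W i j k (X {i, j}) (Y {i, k}) (Z {j, k})))))"
      by blast
    have finI: "finite I" using I(1) finH finite_subset by blast
    obtain \<iota> where \<iota>: "bij_betw \<iota> VF I" "\<And>x y. x \<in> VF \<Longrightarrow> y \<in> VF \<Longrightarrow> pos x < pos y \<Longrightarrow> \<iota> x < \<iota> y"
    proof -
      have cp: "card (pos ` VF) = f" using inj by (simp add: card_image f_def)
      obtain h1 where h1: "bij_betw h1 {..<card (pos ` VF)} (pos ` VF)" "strict_mono_on {..<card (pos ` VF)} h1"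
        using ex_bij_betw_strict_mono_card[of "pos ` VF"] finF by auto
      obtain h2 where h2: "bij_betw h2 {..<card I} I" "strict_mono_on {..<card I} h2"
        using ex_bij_betw_strict_mono_card[OF finI] .
      define g where "g = inv_into {..<f} h1"
      have g: "bij_betw g (pos ` VF) {..<f}" unfolding g_def using h1(1) cp by (simp add: bij_betw_inv_into)
      have hg: "h1 (g y) = y" if "y \<in> pos ` VF" for y
        unfolding g_def using h1(1) cp that by (simp add: bij_betw_def f_inv_into_f)
      have "bij_betw (h2 \<circ> (g \<circ> pos)) VF I"
        using inj g h2(1) I(2) by (intro bij_betw_trans[of _ _ "{..<f}"] bij_betw_trans[of _ _ "pos ` VF"])
          (auto simp: bij_betw_def)
      moreover have "(h2 \<circ> (g \<circ> pos)) x < (h2 \<circ> (g \<circ> pos)) y" if xy: "x \<in> VF" "y \<in> VF" "pos x < pos y" for x y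
      proof -
        have gx: "g (pos x) \<in> {..<f}" "g (pos y) \<in> {..<f}" using g xy by (auto simp: bij_betw_def)
        have "g (pos x) < g (pos y)"
        proof (rule ccontr)
          assume "\<not> ?thesis"
          then have le: "g (pos y) \<le> g (pos x)" by simp
          have "h1 (g (pos y)) \<le> h1 (g (pos x))"
            using strict_mono_on_leD[OF h1(2) _ _ le] gx cp by simp
          then show False using hg xy by simp
        qed
        then show ?thesis using strict_mono_onD[OF h2(2)] gx I(2) by simp
      qed
      ultimately show thesis by (rule that)
    qed
    have inj\<iota>: "inj_on \<iota> VF" and im\<iota>: "\<iota> ` VF = I" using \<iota>(1) by (auto simp: bij_betw_def)
    define \<E> where "\<E> = (`) \<iota> ` EF"
    have fin\<E>: "finite \<E>" and card\<E>: "card \<E> \<le> card EF"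
      unfolding \<E>_def using finEF by (simp_all add: card_image_le)
    define bk where "bk s = inv_into VF \<iota> ` s" for s
    have bk: "bk {\<iota> x, \<iota> y} = {x, y}" if "x \<in> VF" "y \<in> VF" for x y
      unfolding bk_def using that inj\<iota> by (simp add: inv_into_f_f)
    \<comment> \<open>This is where vanishing is used: no pair occurs in two roles. The red, blue
      and green colours can therefore come from three independent colourings \<open>X\<close>,
      \<open>Y\<close> and \<open>Z\<close>, merged along \<open>D0\<close> and
      \<open>D1\<close>.\<close>
    define D0 where "D0 = {s. col (bk s) = 0}"
    define D1 where "D1 = {s. col (bk s) = 1}"
    have IN: "I \<subseteq> {..<N}" using I(1) H(1) by blast
    have \<E>: "\<exists>i j k. e = {i, j, k} \<and> i < j \<and> j < k \<and> {i, j, k} \<subseteq> I \<and>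
        {i, j} \<in> D0 \<and> {i, k} \<notin> D0 \<and> {i, k} \<in> D1 \<and> {j, k} \<notin> D0 \<and> {j, k} \<notin> D1" if eE: "e \<in> \<E>" for e
    proof -
      obtain e' where e': "e' \<in> EF" "e = \<iota> ` e'" using eE by (auto simp: \<E>_def)
      have "e' \<subseteq> VF" "card e' = 3" using EF[OF e'(1)] by auto
      then obtain x y z where xyz: "e' = {x, y, z}" "pos x < pos y" "pos y < pos z"
        using card_3_sortedE[of e' pos] inj_on_subset[OF inj] by metis
      then have V: "x \<in> VF" "y \<in> VF" "z \<in> VF" using \<open>e' \<subseteq> VF\<close> by auto
      have "col {x, y} = 0 \<and> col {x, z} = 1 \<and> col {y, z} = 2"
        using col[OF V] e'(1) xyz by simp
      moreover have "\<iota> x < \<iota> y" "\<iota> y < \<iota> z" using \<iota>(2) V xyz by auto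
      moreover have "{\<iota> x, \<iota> y, \<iota> z} \<subseteq> I" using im\<iota> V by auto
      ultimately show ?thesis
        using e'(2) xyz(1) V by (intro exI[of _ "\<iota> x"] exI[of _ "\<iota> y"] exI[of _ "\<iota> z"]) (auto simp: D0_def D1_def bk)
    qed
    have \<E>3: "e \<in> nsets {..<N} 3" if eE: "e \<in> \<E>" for e
    proof -
      obtain i j k where "e = {i, j, k}" "i < j" "j < k" "{i, j, k} \<subseteq> I" using \<E>[OF eE] by blast
      then show ?thesis using IN by (auto simp: nsets_def card_insert_if)
    qed
    define \<Phi> where "\<Phi> X = (\<Prod>e\<in>\<E>. D e X)" for X
    have \<Phi>01: "0 \<le> \<Phi> X \<and> \<Phi> X \<le> 1" for X
      unfolding \<Phi>_def using D01 by (auto intro!: prod_nonneg prod_le_1)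
    have "c' \<le> cE S K p \<Phi>"
    proof -
      let ?d = "d / 4 / 8"
      let ?ev = "\<lambda>X Y Z. \<forall>i\<in>I. \<forall>j\<in>I. \<forall>k\<in>I. i < j \<longrightarrow> j < k \<longrightarrow> ?d \<le> W i j k (X {i, j}) (Y {i, k}) (Z {j, k})"
      have "c' \<le> ?d ^ card EF * cE S K p (\<lambda>X. cE S K p (\<lambda>Y. cE S K p (\<lambda>Z. of_bool (?ev X Y Z))))"
        unfolding c'_def using mult_left_mono[OF big, of "?d ^ card EF"] d by (simp add: mult.commute)
      also have "\<dots> = cE S K p (\<lambda>X. cE S K p (\<lambda>Y. cE S K p (\<lambda>Z. ?d ^ card EF * of_bool (?ev X Y Z))))"
        by (simp only: cE_cmult)
      also have "\<dots> \<le> cE S K p (\<lambda>X. cE S K p (\<lambda>Y. cE S K p (\<lambda>Z. \<Phi> (mix D0 X (mix D1 Y Z)))))"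
      proof (intro cE_mono[OF w])
        fix X Y Z
        show "?d ^ card EF * of_bool (?ev X Y Z) \<le> \<Phi> (mix D0 X (mix D1 Y Z))"
        proof (cases "?ev X Y Z")
          case True
          have "?d \<le> D e (mix D0 X (mix D1 Y Z))" if "e \<in> \<E>" for e
          proof -
            obtain i j k where e: "e = {i, j, k}" "i < j" "j < k" "{i, j, k} \<subseteq> I"
              "{i, j} \<in> D0" "{i, k} \<notin> D0" "{i, k} \<in> D1" "{j, k} \<notin> D0" "{j, k} \<notin> D1"
              using \<E>[OF \<open>e \<in> \<E>\<close>] by blast
            have "D e (mix D0 X (mix D1 Y Z)) = W i j k (X {i, j}) (Y {i, k}) (Z {j, k})"
              unfolding e(1) DW[OF e(2,3)] using e(5-9) by (simp add: mix_def)
            then show ?thesis using True e by simp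
          qed
          then have "(\<Prod>e\<in>\<E>. ?d) \<le> \<Phi> (mix D0 X (mix D1 Y Z))"
            unfolding \<Phi>_def using d by (intro prod_mono) auto
          moreover have "?d ^ card EF \<le> ?d ^ card \<E>"
            using card\<E> d by (intro power_decreasing) auto
          ultimately show ?thesis using True by simp
        next
          case False
          then have "?d ^ card EF * of_bool (?ev X Y Z) = 0" by (simp only: of_bool_eq mult_zero_right)
          also have "\<dots> \<le> \<Phi> (mix D0 X (mix D1 Y Z))" using \<Phi>01 by simp
          finally show ?thesis .
        qed
      qed
      also have "\<dots> = cE S K p \<Phi>" by (rule cE_mix3[OF w])
      finally show ?thesis .
    qed
    \<comment> \<open>Of the main term \<open>c' * ?n\<close>, the independent model and the
      counting lemma lose at most a quarter each, so a positive count remains.\<close>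
    then have "c' * ?n \<le> ?n * cE S K p \<Phi>" using n0 by (simp add: mult.commute)
    also have "\<dots> \<le> (\<Sum>x\<in>\<Omega>. \<Phi> (restrict (\<lambda>s. \<kappa> s x) S)) + b * ?n"
      using model[of \<Phi>, OF \<Phi>01] by linarith
    also have "(\<Sum>x\<in>\<Omega>. \<Phi> (restrict (\<lambda>s. \<kappa> s x) S)) = (\<Sum>x\<in>\<Omega>. \<Prod>e\<in>\<E>. cexp \<Omega> (cols \<kappa> e) (h e) x)"
      unfolding \<Phi>_def by (intro sum.cong prod.cong refl) (simp add: Dres \<E>3)
    also have "\<dots> \<le> (\<Sum>x\<in>\<Omega>. \<Prod>e\<in>\<E>. h e x) + real (card \<E>) * \<epsilon> * ?n"
    proof -
      have "\<bar>(\<Sum>x\<in>PiE {..<N} U. \<Prod>e\<in>\<E>. h e x) - (\<Sum>x\<in>PiE {..<N} U. \<Prod>e\<in>\<E>. cexp \<Omega> (cols \<kappa> e) (h e) x)\<bar>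
          \<le> real (card \<E>) * \<epsilon> * real (card (PiE {..<N} U))"
      proof (rule counting_lemma)
        fix e assume e: "e \<in> \<E>"
        show "finite e" using \<E>3[OF e] by (simp add: nsets_def)
        show "regular (PiE {..<N} U) e (\<lambda>x. h e x - cexp \<Omega> (cols \<kappa> e) (h e) x) \<epsilon>"
          using reg3 \<E>3[OF e] by (simp add: \<Omega>_def)
        show "depends_on e (h e)"
        proof (rule depends_onI)
          fix x y :: "nat \<Rightarrow> 'v" assume "\<And>i. i \<in> e \<Longrightarrow> x i = y i"
          then have "x ` e = y ` e" by (intro image_cong) auto
          then show "h e x = h e y" by (simp add: h_def)
        qed
        show "depends_on e (cexp \<Omega> (cols \<kappa> e) (h e))"
          by (rule depends_on_cexp_cols) (use \<kappa> faceS[OF \<E>3[OF e]] in \<open>simp add: S_def\<close>)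
        show "0 \<le> h e x \<and> h e x \<le> 1" for x by (rule h)
        show "0 \<le> cexp \<Omega> (cols \<kappa> e) (h e) x \<and> cexp \<Omega> (cols \<kappa> e) (h e) x \<le> 1" for x
          using h by (simp add: cexp_nonneg cexp_le_1)
        fix e' assume e': "e' \<in> \<E>" "e \<subseteq> e'"
        show "e = e'" using \<E>3[OF e] \<E>3[OF e'(1)] e'(2) by (simp add: nsets_def card_subset_eq)
      qed (use fin\<Omega> fin\<E> in \<open>auto simp: \<Omega>_def\<close>)
      then show ?thesis by (simp add: \<Omega>_def)
    qed
    also have "\<dots> \<le> (\<Sum>x\<in>\<Omega>. \<Prod>e\<in>\<E>. h e x) + c' / 4 * ?n"
    proof -
      have "real (card \<E>) * \<epsilon> \<le> real (card EF) * \<epsilon>" using card\<E> \<epsilon>(1) by (intro mult_right_mono) auto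
      then have "real (card \<E>) * \<epsilon> \<le> c' / 4" using \<epsilon>(2) by linarith
      then show ?thesis by (intro add_left_mono mult_right_mono) auto
    qed
    finally have "c' * ?n \<le> (\<Sum>x\<in>\<Omega>. \<Prod>e\<in>\<E>. h e x) + c' / 4 * ?n + b * ?n" by simp
    moreover have "b * ?n \<le> c' / 4 * ?n" by (intro mult_right_mono) (simp_all add: b_def)
    moreover have "c' * ?n > 0" using c' n0 by simp
    ultimately have "(\<Sum>x\<in>\<Omega>. \<Prod>e\<in>\<E>. h e x) > 0" by (simp add: algebra_simps)
    then obtain x where x: "x \<in> \<Omega>" "(\<Prod>e\<in>\<E>. h e x) \<noteq> 0"
      by (metis sum.neutral less_irrefl)
    have edge: "x ` e \<in> E" if "e \<in> \<E>" for e
    proof (rule ccontr)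
      assume "x ` e \<notin> E"
      then have "h e x = 0" by (simp add: h_def)
      then have "(\<Prod>e\<in>\<E>. h e x) = 0" using fin\<E> that by (auto simp: prod_zero_iff)
      then show False using x(2) by simp
    qed
    have xU: "x i \<in> U i" if "i < N" for i using x(1) that by (auto simp: \<Omega>_def)
    have injx: "inj_on x {..<N}"
    proof (rule inj_onI)
      fix i j assume ij: "i \<in> {..<N}" "j \<in> {..<N}" "x i = x j"
      show "i = j"
      proof (rule ccontr)
        assume "i \<noteq> j"
        then have "U i \<inter> U j = {}" using disj ij unfolding disjoint_family_on_def by blast
        moreover have "x i \<in> U i" "x i \<in> U j" using xU[of i] xU[of j] ij by auto
        ultimately show False by blast
      qed
    qed
    show ?thesis
      unfolding contains_copy_def
    proof (intro exI[of _ "x \<circ> \<iota>"] conjI ballI)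
      show "inj_on (x \<circ> \<iota>) VF"
        using inj\<iota> injx im\<iota> IN by (intro comp_inj_on) (auto intro: inj_on_subset)
      show "(x \<circ> \<iota>) ` VF \<subseteq> V"
      proof
        fix v assume "v \<in> (x \<circ> \<iota>) ` VF"
        then obtain i where "i \<in> I" "v = x i" using im\<iota> by auto
        then show "v \<in> V" using IN xU[of i] UV[of i] by auto
      qed
      fix e assume "e \<in> EF"
      then have "\<iota> ` e \<in> \<E>" by (simp add: \<E>_def)
      from edge[OF this] show "(x \<circ> \<iota>) ` e \<in> E" by (simp add: image_comp)
    qed
  qed
  show thesis by (rule that[of "\<theta>' ^ 3" "2 * N"]) (use \<theta>' main in auto)
qed

subsection \<open>A tail bound on product sets\<close>

text \<open>Once the coordinates \<open>i\<close> and \<open>j\<close> are fixed the others are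
  independent, so the expectation of the product factorises. The powers of \<open>card S\<close> on
  the left replace a division.\<close>

lemma sum_PiE_two:
  fixes w :: "'i \<Rightarrow> 'a \<Rightarrow> 'a \<Rightarrow> 'a \<Rightarrow> real"
  assumes I: "finite I" and S: "finite S" and ij: "i \<in> I" "j \<in> I" "i \<noteq> j" and K: "K \<subseteq> I - {i, j}"
  shows "real (card S) ^ 2 * real (card S) ^ card K *
      (\<Sum>x\<in>PiE I (\<lambda>_. S). F (x i) (x j) * (\<Prod>k\<in>K. w k (x i) (x j) (x k)))
    = real (card S) ^ card I * (\<Sum>a\<in>S. \<Sum>b\<in>S. F a b * (\<Prod>k\<in>K. \<Sum>c\<in>S. w k a b c))"
proof -
  let ?O = "PiE I (\<lambda>_. S)" and ?n = "real (card S)"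
  have finK: "finite K" using K I by (meson finite_Diff finite_subset)
  \<comment> \<open>Indicators at \<open>i\<close> and \<open>j\<close> freeze
    \<open>x i = a\<close> and \<open>x j = b\<close>; this turns the summand into a product over
    all coordinates.\<close>
  define g where "g a b k c = (if k = i then of_bool (c = a) else if k = j then of_bool (c = b)
    else if k \<in> K then w k a b c else 1)" for a b k c
  have split: "(\<Prod>k\<in>I. f k) = f i * f j * (\<Prod>k\<in>K. f k) * (\<Prod>k\<in>I - {i, j} - K. f k)" for f :: "'i \<Rightarrow> real"
  proof -
    have "(\<Prod>k\<in>I. f k) = f i * (f j * (\<Prod>k\<in>I - {i} - {j}. f k))"
      using I ij by (simp add: prod.remove[of I i] prod.remove[of "I - {i}" j])
    also have "I - {i} - {j} = I - {i, j}" by auto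
    also have "(\<Prod>k\<in>I - {i, j}. f k) = (\<Prod>k\<in>I - {i, j} - K. f k) * (\<Prod>k\<in>K. f k)"
      by (rule prod.subset_diff[OF K]) (use I in simp)
    finally show ?thesis by (simp add: mult_ac)
  qed
  have pg: "(\<Prod>k\<in>I. g a b k (x k)) = of_bool (x i = a) * of_bool (x j = b) * (\<Prod>k\<in>K. w k a b (x k))" for a b x
  proof -
    have "(\<Prod>k\<in>K. g a b k (x k)) = (\<Prod>k\<in>K. w k a b (x k))"
      by (rule prod.cong) (use K in \<open>auto simp: g_def\<close>)
    moreover have "(\<Prod>k\<in>I - {i, j} - K. g a b k (x k)) = 1"
      by (rule prod.neutral) (auto simp: g_def)
    ultimately show ?thesis unfolding split using ij by (simp add: g_def)
  qed
  have expand: "F (x i) (x j) * (\<Prod>k\<in>K. w k (x i) (x j) (x k)) = (\<Sum>a\<in>S. \<Sum>b\<in>S. F a b * (\<Prod>k\<in>I. g a b k (x k)))"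
    if x: "x \<in> ?O" for x
  proof -
    have xS: "x i \<in> S" "x j \<in> S" using x ij by auto
    have "(\<Sum>b\<in>S. F a b * (\<Prod>k\<in>I. g a b k (x k)))
        = (if a = x i then F a (x j) * (\<Prod>k\<in>K. w k a (x j) (x k)) else 0)" for a
    proof -
      have "(\<Sum>b\<in>S. F a b * (\<Prod>k\<in>I. g a b k (x k)))
          = (\<Sum>b\<in>S. if b = x j then (if a = x i then F a b * (\<Prod>k\<in>K. w k a b (x k)) else 0) else 0)"
        unfolding pg by (intro sum.cong) auto
      then show ?thesis using xS S by (simp add: sum.delta)
    qed
    then show ?thesis using xS S by (simp add: sum.delta)
  qed
  have one: "?n ^ 2 * ?n ^ card K * (\<Sum>x\<in>?O. \<Prod>k\<in>I. g a b k (x k)) = ?n ^ card I * (\<Prod>k\<in>K. \<Sum>c\<in>S. w k a b c)"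
    if ab: "a \<in> S" "b \<in> S" for a b
  proof -
    have "(\<Sum>x\<in>?O. \<Prod>k\<in>I. g a b k (x k)) = (\<Prod>k\<in>I. \<Sum>c\<in>S. g a b k c)"
      using prod_sum_PiE[of I "\<lambda>_. S" "g a b"] I S by simp
    also have "\<dots> = 1 * 1 * (\<Prod>k\<in>K. \<Sum>c\<in>S. w k a b c) * ?n ^ card (I - {i, j} - K)"
    proof -
      have "(\<Sum>c\<in>S. g a b i c) = (\<Sum>c\<in>S. if c = a then 1 else 0)"
        "(\<Sum>c\<in>S. g a b j c) = (\<Sum>c\<in>S. if c = b then 1 else 0)"
        using ij by (auto simp: g_def intro!: sum.cong)
      then have "(\<Sum>c\<in>S. g a b i c) = 1" "(\<Sum>c\<in>S. g a b j c) = 1"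
        using ab S by (simp_all add: sum.delta)
      moreover have "(\<Prod>k\<in>K. \<Sum>c\<in>S. g a b k c) = (\<Prod>k\<in>K. \<Sum>c\<in>S. w k a b c)"
        by (intro prod.cong sum.cong) (use K in \<open>auto simp: g_def\<close>)
      moreover have "(\<Prod>k\<in>I - {i, j} - K. \<Sum>c\<in>S. g a b k c) = (\<Prod>k\<in>I - {i, j} - K. ?n)"
        by (intro prod.cong) (auto simp: g_def)
      ultimately show ?thesis unfolding split by simp
    qed
    moreover have "card I = 2 + card K + card (I - {i, j} - K)"
    proof -
      have "card (I - {i, j}) = card K + card (I - {i, j} - K)"
        using card_Diff_subset[OF finK K] card_mono[OF _ K] I by simp
      moreover have "card I = 2 + card (I - {i, j})"
        using card_Diff_subset[of "{i, j}" I] card_mono[of I "{i, j}"] I ij by simp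
      ultimately show ?thesis by simp
    qed
    ultimately show ?thesis by (simp add: power_add power2_eq_square mult_ac)
  qed
  have "(\<Sum>x\<in>?O. F (x i) (x j) * (\<Prod>k\<in>K. w k (x i) (x j) (x k)))
      = (\<Sum>x\<in>?O. \<Sum>a\<in>S. \<Sum>b\<in>S. F a b * (\<Prod>k\<in>I. g a b k (x k)))"
    by (rule sum.cong[OF refl expand])
  also have "\<dots> = (\<Sum>a\<in>S. \<Sum>x\<in>?O. \<Sum>b\<in>S. F a b * (\<Prod>k\<in>I. g a b k (x k)))"
    by (rule sum.swap)
  also have "\<dots> = (\<Sum>a\<in>S. \<Sum>b\<in>S. \<Sum>x\<in>?O. F a b * (\<Prod>k\<in>I. g a b k (x k)))"
    by (rule sum.cong[OF refl], rule sum.swap)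
  also have "\<dots> = (\<Sum>a\<in>S. \<Sum>b\<in>S. F a b * (\<Sum>x\<in>?O. \<Prod>k\<in>I. g a b k (x k)))"
    by (simp only: sum_distrib_left)
  finally have eq: "(\<Sum>x\<in>?O. F (x i) (x j) * (\<Prod>k\<in>K. w k (x i) (x j) (x k)))
      = (\<Sum>a\<in>S. \<Sum>b\<in>S. F a b * (\<Sum>x\<in>?O. \<Prod>k\<in>I. g a b k (x k)))" .
  have "?n ^ 2 * ?n ^ card K * (\<Sum>a\<in>S. \<Sum>b\<in>S. F a b * (\<Sum>x\<in>?O. \<Prod>k\<in>I. g a b k (x k)))
      = (\<Sum>a\<in>S. \<Sum>b\<in>S. F a b * (?n ^ 2 * ?n ^ card K * (\<Sum>x\<in>?O. \<Prod>k\<in>I. g a b k (x k))))"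
    by (simp only: sum_distrib_left mult_ac)
  also have "\<dots> = (\<Sum>a\<in>S. \<Sum>b\<in>S. F a b * (?n ^ card I * (\<Prod>k\<in>K. \<Sum>c\<in>S. w k a b c)))"
    using one by (intro sum.cong) auto
  also have "\<dots> = ?n ^ card I * (\<Sum>a\<in>S. \<Sum>b\<in>S. F a b * (\<Prod>k\<in>K. \<Sum>c\<in>S. w k a b c))"
    by (simp only: sum_distrib_left mult_ac)
  finally show ?thesis unfolding eq .
qed

text \<open>A Chernoff bound given the coordinates \<open>i\<close> and \<open>j\<close>: the
  exponential moment with parameter \<open>\<epsilon> / 2\<close> is at most \<open>\<rho>\<close>
  per coordinate in \<open>K\<close>. Hits depend on both fixed coordinates, as they do for a common
  neighbour of two vertices.\<close>

lemma card_few_hits: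
  fixes R :: "'i \<Rightarrow> 'a \<Rightarrow> 'a \<Rightarrow> 'a \<Rightarrow> bool"
  assumes I: "finite I" and S: "finite S" "S \<noteq> {}" and ij: "i \<in> I" "j \<in> I" "i \<noteq> j" and K: "K \<subseteq> I - {i, j}"
    and p: "0 \<le> p" "p \<le> 1" and \<epsilon>: "0 \<le> \<epsilon>"
    and R: "\<And>k a b. k \<in> K \<Longrightarrow> a \<in> S \<Longrightarrow> b \<in> S \<Longrightarrow> good a b \<Longrightarrow> p * real (card S) \<le> real (card {c\<in>S. R k a b c})"
  shows "real (card {x \<in> PiE I (\<lambda>_. S). good (x i) (x j) \<and>
      real (card {k\<in>K. R k (x i) (x j) (x k)}) < (p - \<epsilon>) * real (card K)})
    \<le> exp (- (\<epsilon>\<^sup>2 / 4) * real (card K)) * real (card S) ^ card I"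
proof -
  let ?O = "PiE I (\<lambda>_. S)" and ?n = "real (card S)" and ?l = "\<epsilon> / 2"
  have finK: "finite K" using K I by (meson finite_Diff finite_subset)
  have n: "?n > 0" using S by (simp add: card_gt_0_iff)
  have finO: "finite ?O" using I S by (intro finite_PiE) auto
  define w where "w k a b c = exp (- ?l * of_bool (R k a b c))" for k a b c
  define F where "F a b = (of_bool (good a b) :: real)" for a b
  define \<rho> where "\<rho> = exp (- p * (?l - ?l\<^sup>2))"
  let ?cnt = "\<lambda>x. real (card {k\<in>K. R k (x i) (x j) (x k)})"
  let ?B = "{x \<in> ?O. good (x i) (x j) \<and> ?cnt x < (p - \<epsilon>) * real (card K)}"
  let ?c = "exp (?l * (p - \<epsilon>) * real (card K))"
  have "real (card ?B) = (\<Sum>x\<in>?O. of_bool (x \<in> ?B))"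
    using finO by (simp add: Int_def)
  also have "\<dots> \<le> (\<Sum>x\<in>?O. ?c * (F (x i) (x j) * (\<Prod>k\<in>K. w k (x i) (x j) (x k))))"
  proof (rule sum_mono)
    fix x assume x: "x \<in> ?O"
    have pr: "(\<Prod>k\<in>K. w k (x i) (x j) (x k)) = exp (- ?l * ?cnt x)"
    proof -
      have "(\<Sum>k\<in>K. of_bool (R k (x i) (x j) (x k)) :: real) = ?cnt x"
        using finK by (simp add: Int_def)
      moreover have "(\<Prod>k\<in>K. w k (x i) (x j) (x k)) = exp (\<Sum>k\<in>K. - ?l * of_bool (R k (x i) (x j) (x k)))"
        unfolding w_def by (rule exp_sum[OF finK, symmetric])
      ultimately show ?thesis by (simp only: sum_distrib_left[symmetric])
    qed
    show "of_bool (x \<in> ?B) \<le> ?c * (F (x i) (x j) * (\<Prod>k\<in>K. w k (x i) (x j) (x k)))"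
    proof (cases "x \<in> ?B")
      case True
      then have "0 \<le> ?l * ((p - \<epsilon>) * real (card K) - ?cnt x)" using \<epsilon> by simp
      then have "1 \<le> exp (?l * ((p - \<epsilon>) * real (card K) - ?cnt x))" by simp
      also have "\<dots> = ?c * exp (- ?l * ?cnt x)" by (simp add: exp_add[symmetric] algebra_simps)
      finally show ?thesis unfolding pr using True by (simp add: F_def)
    next
      case False
      then have "of_bool (x \<in> ?B) = (0 :: real)" by (simp only: of_bool_eq)
      then show ?thesis unfolding pr by (simp only: F_def) simp
    qed
  qed
  also have "\<dots> = ?c * (\<Sum>x\<in>?O. F (x i) (x j) * (\<Prod>k\<in>K. w k (x i) (x j) (x k)))"
    by (simp only: sum_distrib_left)
  finally have 1: "real (card ?B) \<le> \<dots>" .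
  have ws: "(\<Sum>c\<in>S. w k a b c) \<le> ?n * \<rho>" if "k \<in> K" "a \<in> S" "b \<in> S" "good a b" for k a b
  proof -
    let ?m = "real (card {c\<in>S. R k a b c})"
    \<comment> \<open>The quadratic error is what leaves \<open>- \<epsilon>\<^sup>2 / 4\<close> in
      the exponent, using \<open>p \<le> 1\<close>.\<close>
    have "exp (- ?l) \<le> 1 - (?l - ?l\<^sup>2)"
    proof -
      have "exp (- ?l) = 1 / exp ?l" by (simp add: exp_minus field_simps)
      also have "\<dots> \<le> 1 / (1 + ?l)" using \<epsilon> by (intro divide_left_mono) (auto simp: exp_ge_add_one_self)
      also have "\<dots> \<le> 1 - (?l - ?l\<^sup>2)"
      proof -
        have "1 \<le> (1 - (?l - ?l\<^sup>2)) * (1 + ?l)" using \<epsilon> by (simp add: algebra_simps power2_eq_square)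
        then show ?thesis using \<epsilon> by (simp add: divide_le_eq)
      qed
      finally show ?thesis .
    qed
    then have e: "?l - ?l\<^sup>2 \<le> 1 - exp (- ?l)" by simp
    have e0: "0 \<le> 1 - exp (- ?l)" using \<epsilon> by simp
    have "(\<Sum>c\<in>S. w k a b c) = (\<Sum>c\<in>S. 1 - (1 - exp (- ?l)) * of_bool (R k a b c))"
      unfolding w_def by (intro sum.cong) auto
    also have "\<dots> = ?n - (1 - exp (- ?l)) * ?m"
      using S(1) by (simp add: sum_subtractf sum_distrib_left[symmetric] Int_def)
    also have "\<dots> \<le> ?n - (1 - exp (- ?l)) * (p * ?n)"
      using R[OF that] e0 by (intro diff_left_mono mult_left_mono) auto
    also have "\<dots> = ?n * (1 - p * (1 - exp (- ?l)))" by (simp add: algebra_simps)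
    also have "\<dots> \<le> ?n * (1 - p * (?l - ?l\<^sup>2))"
      using e p by (intro mult_left_mono diff_left_mono) auto
    also have "\<dots> \<le> ?n * \<rho>"
      unfolding \<rho>_def using exp_ge_add_one_self[of "- p * (?l - ?l\<^sup>2)"] by (intro mult_left_mono) auto
    finally show ?thesis .
  qed
  have "?n ^ 2 * ?n ^ card K * (\<Sum>x\<in>?O. F (x i) (x j) * (\<Prod>k\<in>K. w k (x i) (x j) (x k)))
     = ?n ^ card I * (\<Sum>a\<in>S. \<Sum>b\<in>S. F a b * (\<Prod>k\<in>K. \<Sum>c\<in>S. w k a b c))"
    by (rule sum_PiE_two[OF I S(1) ij K])
  also have "\<dots> \<le> ?n ^ card I * (\<Sum>a\<in>S. \<Sum>b\<in>S. (?n * \<rho>) ^ card K)"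
  proof (intro mult_left_mono sum_mono)
    fix a b assume ab: "a \<in> S" "b \<in> S"
    show "F a b * (\<Prod>k\<in>K. \<Sum>c\<in>S. w k a b c) \<le> (?n * \<rho>) ^ card K"
    proof (cases "good a b")
      case True
      have "(\<Prod>k\<in>K. \<Sum>c\<in>S. w k a b c) \<le> (\<Prod>k\<in>K. ?n * \<rho>)"
        by (intro prod_mono conjI sum_nonneg ws) (use ab True in \<open>auto simp: w_def\<close>)
      then show ?thesis using True by (simp add: F_def)
    qed (use n in \<open>simp add: F_def \<rho>_def\<close>)
  qed simp
  also have "\<dots> = ?n ^ 2 * ?n ^ card K * (?n ^ card I * \<rho> ^ card K)"
    by (simp add: power_mult_distrib power2_eq_square)
  finally have 2: "(\<Sum>x\<in>?O. F (x i) (x j) * (\<Prod>k\<in>K. w k (x i) (x j) (x k))) \<le> ?n ^ card I * \<rho> ^ card K"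
    using n by simp
  have "?c * (\<Sum>x\<in>?O. F (x i) (x j) * (\<Prod>k\<in>K. w k (x i) (x j) (x k))) \<le> ?c * (?n ^ card I * \<rho> ^ card K)"
    using 2 by (intro mult_left_mono) auto
  also have "\<dots> = exp (?l * (p - \<epsilon>) * real (card K) + real (card K) * (- p * (?l - ?l\<^sup>2))) * ?n ^ card I"
    by (simp only: \<rho>_def exp_of_nat_mult[symmetric] exp_add mult_ac)
  also have "\<dots> \<le> exp (- (\<epsilon>\<^sup>2 / 4) * real (card K)) * ?n ^ card I"
  proof -
    have "?l * (p - \<epsilon>) * real (card K) + real (card K) * (- p * (?l - ?l\<^sup>2))
      = (p * \<epsilon>\<^sup>2 / 4 - \<epsilon>\<^sup>2 / 2) * real (card K)" by (simp add: field_simps power2_eq_square)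
    also have "\<dots> \<le> (- (\<epsilon>\<^sup>2 / 4)) * real (card K)"
      using p mult_right_mono[OF p(2), of "\<epsilon>\<^sup>2"] by (intro mult_right_mono) auto
    finally show ?thesis by (intro mult_right_mono) auto
  qed
  finally show ?thesis using 1 by linarith
qed

subsection \<open>The codegree Turan density exists\<close>

lemma finite_3graphs: "finite V \<Longrightarrow> finite {E. is_3graph V E}"
  by (rule finite_subset[of _ "Pow (Pow V)"]) (auto simp: is_3graph_def)

lemma finite_ex_co_set:
  fixes n :: nat
  shows "finite {min_codeg {..<n} E | E. is_3graph {..<n} E \<and> \<not> contains_copy {..<n} E VF EF}"
proof (rule finite_subset)
  show "finite (min_codeg {..<n} ` {E. is_3graph {..<n} E})" by (rule finite_imageI[OF finite_3graphs]) simp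
qed auto

lemma ex_co_ge:
  assumes "is_3graph {..<n} E" "\<not> contains_copy {..<n} E VF EF"
  shows "min_codeg {..<n} E \<le> ex_co n VF EF"
proof -
  let ?A = "{min_codeg {..<n} E | E. is_3graph {..<n} E \<and> \<not> contains_copy {..<n} E VF EF}"
  have "min_codeg {..<n} E \<in> ?A" using assms by blast
  then show ?thesis unfolding ex_co_def using finite_ex_co_set
    by (intro cSup_upper bdd_above_finite)
qed

text \<open>A finite non-empty set attains its supremum. The first case covers \<open>n\<close> for
  which every 3-graph on \<open>n\<close> vertices contains \<open>F\<close>, where the supremum of
  the empty set is \<open>0\<close>.\<close>

lemma ex_co_cases:
  obtains "ex_co n VF EF = 0"
  | E where "is_3graph {..<n} E" "\<not> contains_copy {..<n} E VF EF" "ex_co n VF EF = min_codeg {..<n} E"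
proof -
  let ?A = "{min_codeg {..<n} E | E. is_3graph {..<n} E \<and> \<not> contains_copy {..<n} E VF EF}"
  show thesis
  proof (cases "?A = {}")
    case True
    then have "ex_co n VF EF = 0" unfolding ex_co_def by (simp only: True Sup_nat_empty)
    then show ?thesis by (rule that(1))
  next
    case False
    have "Sup ?A = Max ?A" by (rule cSup_eq_Max[OF finite_ex_co_set False])
    then have "ex_co n VF EF \<in> ?A"
      unfolding ex_co_def using Max_in[OF finite_ex_co_set False] by simp
    then show ?thesis using that(2) by blast
  qed
qed

lemma min_codeg_le:
  assumes "a \<in> V" "b \<in> V" "a \<noteq> b"
  shows "min_codeg V E \<le> codeg E {a, b}"
  unfolding min_codeg_def
  by (rule cInf_lower) (use assms in \<open>auto intro!: exI[of _ "{a, b}"]\<close>)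

lemma min_codeg_ge:
  assumes "finite V" "card V \<ge> 2" "\<And>a b. a \<in> V \<Longrightarrow> b \<in> V \<Longrightarrow> a \<noteq> b \<Longrightarrow> c \<le> codeg E {a, b}"
  shows "c \<le> min_codeg V E"
  unfolding min_codeg_def
proof (rule cInf_greatest)
  obtain S where "S \<subseteq> V" "card S = 2" using obtain_subset_with_card_n[OF assms(2)] by metis
  then show "{codeg E S | S. S \<subseteq> V \<and> card S = 2} \<noteq> {}" by blast
  fix x assume "x \<in> {codeg E S | S. S \<subseteq> V \<and> card S = 2}"
  then obtain S where S: "x = codeg E S" "S \<subseteq> V" "card S = 2" by blast
  then obtain a b where "S = {a, b}" "a \<noteq> b" by (auto simp: card_2_iff)
  then show "c \<le> x" using assms(3) S by auto
qed

lemma codeg_le_neighbours: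
  assumes "is_3graph V E" "a \<noteq> b"
  shows "codeg E {a, b} \<le> card {c \<in> V. {a, b, c} \<in> E}"
proof -
  have V: "finite V" "\<And>e. e \<in> E \<Longrightarrow> e \<subseteq> V \<and> card e = 3" using assms(1) by (auto simp: is_3graph_def)
  have "{e \<in> E. {a, b} \<subseteq> e} \<subseteq> (\<lambda>c. {a, b, c}) ` {c \<in> V. {a, b, c} \<in> E}"
  proof
    fix e assume e: "e \<in> {e \<in> E. {a, b} \<subseteq> e}"
    then have e3: "card e = 3" "e \<subseteq> V" "{a, b} \<subseteq> e" using V by auto
    then have "card (e - {a, b}) = 1" using assms(2) by (simp add: card_Diff_subset)
    then obtain c where "e - {a, b} = {c}" by (rule card_1_singletonE)
    then have "e = {a, b, c}" "c \<in> V" using e3 by auto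
    then show "e \<in> (\<lambda>c. {a, b, c}) ` {c \<in> V. {a, b, c} \<in> E}" using e by blast
  qed
  then have "card {e \<in> E. {a, b} \<subseteq> e} \<le> card ((\<lambda>c. {a, b, c}) ` {c \<in> V. {a, b, c} \<in> E})"
    using V(1) by (intro card_mono) auto
  also have "\<dots> \<le> card {c \<in> V. {a, b, c} \<in> E}" using V(1) by (intro card_image_le) auto
  finally show ?thesis by (simp add: codeg_def)
qed

lemma neighbours_le_codeg:
  assumes "finite E" "a \<noteq> b" "finite K" "K \<inter> {a, b} = {}" "\<And>c. c \<in> K \<Longrightarrow> {a, b, c} \<in> E"
  shows "card K \<le> codeg E {a, b}"
proof -
  have "inj_on (\<lambda>c. {a, b, c}) K"
    using assms(4) by (intro inj_onI) (auto simp: insert_eq_iff doubleton_eq_iff)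
  then have "card K = card ((\<lambda>c. {a, b, c}) ` K)" by (simp add: card_image)
  also have "\<dots> \<le> codeg E {a, b}"
    unfolding codeg_def using assms by (intro card_mono) auto
  finally show ?thesis .
qed

lemma ex_co_le:
  assumes "n \<ge> 2"
  shows "ex_co n VF EF \<le> n"
proof (rule ex_co_cases[of n VF EF])
  fix E assume E: "is_3graph {..<n} E" "ex_co n VF EF = min_codeg {..<n} E"
  have "min_codeg {..<n} E \<le> codeg E {0, 1}" using assms by (intro min_codeg_le) auto
  also have "\<dots> \<le> card {c \<in> {..<n}. {0, 1, c} \<in> E}" by (rule codeg_le_neighbours[OF E(1)]) simp
  also have "\<dots> \<le> card {..<n}" by (intro card_mono) auto
  finally show ?thesis using E(2) by simp
qed simp

text \<open>Draw \<open>m\<close> vertices of an extremal 3-graph with repetition. Coincidences have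
  total probability below \<open>1 / 2\<close> since \<open>n\<close> exceeds
  \<open>2 * m ^ 2\<close>, and so have pairs with too few common neighbours in the sample, by
  \<open>card_few_hits\<close>. Some sample avoids both and induces an \<open>F\<close>-free 3-graph
  of nearly the same relative codegree.\<close>

lemma ex_co_sample:
  fixes VF :: "'b set" and \<epsilon> :: real
  assumes \<epsilon>: "\<epsilon> > 0" and m: "m \<ge> 2" "2 / \<epsilon> \<le> real m" "real m ^ 2 * exp (- (\<epsilon>\<^sup>2 / 4) * real (m - 2)) < 1 / 2"
    and n: "2 * m ^ 2 < n"
  shows "real (ex_co n VF EF) / real n - 2 * \<epsilon> \<le> real (ex_co m VF EF) / real m"
proof (rule ex_co_cases[of n VF EF])
  assume "ex_co n VF EF = 0"
  then show ?thesis using \<epsilon> by (simp add: order_trans[of _ 0])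
next
  fix E assume E: "is_3graph {..<n} E" and free: "\<not> contains_copy {..<n} E VF EF"
    and exn: "ex_co n VF EF = min_codeg {..<n} E"
  define p where "p = real (ex_co n VF EF) / real n"
  have n2: "n \<ge> 2" using n m(1) power_mono[OF m(1), of 2] by simp
  then have n0: "real n > 0" "n > 0" by auto
  have p: "0 \<le> p" "p \<le> 1" using ex_co_le[of n VF EF] n0 n2 by (auto simp: p_def)
  let ?I = "{..<m}" and ?S = "{..<n}"
  let ?O = "PiE ?I (\<lambda>_. ?S)"
  have finO: "finite ?O" by (intro finite_PiE) auto
  have cO: "real (card ?O) = real n ^ m" by (simp add: card_PiE)
  let ?R = "\<lambda>(k :: nat) a b c. {a, b, c} \<in> E"
  let ?K = "\<lambda>i j. ?I - {i, j}"
  define B1 where "B1 i j = {x \<in> ?O. x i = x j}" for i j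
  define B2 where "B2 i j = {x \<in> ?O. x i \<noteq> x j \<and>
      real (card {k \<in> ?K i j. {x i, x j, x k} \<in> E}) < (p - \<epsilon>) * real (card (?K i j))}" for i j
  define PP where "PP = {(i, j). i \<in> ?I \<and> j \<in> ?I \<and> i \<noteq> j}"
  have PP: "finite PP" "real (card PP) \<le> real m ^ 2"
  proof -
    have sub: "PP \<subseteq> ?I \<times> ?I" by (auto simp: PP_def)
    then show "finite PP" by (rule finite_subset) simp
    have "card PP \<le> card (?I \<times> ?I)" by (intro card_mono sub) simp
    then have "card PP \<le> m ^ 2" by (simp add: card_cartesian_product power2_eq_square)
    then show "real (card PP) \<le> real m ^ 2" by (metis of_nat_le_iff of_nat_power)
  qed
  have b1: "real n * real (card (B1 i j)) \<le> real n ^ m" if "(i, j) \<in> PP" for i j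
  proof -
    have ij: "i \<in> ?I" "j \<in> ?I" "i \<noteq> j" using that by (auto simp: PP_def)
    \<comment> \<open>With \<open>K\<close> empty the lemma describes the joint distribution of two
      coordinates.\<close>
    have "real (card ?S) ^ 2 * real (card ?S) ^ card ({} :: nat set) *
        (\<Sum>x\<in>?O. of_bool (x i = x j) * (\<Prod>k\<in>({} :: nat set). (1 :: real)))
      = real (card ?S) ^ card ?I * (\<Sum>a\<in>?S. \<Sum>b\<in>?S. of_bool (a = b) * (\<Prod>k\<in>({} :: nat set). \<Sum>c\<in>?S. 1))"
      by (rule sum_PiE_two[OF _ _ ij, where F = "\<lambda>a b. of_bool (a = b)" and w = "\<lambda>_ _ _ _. 1"]) auto
    then have "real n ^ 2 * (\<Sum>x\<in>?O. of_bool (x i = x j)) = real n ^ m * (\<Sum>a<n. \<Sum>b<n. of_bool (a = b))"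
      by simp
    also have "(\<Sum>a<n. \<Sum>b<n. of_bool (a = b) :: real) = (\<Sum>a<n. 1)"
    proof (rule sum.cong[OF refl])
      fix a assume "a \<in> {..<n}"
      have "(\<Sum>b<n. of_bool (a = b) :: real) = (\<Sum>b<n. if a = b then 1 else 0)" by (rule sum.cong) auto
      then show "(\<Sum>b<n. of_bool (a = b) :: real) = 1" using \<open>a \<in> {..<n}\<close> by (simp add: sum.delta')
    qed
    also have "(\<Sum>x\<in>?O. of_bool (x i = x j) :: real) = real (card (B1 i j))"
      using finO by (simp add: B1_def Int_def)
    finally have "real n * (real n * real (card (B1 i j))) = real n * real n ^ m"
      by (simp add: power2_eq_square mult_ac)
    then show ?thesis using n0 by simp
  qed
  have b2: "real (card (B2 i j)) \<le> exp (- (\<epsilon>\<^sup>2 / 4) * real (m - 2)) * real n ^ m" if "(i, j) \<in> PP" for i j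
  proof -
    have ij: "i \<in> ?I" "j \<in> ?I" "i \<noteq> j" using that by (auto simp: PP_def)
    have cK: "card (?K i j) = m - 2" using ij by (simp add: card_Diff_subset)
    have "real (card {x \<in> ?O. x i \<noteq> x j \<and>
        real (card {k \<in> ?K i j. ?R k (x i) (x j) (x k)}) < (p - \<epsilon>) * real (card (?K i j))})
      \<le> exp (- (\<epsilon>\<^sup>2 / 4) * real (card (?K i j))) * real (card ?S) ^ card ?I"
    proof (rule card_few_hits[where good = "(\<noteq>)" and R = ?R, OF _ _ _ ij])
      fix a b assume ab: "a \<in> ?S" "b \<in> ?S" "a \<noteq> b"
      have "ex_co n VF EF \<le> codeg E {a, b}" unfolding exn by (rule min_codeg_le[OF ab])
      also have "\<dots> \<le> card {c \<in> ?S. {a, b, c} \<in> E}" by (rule codeg_le_neighbours[OF E ab(3)])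
      finally show "p * real (card ?S) \<le> real (card {c \<in> ?S. {a, b, c} \<in> E})"
        using n0 by (simp add: p_def)
    qed (use p \<epsilon> n0 in auto)
    then show ?thesis by (simp add: B2_def cK)
  qed
  have "\<exists>x\<in>?O. \<forall>(i, j)\<in>PP. x \<notin> B1 i j \<and> x \<notin> B2 i j"
  proof (rule ccontr)
    assume "\<not> ?thesis"
    then have "?O \<subseteq> (\<Union>(i, j)\<in>PP. B1 i j \<union> B2 i j)" by blast
    moreover have "finite (\<Union>(i, j)\<in>PP. B1 i j \<union> B2 i j)"
      by (rule finite_subset[OF _ finO]) (auto simp: B1_def B2_def)
    ultimately have "card ?O \<le> card (\<Union>(i, j)\<in>PP. B1 i j \<union> B2 i j)" by (intro card_mono)
    also have "\<dots> \<le> (\<Sum>(i, j)\<in>PP. card (B1 i j \<union> B2 i j))"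
      using card_UN_le[OF PP(1), of "\<lambda>(i, j). B1 i j \<union> B2 i j"] by (simp add: case_prod_unfold)
    also have "\<dots> \<le> (\<Sum>(i, j)\<in>PP. card (B1 i j) + card (B2 i j))"
      by (intro sum_mono) (auto intro: card_Un_le)
    finally have "real (card ?O) \<le> (\<Sum>(i, j)\<in>PP. real (card (B1 i j)) + real (card (B2 i j)))"
      by (simp only: of_nat_le_iff[symmetric, where 'a = real] of_nat_sum case_prod_unfold of_nat_add)
    also have "\<dots> \<le> (\<Sum>(i, j)\<in>PP. real n ^ m / real n + exp (- (\<epsilon>\<^sup>2 / 4) * real (m - 2)) * real n ^ m)"
      using b1 b2 n0 by (intro sum_mono) (auto simp: pos_le_divide_eq mult.commute intro!: add_mono)
    also have "\<dots> = real (card PP) * (real n ^ m / real n + exp (- (\<epsilon>\<^sup>2 / 4) * real (m - 2)) * real n ^ m)"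
      by (simp add: case_prod_unfold)
    also have "\<dots> \<le> real m ^ 2 * (real n ^ m / real n + exp (- (\<epsilon>\<^sup>2 / 4) * real (m - 2)) * real n ^ m)"
      using PP(2) n0 by (intro mult_right_mono) auto
    also have "\<dots> = real n ^ m * (real m ^ 2 / real n + real m ^ 2 * exp (- (\<epsilon>\<^sup>2 / 4) * real (m - 2)))"
      by (simp add: algebra_simps)
    also have "\<dots> < real n ^ m * 1"
    proof (rule mult_strict_left_mono)
      have "real (2 * m ^ 2) < real n" using n by (simp only: of_nat_less_iff)
      then have "real m ^ 2 / real n < 1 / 2" using n0 by (simp add: field_simps)
      then show "real m ^ 2 / real n + real m ^ 2 * exp (- (\<epsilon>\<^sup>2 / 4) * real (m - 2)) < 1" using m(3) by linarith
    qed (use n0 in simp)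
    finally show False using cO by simp
  qed
  then obtain x where x: "x \<in> ?O" and nb: "\<And>i j. i \<in> ?I \<Longrightarrow> j \<in> ?I \<Longrightarrow> i \<noteq> j \<Longrightarrow> x \<notin> B1 i j \<and> x \<notin> B2 i j"
    unfolding PP_def by blast
  have inj: "inj_on x ?I" using nb x by (intro inj_onI) (auto simp: B1_def)
  have xn: "x ` ?I \<subseteq> ?S" using x by auto
  define E' where "E' = {e. e \<subseteq> ?I \<and> card e = 3 \<and> x ` e \<in> E}"
  have E': "is_3graph ?I E'" by (auto simp: E'_def is_3graph_def)
  have finE': "finite E'" by (rule finite_subset[of _ "Pow ?I"]) (auto simp: E'_def)
  have "\<not> contains_copy ?I E' VF EF"
  proof
    assume "contains_copy ?I E' VF EF"
    then obtain g where g: "inj_on g VF" "g ` VF \<subseteq> ?I" "\<forall>e\<in>EF. g ` e \<in> E'"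
      unfolding contains_copy_def by blast
    have "contains_copy ?S E VF EF"
      unfolding contains_copy_def
    proof (intro exI[of _ "x \<circ> g"] conjI ballI)
      show "inj_on (x \<circ> g) VF" using g(1,2) inj by (intro comp_inj_on) (auto intro: inj_on_subset)
      show "(x \<circ> g) ` VF \<subseteq> ?S" using g(2) xn by (auto simp: image_comp[symmetric])
      fix e assume "e \<in> EF"
      then show "(x \<circ> g) ` e \<in> E" using g(3) by (auto simp: E'_def image_comp)
    qed
    then show False using free by simp
  qed
  from ex_co_ge[OF E' this] have 1: "min_codeg ?I E' \<le> ex_co m VF EF" .
  have "nat \<lceil>(p - \<epsilon>) * real (m - 2)\<rceil> \<le> min_codeg ?I E'"
  proof (rule min_codeg_ge)
    fix i j assume ij: "i \<in> ?I" "j \<in> ?I" "i \<noteq> j"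
    have cK: "card (?K i j) = m - 2" using ij by (simp add: card_Diff_subset)
    have "x i \<noteq> x j" using inj ij by (auto simp: inj_on_def)
    then have "(p - \<epsilon>) * real (m - 2) \<le> real (card {k \<in> ?K i j. {x i, x j, x k} \<in> E})"
      using nb[OF ij] x cK by (auto simp: B2_def)
    moreover have "card {k \<in> ?K i j. {x i, x j, x k} \<in> E} \<le> codeg E' {i, j}"
    proof (rule neighbours_le_codeg[OF finE' ij(3)])
      fix k assume "k \<in> {k \<in> ?K i j. {x i, x j, x k} \<in> E}"
      then show "{i, j, k} \<in> E'" using ij by (auto simp: E'_def card_insert_if)
    qed auto
    ultimately have "(p - \<epsilon>) * real (m - 2) \<le> real (codeg E' {i, j})" by linarith
    then show "nat \<lceil>(p - \<epsilon>) * real (m - 2)\<rceil> \<le> codeg E' {i, j}" by linarith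
  qed (use m in auto)
  then have "(p - \<epsilon>) * real (m - 2) \<le> real (ex_co m VF EF)" using 1 by linarith
  \<comment> \<open>Replacing \<open>m - 2\<close> by \<open>m\<close> costs at most
    \<open>2\<close>, which is at most \<open>\<epsilon> * m\<close> by the assumption
    \<open>2 / \<epsilon> \<le> m\<close>.\<close>
  moreover have "(p - 2 * \<epsilon>) * real m \<le> (p - \<epsilon>) * real (m - 2)"
  proof -
    have "2 \<le> \<epsilon> * real m" using m(2) \<epsilon> by (simp add: divide_le_eq mult.commute)
    moreover have "p * 2 \<le> 2" "0 \<le> \<epsilon> * 2" using p \<epsilon> by auto
    moreover have "(p - \<epsilon>) * real (m - 2) = (p - 2 * \<epsilon>) * real m + \<epsilon> * real m - p * 2 + \<epsilon> * 2"
      using m(1) by (simp add: of_nat_diff algebra_simps)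
    ultimately show ?thesis by linarith
  qed
  ultimately have "(p - 2 * \<epsilon>) * real m \<le> real (ex_co m VF EF)" by linarith
  then show ?thesis using m(1) by (simp add: p_def pos_le_divide_eq)
qed

text \<open>With \<open>y\<close> a third of the exponent,
  \<open>exp y ^ 3 \<ge> (1 + y) ^ 3\<close> grows like the cube of \<open>n\<close> and beats the
  square. Capping \<open>c\<close> at \<open>1\<close> lets the summand \<open>1\<close> absorb the
  shift from \<open>n\<close> to \<open>n - 2\<close>.\<close>

lemma square_mult_exp_small:
  fixes c \<delta> :: real
  assumes "c > 0" "\<delta> > 0"
  obtains n0 where "\<And>n. n \<ge> n0 \<Longrightarrow> real n ^ 2 * exp (- c * real (n - 2)) < \<delta>"
proof -
  define b where "b = min c 1"
  have b: "0 < b" "b \<le> 1" "b \<le> c" using assms by (auto simp: b_def)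
  define n0 where "n0 = 2 + nat \<lceil>27 / (b ^ 3 * \<delta>)\<rceil>"
  have "real n ^ 2 * exp (- c * real (n - 2)) < \<delta>" if n: "n \<ge> n0" for n
  proof -
    have n2: "n \<ge> 2" and big: "27 / (b ^ 3 * \<delta>) < real n" using n unfolding n0_def by linarith+
    define y where "y = b * real (n - 2) / 3"
    have y: "0 \<le> y" using b by (simp add: y_def)
    have lower: "b * real n / 3 \<le> 1 + y"
      using b n2 by (simp add: y_def of_nat_diff field_simps)
    have "(b * real n / 3) ^ 3 \<le> (1 + y) ^ 3"
      using lower b by (intro power_mono) auto
    also have "\<dots> \<le> exp y ^ 3"
      using y by (intro power_mono exp_ge_add_one_self) auto
    also have "\<dots> = exp (b * real (n - 2))"
      by (simp add: y_def flip: exp_of_nat_mult)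
    also have "\<dots> \<le> exp (c * real (n - 2))"
      using b by (simp add: mult_right_mono)
    finally have ge: "(b * real n / 3) ^ 3 \<le> exp (c * real (n - 2))" .
    have "27 < \<delta> * (b ^ 3 * real n)"
      using big assms b by (simp add: divide_less_eq mult_ac)
    then have "27 * real n ^ 2 < \<delta> * (b ^ 3 * real n) * real n ^ 2"
      using n2 by (intro mult_strict_right_mono) auto
    then have "real n ^ 2 < \<delta> * (b * real n / 3) ^ 3"
      by (simp add: power_divide power_mult_distrib power2_eq_square power3_eq_cube mult_ac)
    also have "\<dots> \<le> \<delta> * exp (c * real (n - 2))" using ge assms by (intro mult_left_mono) auto
    finally have "real n ^ 2 * exp (- c * real (n - 2)) < \<delta> * exp (c * real (n - 2)) * exp (- c * real (n - 2))"
      by (intro mult_strict_right_mono) auto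
    then show ?thesis by (simp add: mult.assoc flip: exp_add)
  qed
  then show thesis by (rule that)
qed

text \<open>Without convergence, the value of \<open>lim\<close> in \<open>pi_co\<close> would carry
  no information. Sampling makes the sequence nearly decreasing: each term bounds all much later
  terms up to a small error.\<close>

lemma ex_co_convergent: "convergent (\<lambda>n. real (ex_co n VF EF) / real n)"
proof -
  define a where "a n = real (ex_co n VF EF) / real n" for n
  have a0: "0 \<le> a n" for n by (simp add: a_def)
  have "Cauchy a"
    unfolding Cauchy_def
  proof (intro allI impI)
    fix r :: real assume r: "r > 0"
    define \<epsilon> where "\<epsilon> = r / 4"
    have \<epsilon>: "\<epsilon> > 0" "\<epsilon>\<^sup>2 / 4 > 0" using r by (auto simp: \<epsilon>_def)
    obtain n0 where n0: "\<And>n. n \<ge> n0 \<Longrightarrow> real n ^ 2 * exp (- (\<epsilon>\<^sup>2 / 4) * real (n - 2)) < 1 / 2"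
      using square_mult_exp_small[OF \<epsilon>(2), of "1 / 2"] by auto
    define m0 where "m0 = max n0 (2 + nat \<lceil>2 / \<epsilon>\<rceil>)"
    have sample: "a n - 2 * \<epsilon> \<le> a m" if "m \<ge> m0" "2 * m ^ 2 < n" for m n
      unfolding a_def
    proof (rule ex_co_sample[OF \<epsilon>(1)])
      have "m \<ge> 2 + nat \<lceil>2 / \<epsilon>\<rceil>" using that by (simp add: m0_def)
      then show "m \<ge> 2" "2 / \<epsilon> \<le> real m" by linarith+
      show "real m ^ 2 * exp (- (\<epsilon>\<^sup>2 / 4) * real (m - 2)) < 1 / 2"
        by (rule n0) (use that in \<open>simp add: m0_def\<close>)
    qed (use that in auto)
    \<comment> \<open>From \<open>m0\<close> on the sequence stays above \<open>s\<close>. Far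
      beyond an index \<open>m\<close> that nearly attains the infimum it also stays below
      \<open>s + 3 * \<epsilon>\<close>, and \<open>\<epsilon> = r / 4\<close> makes this window
      shorter than \<open>r\<close>.\<close>
    define s where "s = Inf (a ` {m0..})"
    have bdd: "bdd_below (a ` {m0..})" using a0 by (auto intro!: bdd_belowI[of _ 0])
    have low: "s \<le> a n" if "n \<ge> m0" for n
      unfolding s_def by (rule cInf_lower[OF _ bdd]) (use that in auto)
    have "\<exists>y\<in>a ` {m0..}. y < s + \<epsilon>"
      unfolding s_def by (rule cInf_lessD) (use \<epsilon> in auto)
    then obtain m where m: "m \<ge> m0" "a m < s + \<epsilon>" by auto
    have up: "a n < s + 3 * \<epsilon>" if "n > 2 * m ^ 2" for n
      using sample[OF m(1) that] m(2) by linarith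
    show "\<exists>M. \<forall>i\<ge>M. \<forall>j\<ge>M. dist (a i) (a j) < r"
    proof (intro exI allI impI)
      fix i j assume ij: "max m0 (2 * m ^ 2 + 1) \<le> i" "max m0 (2 * m ^ 2 + 1) \<le> j"
      then have "s \<le> a i" "s \<le> a j" "a i < s + 3 * \<epsilon>" "a j < s + 3 * \<epsilon>"
        using low up by auto
      then show "dist (a i) (a j) < r" using \<epsilon>(1) by (auto simp: dist_real_def \<epsilon>_def abs_less_iff)
    qed
  qed
  then show ?thesis unfolding a_def by (simp add: Cauchy_convergent)
qed

subsection \<open>Non-vanishing 3-graphs have positive codegree density\<close>

text \<open>Each vertex \<open>u\<close> has a random row \<open>c u\<close>, and the sum makes the
  colour symmetric. Once the rows of \<open>u\<close> and \<open>v\<close> are known, the colours of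
  \<open>uw\<close> and \<open>vw\<close> depend on the row of \<open>w\<close> only, so the rows
  are the coordinates of a product set to which \<open>card_few_hits\<close> applies.\<close>

definition pair_col :: "nat \<Rightarrow> (nat \<Rightarrow> nat \<Rightarrow> nat) \<Rightarrow> nat \<Rightarrow> nat \<Rightarrow> nat" where
  "pair_col M c u v = (c u v + c v u) mod M"

text \<open>The default prevents a pair from pointing to a cell of one of its own vertices; a pair
  in two different cells then always has candidates for a third vertex.\<close>

definition third_cell :: "nat \<Rightarrow> (nat \<Rightarrow> nat \<Rightarrow> nat) \<Rightarrow> nat \<Rightarrow> nat \<Rightarrow> nat" where
  "third_cell M c u v = (if pair_col M c u v \<in> {u mod M, v mod M}
     then LEAST k. k \<notin> {u mod M, v mod M} else pair_col M c u v)"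

text \<open>The vertex set is partitioned into the residue classes modulo \<open>M\<close>.\<close>

definition cyc_edge :: "nat \<Rightarrow> (nat \<Rightarrow> nat \<Rightarrow> nat) \<Rightarrow> nat \<Rightarrow> nat \<Rightarrow> nat \<Rightarrow> bool" where
  "cyc_edge M c x y z \<longleftrightarrow>
    (x mod M \<noteq> y mod M \<and> y mod M \<noteq> z mod M \<and> x mod M \<noteq> z mod M \<and>
       third_cell M c x y = z mod M \<and> third_cell M c x z = y mod M \<and> third_cell M c y z = x mod M) \<or>
    (x < y \<and> x mod M = y mod M \<and> z mod M = (x + 2) mod M \<and>
       third_cell M c x z = (x + 1) mod M \<and> third_cell M c y z = (x + M - 1) mod M)"

definition cyc_graph :: "nat \<Rightarrow> nat \<Rightarrow> (nat \<Rightarrow> nat \<Rightarrow> nat) \<Rightarrow> nat set set" where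
  "cyc_graph M n c = {e. \<exists>x y z. e = {x, y, z} \<and> card e = 3 \<and> e \<subseteq> {..<M * n} \<and> cyc_edge M c x y z}"

lemma pair_col_commute: "pair_col M c u v = pair_col M c v u"
  by (simp add: pair_col_def add.commute)

lemma third_cell_commute: "third_cell M c u v = third_cell M c v u"
  by (simp add: third_cell_def pair_col_commute insert_commute)

lemma third_cell_less:
  assumes "M \<ge> 3"
  shows "third_cell M c u v < M" "third_cell M c u v \<notin> {u mod M, v mod M}"
proof -
  have "\<exists>k<3. k \<notin> {u mod M, v mod M}"
  proof (rule ccontr)
    assume "\<not> ?thesis"
    then have *: "\<And>k. k < 3 \<Longrightarrow> k \<in> {u mod M, v mod M}" by blast
    have "{0, 1, 2} \<subseteq> {u mod M, v mod M}" using *[of 0] *[of 1] *[of 2] by simp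
    then have "card {0, 1, 2 :: nat} \<le> card {u mod M, v mod M}" by (intro card_mono) auto
    then show False by (simp add: card_insert_if split: if_splits)
  qed
  then obtain k where k: "k < 3" "k \<notin> {u mod M, v mod M}" by blast
  let ?L = "LEAST k. k \<notin> {u mod M, v mod M}"
  have "?L \<le> k" using k(2) by (rule Least_le)
  moreover have "?L \<notin> {u mod M, v mod M}" using k(2) by (rule LeastI)
  ultimately show "third_cell M c u v < M" "third_cell M c u v \<notin> {u mod M, v mod M}"
    using k(1) assms by (auto simp: third_cell_def pair_col_def)
qed

lemma is_3graph_cyc_graph: "is_3graph {..<M * n} (cyc_graph M n c)"
  by (auto simp: is_3graph_def cyc_graph_def)

lemma mod_shift_eq:
  fixes M :: nat
  assumes "M > 0" "a mod M = b mod M"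
  shows "(a + k) mod M = (b + k) mod M"
  using assms(2) by (metis mod_add_left_eq)

text \<open>A copy of \<open>F\<close> misses two cyclically consecutive cells. Cutting the cycle there orders the cells,
  and a pair gets its colour from the position of its third cell.\<close>

lemma copy_in_cyc_graph_vanishing:
  assumes M: "M \<ge> 4" and fin: "finite VF" and emb: "inj_on g VF" "\<And>e. e \<in> EF \<Longrightarrow> g ` e \<in> cyc_graph M n c"
    and EF: "\<And>e. e \<in> EF \<Longrightarrow> e \<subseteq> VF"
    and miss: "\<And>v. v \<in> VF \<Longrightarrow> (g v + (M - b)) mod M \<ge> 2" and b: "b < M"
  shows "vanishing VF EF"
proof -
  have M0: "M > 0" using M by simp
  \<comment> \<open>The position of a cell after the cut. The two missed cells \<open>b\<close> and
    its successor get positions \<open>0\<close> and \<open>1\<close>.\<close>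
  define P where "P k = (k + (M - b)) mod M" for k
  have PM: "P k < M" for k using M by (simp add: P_def)
  have Pmod: "P (k mod M) = P k" for k by (simp add: P_def mod_add_left_eq)
  have Pinj: "k mod M = l mod M" if "P k = P l" for k l
  proof -
    have "(k + (M - b) + b) mod M = (l + (M - b) + b) mod M"
      by (rule mod_shift_eq[OF M0]) (use that in \<open>simp add: P_def\<close>)
    then show ?thesis using b by simp
  qed
  define T where "T = third_cell M c"
  define m where "m = Suc (Max (g ` VF))"
  \<comment> \<open>The lexicographic order by position of the cell and then by vertex, written in
    base \<open>m\<close>.\<close>
  define pos where "pos v = P (g v) * m + g v" for v
  \<comment> \<open>Red if the third cell lies above both cells, green if it lies below both, blue
    otherwise. Pairs inside a cell are red regardless of where they point, since their edges go to
    the cell two steps further.\<close>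
  define key where "key u v = (if u mod M = v mod M then 0 else
    if P (T u v) > max (P u) (P v) then 0 else if P (T u v) < min (P u) (P v) then 2 else (1 :: nat))" for u v
  have key_comm: "key u v = key v u" for u v
    unfolding key_def T_def by (simp add: third_cell_commute max.commute min.commute eq_commute)
  define col where "col s = key (Min (g ` s)) (Max (g ` s))" for s
  have col: "col {x, y} = key (g x) (g y)" for x y
    unfolding col_def using key_comm by (simp add: min_def max_def)
  have gm: "g x < m" if "x \<in> VF" for x using that fin by (simp add: m_def le_imp_less_Suc)
  have pdiv: "pos x div m = P (g x)" and pmod: "pos x mod m = g x" if "x \<in> VF" for x
    using gm[OF that] by (simp_all add: pos_def)
  have inj: "inj_on pos VF"
  proof (rule inj_onI)
    fix x y assume xy: "x \<in> VF" "y \<in> VF" "pos x = pos y"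
    then have "g x = g y" using pmod[of x] pmod[of y] by simp
    then show "x = y" using emb(1) xy by (auto simp: inj_on_def)
  qed
  have lex: "P (g x) < P (g y) \<or> (P (g x) = P (g y) \<and> g x < g y)"
    if "pos x < pos y" "x \<in> VF" "y \<in> VF" for x y
  proof -
    have "P (g x) \<le> P (g y)"
      using div_le_mono[OF less_imp_le[OF that(1)], of m] pdiv that by simp
    moreover have "g x < g y" if "P (g x) = P (g y)" using \<open>pos x < pos y\<close> that by (simp add: pos_def)
    ultimately show ?thesis by linarith
  qed
  have "col {x, y} = 0 \<and> col {x, z} = 1 \<and> col {y, z} = 2"
    if V: "x \<in> VF" "y \<in> VF" "z \<in> VF" and e: "{x, y, z} \<in> EF" and pos: "pos x < pos y" "pos y < pos z" for x y z
  proof -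
    define X Y Z where "X = g x" and "Y = g y" and "Z = g z"
    have lx: "P X < P Y \<or> (P X = P Y \<and> X < Y)" "P Y < P Z \<or> (P Y = P Z \<and> Y < Z)"
      using lex[OF pos(1) V(1,2)] lex[OF pos(2) V(2,3)] by (auto simp: X_def Y_def Z_def)
    have ge2: "P X \<ge> 2" "P Y \<ge> 2" "P Z \<ge> 2"
      using miss V by (auto simp: P_def X_def Y_def Z_def)
    obtain u v w where uvw: "{X, Y, Z} = {u, v, w}" and ce: "cyc_edge M c u v w"
      using emb(2)[OF e] by (auto simp: cyc_graph_def X_def Y_def Z_def)
    have "key X Y = 0 \<and> key X Z = 1 \<and> key Y Z = 2"
      using ce unfolding cyc_edge_def
    proof
      assume a: "u mod M \<noteq> v mod M \<and> v mod M \<noteq> w mod M \<and> u mod M \<noteq> w mod M \<and>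
       third_cell M c u v = w mod M \<and> third_cell M c u w = v mod M \<and> third_cell M c v w = u mod M"
      have ne: "X \<noteq> Y" "Y \<noteq> Z" "X \<noteq> Z" using lx by auto
      have *: "X mod M \<noteq> Y mod M \<and> Y mod M \<noteq> Z mod M \<and> X mod M \<noteq> Z mod M \<and>
        T X Y = Z mod M \<and> T X Z = Y mod M \<and> T Y Z = X mod M"
      proof -
        have X: "X = u \<or> X = v \<or> X = w" and Y: "Y = u \<or> Y = v \<or> Y = w" and Z: "Z = u \<or> Z = v \<or> Z = w"
          using uvw by blast+
        show ?thesis
          using X Y Z ne a third_cell_commute[of M c u v] third_cell_commute[of M c u w] third_cell_commute[of M c v w]
          unfolding T_def by (elim disjE) simp_all
      qed
      then have "P X \<noteq> P Y" "P Y \<noteq> P Z" using Pinj by blast+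
      then have "P X < P Y" "P Y < P Z" using lx by auto
      then show ?thesis using * by (simp add: key_def Pmod)
    next
      assume b: "u < v \<and> u mod M = v mod M \<and> w mod M = (u + 2) mod M \<and>
       third_cell M c u w = (u + 1) mod M \<and> third_cell M c v w = (u + M - 1) mod M"
      have PS: "P (u + k) = (P u + k) mod M" for k
        unfolding P_def by (simp add: mod_add_right_eq ac_simps)
      have uv: "P v = P u" using b Pmod by metis
      have Pge: "P u \<ge> 2" "P w \<ge> 2"
      proof -
        have "u \<in> {X, Y, Z}" "w \<in> {X, Y, Z}" using uvw by auto
        then show "P u \<ge> 2" "P w \<ge> 2" using ge2 by auto
      qed
      have Pw: "P w = (P u + 2) mod M" using b Pmod PS[of 2] by metis
      \<comment> \<open>If the step by two wrapped around, \<open>w\<close> would be in position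
        \<open>0\<close> or \<open>1\<close>, which the copy misses.\<close>
      have lt: "P u + 2 < M"
      proof (rule ccontr)
        assume "\<not> ?thesis"
        then have "(P u + 2) mod M = P u + 2 - M"
          using PM[of u] M by (simp add: mod_if)
        then show False using Pw Pge PM[of u] by simp
      qed
      then have Pw': "P w = P u + 2" using Pw by simp
      \<comment> \<open>The pair \<open>uw\<close> points between the two cells and is blue;
        \<open>vw\<close> points just below them and is green. The smaller vertex \<open>u\<close>
        comes first in the ordering, as the definition of the edge demands.\<close>
      have t1: "P (T u w) = P u + 1" using b Pmod PS[of 1] lt unfolding T_def by simp
      have t2: "P (T v w) = P u - 1"
      proof -
        have "P (T v w) = P (u + (M - 1))" using b Pmod M unfolding T_def by simp
        also have "\<dots> = (P u + (M - 1)) mod M" by (rule PS)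
        also have "\<dots> = (P u - 1 + M) mod M" using Pge M by simp
        also have "\<dots> = P u - 1" using PM[of u] by simp
        finally show ?thesis .
      qed
      have X: "X = u \<or> X = v \<or> X = w" and Y: "Y = u \<or> Y = v \<or> Y = w" and Z: "Z = u \<or> Z = v \<or> Z = w"
        using uvw by blast+
      have u: "u \<in> {X, Y, Z}" "v \<in> {X, Y, Z}" "w \<in> {X, Y, Z}" using uvw by auto
      have top: "P y \<le> P u + 2 \<and> (P y = P u + 2 \<longrightarrow> y = w)" if "y = u \<or> y = v \<or> y = w" for y
        using that uv Pw' by (elim disjE) simp_all
      have "w \<noteq> X"
      proof
        assume "w = X"
        then have "P X = P u + 2" using Pw' by simp
        then have "P Y = P u + 2" "X < Y" using lx(1) top[OF Y] by linarith+
        then show False using top[OF Y] \<open>w = X\<close> by simp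
      qed
      moreover have "w \<noteq> Y"
      proof
        assume "w = Y"
        then have "P Y = P u + 2" using Pw' by simp
        then have "P Z = P u + 2" "Y < Z" using lx(2) top[OF Z] by linarith+
        then show False using top[OF Z] \<open>w = Y\<close> by simp
      qed
      ultimately have Zw: "Z = w" using u(3) by blast
      have "u \<noteq> w" "v \<noteq> w" using Pw' uv by auto
      then have "u = X \<or> u = Y" "v = X \<or> v = Y" using u(1,2) Zw by blast+
      moreover have "u < v" using b by simp
      moreover have "X < Y"
      proof -
        have "P X = P u" "P Y = P u" using X Y \<open>w \<noteq> X\<close> \<open>w \<noteq> Y\<close> uv by auto
        then show ?thesis using lx(1) by simp
      qed
      ultimately have "X = u \<and> Y = v" by auto
      moreover have "u mod M \<noteq> w mod M" "v mod M \<noteq> w mod M"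
      proof -
        show "u mod M \<noteq> w mod M" using Pmod[of u] Pmod[of w] Pw' by force
        show "v mod M \<noteq> w mod M" using Pmod[of v] Pmod[of w] Pw' uv by force
      qed
      ultimately show ?thesis
        using Zw b t1 t2 Pw' uv Pge by (simp add: key_def)
    qed
    then show ?thesis unfolding col by (simp add: X_def Y_def Z_def)
  qed
  then show ?thesis unfolding vanishing_def using inj by blast
qed

section \<open>A random colouring with large codegrees\<close>

lemma card_residue_class:
  assumes "k < M"
  shows "n \<le> card {w \<in> {..<M * n}. w mod M = k}"
proof -
  have "(\<lambda>q. k + M * q) ` {..<n} \<subseteq> {w \<in> {..<M * n}. w mod M = k}"
  proof
    fix w assume "w \<in> (\<lambda>q. k + M * q) ` {..<n}"
    then obtain q where q: "q < n" "w = k + M * q" by auto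
    have "w < M + M * q" using q assms by simp
    also have "\<dots> = M * Suc q" by simp
    also have "\<dots> \<le> M * n" using q(1) by (intro mult_le_mono2) simp
    finally show "w \<in> {w \<in> {..<M * n}. w mod M = k}" using q assms by simp
  qed
  moreover have "inj_on (\<lambda>q. k + M * q) {..<n}" using assms by (auto simp: inj_on_def)
  ultimately have "card {..<n} \<le> card {w \<in> {..<M * n}. w mod M = k}"
    by (intro card_inj_on_le[of "\<lambda>q. k + M * q"]) auto
  then show ?thesis by simp
qed

lemma residue_shift:
  fixes M :: nat
  assumes "\<alpha> < M"
  obtains a where "a < M" "(s + a) mod M = \<alpha>"
proof -
  have M: "M > 0" using assms by simp
  have "(s + (\<alpha> + M - s mod M) mod M) mod M = (s mod M + (\<alpha> + M - s mod M)) mod M"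
    by (simp add: mod_add_left_eq mod_add_right_eq)
  also have "s mod M + (\<alpha> + M - s mod M) = \<alpha> + M"
    using mod_less_divisor[OF M, of s] by linarith
  finally have "(s + (\<alpha> + M - s mod M) mod M) mod M = \<alpha>" using assms by simp
  then show thesis using that M by (meson mod_less_divisor)
qed

text \<open>A random row \<open>g\<close> of a third vertex enters the two pair colours through its
  entries at \<open>u\<close> and at \<open>v\<close>. These are independent and uniform modulo
  \<open>M\<close>, so prescribed values occur with probability \<open>1 / M ^ 2\<close>.\<close>

lemma card_rows:
  fixes M :: nat
  assumes V: "finite V" and uv: "u \<in> V" "v \<in> V" "u \<noteq> v" and \<alpha>\<beta>: "\<alpha> < M" "\<beta> < M"
  shows "1 / real M ^ 2 * real (card (PiE V (\<lambda>_. {..<M}))) \<le>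
    real (card {g \<in> PiE V (\<lambda>_. {..<M}). (s + g u) mod M = \<alpha> \<and> (s' + g v) mod M = \<beta>})"
proof -
  let ?O = "PiE V (\<lambda>_. {..<M})"
  let ?F = "\<lambda>a b. of_bool ((s + a) mod M = \<alpha> \<and> (s' + b) mod M = \<beta>) :: real"
  have finO: "finite ?O" using V by (intro finite_PiE) auto
  obtain a0 where a0: "a0 < M" "(s + a0) mod M = \<alpha>" using residue_shift[OF \<alpha>\<beta>(1)] .
  obtain b0 where b0: "b0 < M" "(s' + b0) mod M = \<beta>" using residue_shift[OF \<alpha>\<beta>(2)] .
  have M0: "real M > 0" using \<alpha>\<beta> by simp
  have "real (card {..<M}) ^ 2 * real (card {..<M}) ^ card ({} :: 'a set) *
      (\<Sum>x\<in>?O. ?F (x u) (x v) * (\<Prod>k\<in>({} :: 'a set). (1 :: real)))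
    = real (card {..<M}) ^ card V * (\<Sum>a\<in>{..<M}. \<Sum>b\<in>{..<M}. ?F a b * (\<Prod>k\<in>({} :: 'a set). \<Sum>c\<in>{..<M}. 1))"
    by (rule sum_PiE_two[OF V _ uv, where F = ?F and w = "\<lambda>_ _ _ _. 1"]) auto
  then have eq: "real M ^ 2 * (\<Sum>x\<in>?O. ?F (x u) (x v)) = real M ^ card V * (\<Sum>a<M. \<Sum>b<M. ?F a b)"
    by simp
  have "1 = ?F a0 b0" using a0 b0 by simp
  also have "\<dots> \<le> (\<Sum>b<M. ?F a0 b)" by (rule member_le_sum) (use b0 in auto)
  also have "\<dots> \<le> (\<Sum>a<M. \<Sum>b<M. ?F a b)"
    by (rule member_le_sum[of a0 "{..<M}" "\<lambda>a. \<Sum>b<M. ?F a b"]) (use a0 in \<open>auto intro!: sum_nonneg\<close>)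
  finally have "real M ^ card V * 1 \<le> real M ^ card V * (\<Sum>a<M. \<Sum>b<M. ?F a b)"
    using M0 by (intro mult_left_mono) auto
  also have "\<dots> = real M ^ 2 * (\<Sum>x\<in>?O. ?F (x u) (x v))" by (rule eq[symmetric])
  also have "(\<Sum>x\<in>?O. ?F (x u) (x v)) = real (card {g \<in> ?O. (s + g u) mod M = \<alpha> \<and> (s' + g v) mod M = \<beta>})"
    using finO by (simp add: Int_def)
  finally show ?thesis using M0 V by (simp add: card_PiE field_simps)
qed

text \<open>A union bound over \<open>u\<close>, \<open>v\<close>, the cell \<open>k\<close> and the
  two prescribed colours: at most \<open>(M * n) ^ 2 * M ^ 3\<close> events. Each has small
  probability by \<open>card_few_hits\<close> with the rows as coordinates, \<open>1 / M ^ 2\<close>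
  as the probability of a hit, and half of it given away. A cell has at least \<open>n - 2\<close>
  vertices besides \<open>u\<close> and \<open>v\<close>.\<close>

lemma good_colouring:
  assumes M: "M > 0" and n: "real M ^ 5 * (real n ^ 2 * exp (- ((1 / real M ^ 2 / 2)\<^sup>2 / 4) * real (n - 2))) < 1"
  obtains c where "\<And>u v k \<alpha> \<beta>. u < M * n \<Longrightarrow> v < M * n \<Longrightarrow> u \<noteq> v \<Longrightarrow> k < M \<Longrightarrow> \<alpha> < M \<Longrightarrow> \<beta> < M \<Longrightarrow>
    1 / real M ^ 2 / 2 * real (n - 2) \<le> real (card {w \<in> {..<M * n}. w mod M = k \<and> w \<notin> {u, v} \<and>
      pair_col M c u w = \<alpha> \<and> pair_col M c v w = \<beta>})"
proof -
  define V where "V = {..<M * n}"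
  define S where "S = PiE V (\<lambda>_. {..<M})"
  let ?O = "PiE V (\<lambda>_. S)"
  define p where "p = 1 / real M ^ 2"
  define \<epsilon> where "\<epsilon> = p / 2"
  have p: "0 \<le> p" "p \<le> 1" "0 \<le> \<epsilon>" using M by (auto simp: p_def \<epsilon>_def)
  have finV: "finite V" by (simp add: V_def)
  have finS: "finite S" "S \<noteq> {}" using M by (auto simp: S_def finV PiE_eq_empty_iff intro!: finite_PiE)
  have finO: "finite ?O" using finV finS by (intro finite_PiE) auto
  define K where "K u v k = {w \<in> V. w mod M = k} - {u, v}" for u v k
  define R where "R u v \<alpha> \<beta> w a b g \<longleftrightarrow> (a w + g u) mod M = \<alpha> \<and> (b w + g v) mod M = \<beta>"
    for u v \<alpha> \<beta> w :: nat and a b g :: "nat \<Rightarrow> nat"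
  define Idx where "Idx = {(u, v, k, \<alpha>, \<beta>). u \<in> V \<and> v \<in> V \<and> u \<noteq> v \<and> k < M \<and> \<alpha> < M \<and> \<beta> < M}"
  define B where "B = (\<lambda>(u, v, k, \<alpha>, \<beta>). {c \<in> ?O. True \<and>
    real (card {w \<in> K u v k. R u v \<alpha> \<beta> w (c u) (c v) (c w)}) < (p - \<epsilon>) * real (card (K u v k))})"
  have cK: "n - 2 \<le> card (K u v k)" if "k < M" for u v k
  proof -
    have "card {w \<in> V. w mod M = k} - card {u, v} \<le> card (K u v k)"
      unfolding K_def by (rule diff_card_le_card_Diff) simp
    moreover have "card {u, v} \<le> 2" by (simp add: card_insert_if)
    moreover have "n \<le> card {w \<in> V. w mod M = k}" unfolding V_def by (rule card_residue_class[OF that])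
    ultimately show ?thesis by linarith
  qed
  let ?e = "exp (- (\<epsilon>\<^sup>2 / 4) * real (n - 2))"
  have bad: "real (card (B i)) \<le> ?e * real (card ?O)" if "i \<in> Idx" for i
  proof -
    obtain u v k \<alpha> \<beta> where i: "i = (u, v, k, \<alpha>, \<beta>)" by (metis prod_cases5)
    have uv: "u \<in> V" "v \<in> V" "u \<noteq> v" and k: "k < M" and ab: "\<alpha> < M" "\<beta> < M"
      using that by (auto simp: Idx_def i)
    have "real (card {c \<in> ?O. True \<and> real (card {w \<in> K u v k. R u v \<alpha> \<beta> w (c u) (c v) (c w)}) < (p - \<epsilon>) * real (card (K u v k))})
      \<le> exp (- (\<epsilon>\<^sup>2 / 4) * real (card (K u v k))) * real (card S) ^ card V"
    proof (rule card_few_hits[where good = "\<lambda>_ _. True" and R = "R u v \<alpha> \<beta>", OF finV finS uv _ p])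
      show "K u v k \<subseteq> V - {u, v}" by (auto simp: K_def)
      fix w a b assume "w \<in> K u v k" "a \<in> S" "b \<in> S"
      show "p * real (card S) \<le> real (card {g \<in> S. R u v \<alpha> \<beta> w a b g})"
        unfolding p_def S_def R_def by (rule card_rows[OF finV uv ab])
    qed
    also have "\<dots> \<le> ?e * real (card S) ^ card V"
      using cK[OF k, of u v] by (intro mult_right_mono) (auto intro!: mult_left_mono)
    finally show ?thesis using finV by (simp add: B_def i card_PiE)
  qed
  have Idx: "finite Idx" "real (card Idx) \<le> real M ^ 5 * real n ^ 2"
  proof -
    have sub: "Idx \<subseteq> V \<times> V \<times> {..<M} \<times> {..<M} \<times> {..<M}" by (auto simp: Idx_def)
    have f: "finite (V \<times> V \<times> {..<M} \<times> {..<M} \<times> {..<M})" using finV by auto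
    show "finite Idx" by (rule finite_subset[OF sub f])
    have "card Idx \<le> card (V \<times> V \<times> {..<M} \<times> {..<M} \<times> {..<M})" by (rule card_mono[OF f sub])
    also have "\<dots> = M ^ 5 * n ^ 2"
      by (simp add: V_def card_cartesian_product power2_eq_square eval_nat_numeral)
    finally show "real (card Idx) \<le> real M ^ 5 * real n ^ 2"
      by (metis of_nat_le_iff of_nat_mult of_nat_power)
  qed
  have "\<exists>c\<in>?O. \<forall>i\<in>Idx. c \<notin> B i"
  proof (rule ccontr)
    assume "\<not> ?thesis"
    then have "?O \<subseteq> (\<Union>i\<in>Idx. B i)" by blast
    moreover have fB: "finite (B i)" for i by (rule finite_subset[OF _ finO]) (auto simp: B_def)
    ultimately have "card ?O \<le> card (\<Union>i\<in>Idx. B i)" using Idx(1) by (intro card_mono) auto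
    also have "\<dots> \<le> (\<Sum>i\<in>Idx. card (B i))" by (rule card_UN_le[OF Idx(1)])
    finally have "real (card ?O) \<le> (\<Sum>i\<in>Idx. real (card (B i)))"
      by (simp only: of_nat_le_iff[symmetric, where 'a = real] of_nat_sum)
    also have "\<dots> \<le> real (card Idx) * (?e * real (card ?O))" by (rule sum_bounded_above[OF bad])
    also have "\<dots> \<le> real M ^ 5 * real n ^ 2 * (?e * real (card ?O))" by (intro mult_right_mono Idx(2)) auto
    also have "\<dots> = real M ^ 5 * (real n ^ 2 * ?e) * real (card ?O)" by simp
    also have "\<dots> < 1 * real (card ?O)"
    proof (rule mult_strict_right_mono)
      show "real M ^ 5 * (real n ^ 2 * ?e) < 1" using n by (simp only: \<epsilon>_def p_def)
      show "0 < real (card ?O)" using finO finS by (simp add: card_gt_0_iff PiE_eq_empty_iff)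
    qed
    finally show False by simp
  qed
  then obtain c where c: "\<And>i. i \<in> Idx \<Longrightarrow> c \<notin> B i" "c \<in> ?O" by blast
  show thesis
  proof (rule that)
    fix u v k \<alpha> \<beta> assume *: "u < M * n" "v < M * n" "u \<noteq> v" "k < M" "\<alpha> < M" "\<beta> < M"
    then have "(u, v, k, \<alpha>, \<beta>) \<in> Idx" by (simp add: Idx_def V_def)
    from c(1)[OF this] c(2)
    have "(p - \<epsilon>) * real (card (K u v k)) \<le> real (card {w \<in> K u v k. R u v \<alpha> \<beta> w (c u) (c v) (c w)})"
      by (simp add: B_def)
    moreover have "(p - \<epsilon>) * real (n - 2) \<le> (p - \<epsilon>) * real (card (K u v k))"
      using cK[OF *(4), of u v] p by (intro mult_left_mono) (auto simp: \<epsilon>_def)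
    moreover have "{w \<in> K u v k. R u v \<alpha> \<beta> w (c u) (c v) (c w)} = {w \<in> {..<M * n}. w mod M = k \<and> w \<notin> {u, v} \<and>
      pair_col M c u w = \<alpha> \<and> pair_col M c v w = \<beta>}"
      by (auto simp: K_def V_def R_def pair_col_def)
    moreover have "p - \<epsilon> = 1 / real M ^ 2 / 2" by (simp add: \<epsilon>_def p_def)
    ultimately show "1 / real M ^ 2 / 2 * real (n - 2) \<le> real (card {w \<in> {..<M * n}. w mod M = k \<and> w \<notin> {u, v} \<and>
      pair_col M c u w = \<alpha> \<and> pair_col M c v w = \<beta>})" by simp
  qed
qed

lemma mod_add_neq:
  fixes M :: nat
  assumes "0 < k" "k < M"
  shows "(u + k) mod M \<noteq> u mod M"
proof
  assume "(u + k) mod M = u mod M"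
  then have "M dvd (u + k) - u" by (subst mod_eq_dvd_iff_nat[symmetric]) auto
  then show False using assms by (auto dest: dvd_imp_le)
qed

text \<open>Prescribed pair colours become prescribed third cells as long as they avoid the cells of
  the pair itself, so that the default in \<open>third_cell\<close> does not interfere. This holds
  for the colours needed in both kinds of edges; \<open>M \<ge> 4\<close> separates the cells
  \<open>i - 1\<close> and \<open>i + 2\<close>.\<close>

lemma codeg_cyc_graph:
  assumes M: "M \<ge> 4" and uv: "u < M * n" "v < M * n" "u \<noteq> v"
    and c: "\<And>u v k \<alpha> \<beta>. u < M * n \<Longrightarrow> v < M * n \<Longrightarrow> u \<noteq> v \<Longrightarrow> k < M \<Longrightarrow> \<alpha> < M \<Longrightarrow> \<beta> < M \<Longrightarrow>
    D \<le> real (card {w \<in> {..<M * n}. w mod M = k \<and> w \<notin> {u, v} \<and>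
      pair_col M c u w = \<alpha> \<and> pair_col M c v w = \<beta>})"
  shows "D \<le> real (codeg (cyc_graph M n c) {u, v})"
proof -
  let ?K = "\<lambda>u v k \<alpha> \<beta>. {w \<in> {..<M * n}. w mod M = k \<and> w \<notin> {u, v} \<and>
      pair_col M c u w = \<alpha> \<and> pair_col M c v w = \<beta>}"
  have M3: "M \<ge> 3" and M0: "M > 0" using M by auto
  have finE: "finite (cyc_graph M n c)"
    by (rule finite_subset[of _ "Pow {..<M * n}"]) (auto simp: cyc_graph_def)
  have third: "third_cell M c x w = \<gamma>" if "pair_col M c x w = \<gamma>" "\<gamma> \<noteq> x mod M" "\<gamma> \<noteq> w mod M" for x w \<gamma>
    using that by (simp add: third_cell_def)
  have main: "D \<le> real (codeg (cyc_graph M n c) {u, v})"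
    if uv: "u < M * n" "v < M * n" "u \<noteq> v" and k: "k < M" "\<alpha> < M" "\<beta> < M"
      and edge: "\<And>w. w \<in> ?K u v k \<alpha> \<beta> \<Longrightarrow> cyc_edge M c u v w" for u v k \<alpha> \<beta>
  proof -
    have "card (?K u v k \<alpha> \<beta>) \<le> codeg (cyc_graph M n c) {u, v}"
    proof (rule neighbours_le_codeg[OF finE uv(3)])
      fix w assume w: "w \<in> ?K u v k \<alpha> \<beta>"
      then have "card {u, v, w} = 3" "{u, v, w} \<subseteq> {..<M * n}" using uv by (auto simp: card_insert_if)
      then show "{u, v, w} \<in> cyc_graph M n c" unfolding cyc_graph_def using edge[OF w] by blast
    qed auto
    then show ?thesis using c[OF uv k] by linarith
  qed
  have same: "D \<le> real (codeg (cyc_graph M n c) {u, v})"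
    if uv: "u < M * n" "v < M * n" "u < v" and cell: "u mod M = v mod M" for u v
  proof (rule main[of u v "(u + 2) mod M" "(u + 1) mod M" "(u + M - 1) mod M"])
    fix w assume w: "w \<in> ?K u v ((u + 2) mod M) ((u + 1) mod M) ((u + M - 1) mod M)"
    have "third_cell M c u w = (u + 1) mod M"
    proof (rule third)
      show "(u + 1) mod M \<noteq> u mod M" by (rule mod_add_neq) (use M in auto)
      show "(u + 1) mod M \<noteq> w mod M" using w mod_add_neq[of 1 M "u + 1"] M by auto
    qed (use w in auto)
    moreover have "third_cell M c v w = (u + M - 1) mod M"
    proof (rule third)
      show "(u + M - 1) mod M \<noteq> v mod M" using mod_add_neq[of "M - 1" M u] M cell by simp
      show "(u + M - 1) mod M \<noteq> w mod M" 
      proof -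
        have "u + 2 + (M - 3) = u + M - 1" using M by simp
        then show ?thesis using w mod_add_neq[of "M - 3" M "u + 2"] M by (simp del: add_2_eq_Suc')
      qed
    qed (use w in auto)
    ultimately show "cyc_edge M c u v w" unfolding cyc_edge_def using w uv cell by auto
  qed (use uv M0 in auto)
  consider "u mod M \<noteq> v mod M" | "u mod M = v mod M" "u < v" | "u mod M = v mod M" "v < u"
    using uv(3) by linarith
  then show ?thesis
  proof cases
    case 1
    show ?thesis
    proof (rule main[OF uv, of "third_cell M c u v" "v mod M" "u mod M"])
      fix w assume w: "w \<in> ?K u v (third_cell M c u v) (v mod M) (u mod M)"
      have wc: "w mod M = third_cell M c u v" "w mod M \<notin> {u mod M, v mod M}"
        using w third_cell_less(2)[OF M3, of c u v] by auto
      have "third_cell M c u w = v mod M" "third_cell M c v w = u mod M"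
        using third[of u w "v mod M"] third[of v w "u mod M"] w wc 1 by auto
      then show "cyc_edge M c u v w" unfolding cyc_edge_def using wc 1 by auto
    qed (use third_cell_less(1)[OF M3] M0 in auto)
  next
    case 2
    then show ?thesis using same uv by blast
  next
    case 3
    then show ?thesis using same[of v u] uv by (simp add: insert_commute)
  qed
qed

text \<open>The \<open>M\<close> cells form \<open>card VF + 1\<close> disjoint pairs of neighbours,
  one more than there are vertices to hit them.\<close>

lemma missing_cells:
  fixes g :: "'b \<Rightarrow> nat"
  assumes fin: "finite VF" and M: "M = 2 * card VF + 2"
  obtains b where "b < M" "\<And>v. v \<in> VF \<Longrightarrow> 2 \<le> (g v + (M - b)) mod M"
proof -
  have "card ((\<lambda>v. g v mod M div 2) ` VF) \<le> card VF" by (rule card_image_le[OF fin])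
  then have "\<not> {..card VF} \<subseteq> (\<lambda>v. g v mod M div 2) ` VF"
    using card_mono[of "(\<lambda>v. g v mod M div 2) ` VF" "{..card VF}"] fin by auto
  then obtain i where i: "i \<le> card VF" "\<And>v. v \<in> VF \<Longrightarrow> g v mod M div 2 \<noteq> i" by auto
  show thesis
  proof (rule that[of "2 * i"])
    show b: "2 * i < M" using i M by simp
    fix v assume v: "v \<in> VF"
    define r where "r = g v mod M"
    have r: "r < M" "r \<noteq> 2 * i" "r \<noteq> 2 * i + 1" using i(2)[OF v] M by (auto simp: r_def)
    have "(g v + (M - 2 * i)) mod M = (r + (M - 2 * i)) mod M" by (simp add: r_def mod_add_left_eq)
    also have "\<dots> \<ge> 2"
    proof (cases "r < 2 * i")
      case True
      then have "r + (M - 2 * i) < M" using b by simp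
      then have "(r + (M - 2 * i)) mod M = r + (M - 2 * i)" by simp
      then show ?thesis using i(1) M by simp
    next
      case False
      then have "r + (M - 2 * i) = M + (r - 2 * i)" using b by simp
      moreover have "(M + (r - 2 * i)) mod M = r - 2 * i"
        unfolding mod_add_self1 using r(1) by (intro mod_less) simp
      ultimately have "(r + (M - 2 * i)) mod M = r - 2 * i" by (simp only:)
      then show ?thesis using False r by simp
    qed
    finally show "2 \<le> (g v + (M - 2 * i)) mod M" .
  qed
qed

text \<open>The construction lives on multiples of the number \<open>M\<close> of cells, hence a
  bound for arbitrarily large \<open>n\<close> only. As the limit exists, this is enough.\<close>

lemma ex_co_linear_if_not_vanishing:
  fixes VF :: "'b set"
  assumes F: "is_3graph VF EF" and nv: "\<not> vanishing VF EF"
  obtains \<alpha> :: real where "\<alpha> > 0" "\<And>N. \<exists>n\<ge>N. n > 0 \<and> \<alpha> \<le> real (ex_co n VF EF) / real n"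
proof -
  have fin: "finite VF" and EF: "\<And>e. e \<in> EF \<Longrightarrow> e \<subseteq> VF \<and> card e = 3"
    using F by (auto simp: is_3graph_def)
  \<comment> \<open>The empty 3-graph is vanishing. Excluding it gives
    \<open>M \<ge> 4\<close>.\<close>
  have "VF \<noteq> {}"
  proof
    assume "VF = {}"
    then have "EF = {}" using EF by fastforce
    then have "vanishing VF EF" using \<open>VF = {}\<close> by (simp add: vanishing_def)
    then show False using nv by simp
  qed
  define M where "M = 2 * card VF + 2"
  have M: "M \<ge> 4" using \<open>VF \<noteq> {}\<close> fin by (simp add: M_def Suc_le_eq card_gt_0_iff)
  have M0: "real M > 0" "M > 0" using M by auto
  \<comment> \<open>The codegree \<open>(n - 2) / (2 * M\<^sup>2)\<close> is at least
    \<open>n / (4 * M\<^sup>2)\<close>, to be compared with \<open>M * n\<close> vertices.\<close>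
  define \<alpha> where "\<alpha> = 1 / (4 * real M ^ 3)"
  have \<alpha>: "\<alpha> > 0" using M0 by (simp add: \<alpha>_def)
  have "(1 / real M ^ 2 / 2)\<^sup>2 / 4 > 0" "1 / real M ^ 5 > 0" using M0 by auto
  from square_mult_exp_small[OF this] obtain n0 where
    n0: "\<And>n. n \<ge> n0 \<Longrightarrow> real n ^ 2 * exp (- ((1 / real M ^ 2 / 2)\<^sup>2 / 4) * real (n - 2)) < 1 / real M ^ 5"
    by blast
  have "\<exists>n\<ge>N. n > 0 \<and> \<alpha> \<le> real (ex_co n VF EF) / real n" for N
  proof -
    define n where "n = n0 + N + 4"
    have "real M ^ 5 * (real n ^ 2 * exp (- ((1 / real M ^ 2 / 2)\<^sup>2 / 4) * real (n - 2))) < real M ^ 5 * (1 / real M ^ 5)"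
      using M0 by (intro mult_strict_left_mono n0) (auto simp: n_def)
    then have small: "real M ^ 5 * (real n ^ 2 * exp (- ((1 / real M ^ 2 / 2)\<^sup>2 / 4) * real (n - 2))) < 1"
      using M0 by simp
    obtain c where c: "\<And>u v k \<alpha> \<beta>. u < M * n \<Longrightarrow> v < M * n \<Longrightarrow> u \<noteq> v \<Longrightarrow> k < M \<Longrightarrow> \<alpha> < M \<Longrightarrow> \<beta> < M \<Longrightarrow>
      1 / real M ^ 2 / 2 * real (n - 2) \<le> real (card {w \<in> {..<M * n}. w mod M = k \<and> w \<notin> {u, v} \<and>
        pair_col M c u w = \<alpha> \<and> pair_col M c v w = \<beta>})"
      apply (rule good_colouring[OF M0(2) small])
      subgoal premises p by (rule p(1)) (rule p(2))
      done
    let ?E = "cyc_graph M n c" and ?D = "1 / real M ^ 2 / 2 * real (n - 2)"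
    have free: "\<not> contains_copy {..<M * n} ?E VF EF"
    proof
      assume "contains_copy {..<M * n} ?E VF EF"
      then obtain g where g: "inj_on g VF" "\<forall>e\<in>EF. g ` e \<in> ?E" unfolding contains_copy_def by blast
      obtain b where b: "b < M" "\<And>v. v \<in> VF \<Longrightarrow> 2 \<le> (g v + (M - b)) mod M"
        using missing_cells[OF fin M_def, of g] by blast
      have "vanishing VF EF"
        by (rule copy_in_cyc_graph_vanishing[OF M fin g(1) _ _ b(2,1)]) (use g(2) EF in auto)
      then show False using nv by simp
    qed
    have big: "M * n \<ge> n" "n \<ge> 4" using M0(2) by (auto simp: n_def)
    have "nat \<lceil>?D\<rceil> \<le> min_codeg {..<M * n} ?E"
    proof (rule min_codeg_ge)
      fix u v assume "u \<in> {..<M * n}" "v \<in> {..<M * n}" "u \<noteq> v"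
      then have "?D \<le> real (codeg ?E {u, v})" by (intro codeg_cyc_graph[OF M _ _ _ c]) auto
      then show "nat \<lceil>?D\<rceil> \<le> codeg ?E {u, v}" by linarith
    qed (use order_trans[OF big(2,1)] in auto)
    also have "\<dots> \<le> ex_co (M * n) VF EF" by (rule ex_co_ge[OF is_3graph_cyc_graph free])
    finally have "?D \<le> real (ex_co (M * n) VF EF)" by linarith
    moreover have "\<alpha> * real (M * n) \<le> ?D"
    proof -
      have "real n / 2 \<le> real (n - 2)" using big by (simp add: of_nat_diff)
      then have "1 / real M ^ 2 / 2 * (real n / 2) \<le> ?D" by (intro mult_left_mono) auto
      moreover have "1 / real M ^ 2 / 2 * (real n / 2) = \<alpha> * real (M * n)"
        using M0 by (simp add: \<alpha>_def power2_eq_square power3_eq_cube)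
      ultimately show ?thesis by simp
    qed
    ultimately have "\<alpha> * real (M * n) \<le> real (ex_co (M * n) VF EF)" by linarith
    moreover have "M * n > 0" using big M0 by simp
    moreover have "N \<le> M * n" by (rule order_trans[OF _ big(1)]) (simp add: n_def)
    ultimately show ?thesis by (intro exI[of _ "M * n"]) (auto simp: pos_le_divide_eq)
  qed
  with \<alpha> show thesis by (rule that)
qed

section \<open>Combining both halves\<close>

lemma vanishing_if_pi_co_0:
  assumes "is_3graph VF EF" "pi_co VF EF = 0"
  shows "vanishing VF EF"
proof (rule ccontr)
  assume "\<not> vanishing VF EF"
  then obtain \<alpha> :: real where \<alpha>: "\<alpha> > 0" "\<And>N. \<exists>n\<ge>N. n > 0 \<and> \<alpha> \<le> real (ex_co n VF EF) / real n"
    using ex_co_linear_if_not_vanishing[OF assms(1)] by metis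
  \<comment> \<open>Convergence makes \<open>pi_co VF EF = 0\<close> a statement about all large
    \<open>n\<close>, which contradicts the lower bound \<open>\<alpha>\<close> on a
    subsequence.\<close>
  have "(\<lambda>n. real (ex_co n VF EF) / real n) \<longlonglongrightarrow> 0"
    using ex_co_convergent[of VF EF] assms(2) unfolding pi_co_def convergent_LIMSEQ_iff by simp
  then have "eventually (\<lambda>n. real (ex_co n VF EF) / real n < \<alpha>) sequentially"
    using \<alpha>(1) by (rule order_tendstoD)
  then obtain N where "\<And>n. n \<ge> N \<Longrightarrow> real (ex_co n VF EF) / real n < \<alpha>"
    unfolding eventually_sequentially by blast
  then show False using \<alpha>(2)[of N] by (meson not_less)
qed

theorem theorem1p1:
  fixes VF :: "'b set" and EF :: "'b set set"
  assumes "is_3graph VF EF"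
    and "pi_co VF EF = 0"
  shows "pi_unif VF EF = 0"
proof -
  let ?A = "{d. 0 \<le> d \<and> d \<le> 1 \<and> (\<forall>\<eta>>0. \<forall>n0::nat. \<exists>(V::nat set) E.
        is_3graph V E \<and> \<not> contains_copy V E VF EF \<and> unif_dense d \<eta> V E \<and> card V \<ge> n0)}"
  have "d = 0" if "d \<in> ?A" for d :: real
  proof (rule ccontr)
    assume "d \<noteq> 0"
    then have d: "0 < d" "d \<le> 1" using that by auto
    obtain \<eta> n0 where "\<eta> > 0" and copy: "\<And>(V :: nat set) E. is_3graph V E \<Longrightarrow> unif_dense d \<eta> V E \<Longrightarrow>
      n0 \<le> card V \<Longrightarrow> contains_copy V E VF EF"
      using vanishing_contained[OF assms(1) vanishing_if_pi_co_0[OF assms] d, where 'v = nat] by metis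
    then obtain V :: "nat set" and E where "is_3graph V E" "\<not> contains_copy V E VF EF"
      "unif_dense d \<eta> V E" "card V \<ge> n0"
      using that \<open>d \<in> ?A\<close> by blast
    then show False using copy by blast
  qed
  then have eq: "{0} \<union> ?A = {0}" by blast
  have "pi_unif VF EF = Sup {0}" unfolding pi_unif_def eq ..
  then show ?thesis by simp
qed

end
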